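(* Let $p>3$ be a prime. If $p\equiv 1\pmod 3$ and $p=x^2+3y^2$ with $x,y\in\mathbb{Z}$, then $$\sum_{k=0}^{p-1}\frac{D_k}{4^k}\equiv\sum_{k=0}^{p-1}\frac{D_k}{16^k}\equiv 4x^2-2p-\frac{p^2}{4x^2}\pmod{p^3}.$$ If $p\equiv 2\pmod 3$, then $$\sum_{k=0}^{p-1}\frac{D_k}{4^k}\equiv-2\sum_{k=0}^{p-1}\frac{D_k}{16^k}\equiv\frac{p^2}{2}\binom{\frac{p-1}{2}}{\frac{p-5}{6}}^{-2}\pmod{p^3}.$$
   Context: For $n\ge 0$ the $n$th Domb number is $D_n=\sum_{k=0}^n\binom{n}{k}^2\binom{2k}{k}\binom{2n-2k}{n-k}$. Congruences modulo $p^r$ between rational numbers mean that the difference lies in $p^r\mathbb{Z}_{p}$, where $\mathbb{Z}_p$ is the ring of $p$-adic integers. *)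

theory Defs
  imports "HOL-Number_Theory.Number_Theory"
begin

definition domb :: "nat \<Rightarrow> nat" where
  "domb n = (\<Sum>k=0..n. (n choose k)\<^sup>2 * (2 * k choose k) * ((2 * n - 2 * k) choose (n - k)))"

text \<open>The rational numbers that are \<open>p\<close>-adic integers, i.e. the intersection of the rationals
  with the ring of \<open>p\<close>-adic integers. The second component of \<^const>\<open>quotient_of\<close> is the
  (positive) denominator in lowest terms.\<close>

definition padic_int_rats :: "nat \<Rightarrow> rat set" where
  "padic_int_rats p = {x. \<not> int p dvd snd (quotient_of x)}"

text \<open>\<open>rat_cong p r a b\<close> means that \<open>a\<close> and \<open>b\<close> are congruent modulo \<open>p ^ r\<close>. As \<open>a - b\<close> is
  rational, a witness \<open>z\<close> for it lying in \<open>p ^ r\<close> times the \<open>p\<close>-adic integers is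
  itself rational, so nothing is lost by ranging over \<^const>\<open>padic_int_rats\<close>.\<close>

definition rat_cong :: "nat \<Rightarrow> nat \<Rightarrow> rat \<Rightarrow> rat \<Rightarrow> bool" where
  "rat_cong p r a b \<longleftrightarrow> (\<exists>z\<in>padic_int_rats p. a - b = of_nat p ^ r * z)"

end

theory Submission
  imports Defs "HOL-Computational_Algebra.Polynomial"
begin

text \<open>The proof is elementary and takes place in the rational numbers whose denominator is prime to
\<open>p\<close>, modulo \<open>p\<^sup>3\<close>.

From two sums over \<open>n\<close> to two sums over \<open>k\<close>. The Domb numbers satisfy a recurrence of order two,
and so do the sums
\<open>\<Sum>k. C(2k,k)\<^sup>2 C(3k,k) C(n+k,3k) 4^(n-2k)\<close> and
\<open>\<Sum>k. (-1)\<^sup>k C(2k,k)\<^sup>2 C(3k,k) C(n+2k,3k) 16^(n-k)\<close>, which therefore both equal the \<open>n\<close>th Domb number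
(\<open>domb_eq_term4\<close>, \<open>domb_eq_term16\<close>). In these forms the summation over \<open>n < p\<close> is a hockey stick
identity. What remains is a sum over \<open>k\<close> of \<open>p / (3k+1)\<close> times \<open>(C(2k,k) / 4\<^sup>k)\<^sup>2\<close> times a product of
factors \<open>1 + a p / j\<close> (\<open>S4_eq\<close>, \<open>S16_eq\<close>).

Summation. Since \<open>p\<close> stands in front, products matter only modulo \<open>p\<^sup>2\<close> as long as \<open>3k+1\<close> is prime
to \<open>p\<close>. Modulo \<open>p\<^sup>2\<close> they agree with products for which the sum is a terminating balanced
hypergeometric series; Pfaff and Saalschuetz's formula turns it into a quotient of factorials
(\<open>saalschuetz_sum\<close>, \<open>T_eq\<close>). If \<open>p \<equiv> 2 (mod 3)\<close>, this quotient is itself divisible by \<open>p\<close>, so the rest is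
arithmetic modulo \<open>p\<close> with Wilson's theorem; in the second sum the term with \<open>3k+1 = 2p\<close> is added
(\<open>inert_S4\<close>, \<open>inert_S16\<close>). If \<open>p = 6h+1\<close>, the term with \<open>3k+1 = p\<close> has lost its factor \<open>p\<close> and
contributes a second order correction. With \<open>C = C(3h,h)\<close>, and \<open>b\<close>, \<open>c\<close> for the harmonic numbers with
indices \<open>2h\<close>, \<open>3h\<close>, and \<open>t\<close> for the sum of \<open>1/j\<^sup>2\<close> over \<open>j \<le> 2h\<close>, both sums become
\<open>C\<^sup>2 exp (p (b - 2c/3) + p\<^sup>2 t/12)\<close>, by relations between harmonic numbers that come from
\<open>j \<mapsto> p - j\<close> and \<open>j \<mapsto> 2j\<close> (\<open>S4_split\<close>, \<open>S16_split\<close>).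

Arithmetic. Let \<open>J\<close> be the Jacobi sum of a cubic and the quadratic character modulo \<open>p\<close>, with values
in the integers modulo \<open>p\<^sup>3\<close>. Counting shows \<open>J = X + e \<surd>(-3)\<close> with \<open>X\<^sup>2 + 3 e\<^sup>2 = p\<close>
(\<open>norm_eq\<close>, \<open>J_cong\<close>); such a representation of \<open>p\<close> is unique up to signs (\<open>norm_form_unique\<close>), and
since \<open>J\<close> is a unit and its conjugate is \<open>p / J\<close>, the number \<open>4 x\<^sup>2 - 2 p - p\<^sup>2 / (4 x\<^sup>2)\<close> is \<open>J\<^sup>2\<close>
(\<open>unit_root_square\<close>). On the other hand \<open>y = s^((p-1)/2)\<close> is the Legendre symbol \<open>\<epsilon>\<close> of \<open>s\<close> only modulo \<open>p\<close>,
but then \<open>(15 y - 10 y\<^sup>3 + 3 y\<^sup>5) / 8\<close> is \<open>\<epsilon>\<close> modulo \<open>p\<^sup>3\<close>. Expanding this by the binomial theorem leaves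
a combination of six binomial coefficients (\<open>J_binomial\<close>), and this is \<open>- C exp (p (b/2 - c/3) + p\<^sup>2 t/24)\<close>
(\<open>jacobi_binom_cong\<close>), whose square is the value of the two sums.\<close>

section \<open>Two alternative formulas for the Domb numbers\<close>

text \<open>The reciprocal factorial, extended by zero to the negative integers. The rule
\<open>inv_fact_pred\<close> then holds for all integers, so that summands need no case distinction at the ends of
their range.\<close>

definition inv_fact :: "int \<Rightarrow> rat" where
  "inv_fact i = (if i < 0 then 0 else 1 / fact (nat i))"

lemma inv_fact_pred: "inv_fact (i - 1) = of_int i * inv_fact i"
proof (cases "i \<le> 0")
  case True
  then show ?thesis by (auto simp: inv_fact_def)
next
  case False
  then have m: "i = int (nat (i - 1)) + 1" by simp
  have "inv_fact (int m + 1 - 1) = of_int (int m + 1) * inv_fact (int m + 1)" for m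
  proof -
    have "nat (int m + 1) = Suc m" by simp
    moreover have "(1 + of_nat m :: rat) \<noteq> 0" by (metis of_nat_Suc of_nat_neq_0)
    ultimately show ?thesis by (simp add: inv_fact_def add.commute)
  qed
  then show ?thesis using m by metis
qed

text \<open>The common factor of the summands \<open>term4\<close> and \<open>term16\<close>; the \<open>(3k)!\<close> of \<open>C(3k,k)\<close> has cancelled
against that of \<open>C(n+k,3k)\<close> or \<open>C(n+2k,3k)\<close>.\<close>

definition cb_weight :: "nat \<Rightarrow> rat" where
  "cb_weight k = fact (2 * k) / (16 ^ k * fact k ^ 5)"

lemma cb_weight_Suc: "8 * (of_nat (Suc k) ^ 4 * cb_weight (Suc k)) = (2 * of_nat k + 1) * cb_weight k"
proof -
  have gen: "8 * (z ^ 4 * (2 * y * z * A / (16 * q * (z ^ 5 * f)))) = y * (A / (q * f))"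
    if "z \<noteq> 0" "q \<noteq> 0" "f \<noteq> 0" for z y A q f :: rat
    using that by (simp add: divide_simps eval_nat_numeral)
  have "fact (2 * Suc k) = 2 * (2 * of_nat k + 1) * of_nat (Suc k) * (fact (2 * k) :: rat)"
    by (simp add: algebra_simps)
  moreover have "fact (Suc k) ^ 5 = of_nat (Suc k) ^ 5 * (fact k ^ 5 :: rat)"
    by (simp add: power_mult_distrib)
  moreover have "(16 :: rat) ^ Suc k = 16 * 16 ^ k" by simp
  moreover have "8 * (of_nat (Suc k) ^ 4 * (2 * (2 * of_nat k + 1) * of_nat (Suc k) * fact (2 * k) /
     (16 * 16 ^ k * (of_nat (Suc k) ^ 5 * fact k ^ 5)))) =
     (2 * of_nat k + 1) * (fact (2 * k) / (16 ^ k * fact k ^ 5) :: rat)"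
    by (rule gen) (simp_all del: of_nat_Suc)
  ultimately show ?thesis
    unfolding cb_weight_def by (simp only: mult.assoc)
qed

text \<open>The recurrence
\<open>(n+1)\<^sup>3 f(n+1) - 2 (2n+1) (5n\<^sup>2+5n+2) f(n) + 64 n\<^sup>3 f(n-1) = 0\<close>, written with \<open>n = N + 1\<close>.\<close>

definition domb_rec :: "(nat \<Rightarrow> rat) \<Rightarrow> bool" where
  "domb_rec f \<longleftrightarrow> (\<forall>N. (of_nat N + 2) ^ 3 * f (N + 2)
     - 2 * (2 * of_nat N + 3) * (5 * (of_nat N + 1)\<^sup>2 + 5 * (of_nat N + 1) + 2) * f (N + 1)
     + 64 * (of_nat N + 1) ^ 3 * f N = 0)"

lemma domb_rec_unique:
  assumes f: "domb_rec f" and g: "domb_rec g" and "f 0 = g 0" "f 1 = g 1"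
  shows "f n = g n"
proof (induction n rule: less_induct)
  case (less n)
  show ?case
  proof (cases "n < 2")
    case True
    then show ?thesis using assms(3,4) by (metis One_nat_def less_2_cases_iff)
  next
    case False
    then obtain N where N: "n = N + 2" by (metis add.commute le_Suc_ex not_less)
    have eq: "f N = g N" "f (N + 1) = g (N + 1)" using less N by auto
    have "(of_nat N + 2) ^ 3 * f (N + 2) = (of_nat N + 2 :: rat) ^ 3 * g (N + 2)"
      using f[unfolded domb_rec_def, rule_format, of N] g[unfolded domb_rec_def, rule_format, of N]
      unfolding eq by linarith
    moreover have "(of_nat N + 2 :: rat) ^ 3 \<noteq> 0"
      by (metis of_nat_add of_nat_numeral of_nat_eq_0_iff power_not_zero add_2_eq_Suc' nat.distinct(1))
    ultimately show ?thesis using N by simp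
  qed
qed

text \<open>Creative telescoping: if the recurrence operator, applied to the summand, gives a
difference in \<open>k\<close>, then the sum satisfies the recurrence.\<close>

lemma domb_rec_sumI:
  fixes F G :: "nat \<Rightarrow> nat \<Rightarrow> rat"
  assumes "\<And>N k. (of_nat N + 2) ^ 3 * F (N + 2) k
     - 2 * (2 * of_nat N + 3) * (5 * (of_nat N + 1)\<^sup>2 + 5 * (of_nat N + 1) + 2) * F (N + 1) k
     + 64 * (of_nat N + 1) ^ 3 * F N k = G N (Suc k) - G N k"
    and "\<And>N. G N 0 = 0" "\<And>N. G N (N + 3) = 0"
    and vanish: "\<And>n k. k > n \<Longrightarrow> F n k = 0"
  shows "domb_rec (\<lambda>n. \<Sum>k\<le>n. F n k)"
  unfolding domb_rec_def
proof
  fix N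
  have ext: "(\<Sum>k\<le>n. F n k) = (\<Sum>k<N+3. F n k)" if "n \<le> N + 2" for n
    using that vanish by (intro sum.mono_neutral_left) auto
  have l1: "N + 1 \<le> N + 2" by simp
  have "(of_nat N + 2) ^ 3 * (\<Sum>k<N+3. F (N + 2) k)
     - 2 * (2 * of_nat N + 3) * (5 * (of_nat N + 1)\<^sup>2 + 5 * (of_nat N + 1) + 2) * (\<Sum>k<N+3. F (N + 1) k)
     + 64 * (of_nat N + 1) ^ 3 * (\<Sum>k<N+3. F N k) = (\<Sum>k<N+3. G N (Suc k) - G N k)"
    unfolding assms(1)[symmetric] by (simp add: sum.distrib sum_subtractf sum_distrib_left)
  also have "\<dots> = 0"
    unfolding sum_lessThan_telescope using assms(2,3) by simp
  finally show "(of_nat N + 2) ^ 3 * (\<Sum>k\<le>N + 2. F (N + 2) k)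
     - 2 * (2 * of_nat N + 3) * (5 * (of_nat N + 1)\<^sup>2 + 5 * (of_nat N + 1) + 2) * (\<Sum>k\<le>N + 1. F (N + 1) k)
     + 64 * (of_nat N + 1) ^ 3 * (\<Sum>k\<le>N. F N k) = 0"
    unfolding ext[of "N + 2", OF order.refl] ext[of "N + 1", OF l1] ext[of N, OF le_add1] .
qed

text \<open>This is \<open>C(2k,k)\<^sup>2 C(3k,k) C(n+k,3k) 4^(n-2k)\<close>.\<close>

definition term4 :: "nat \<Rightarrow> nat \<Rightarrow> rat" where
  "term4 n k = cb_weight k * fact (n + k) * 4 ^ n
     * inv_fact (int n - 2 * int k)"

text \<open>The three values of the summand at \<open>N\<close>, \<open>N+1\<close>, \<open>N+2\<close> and the certificate are
polynomial multiples of one common term \<open>b\<close>, so that telescoping is a polynomial identity. The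
certificates here and in the two analogous lemmas are the solutions of the linear system for the
coefficients of such a polynomial.\<close>

lemma domb_rec_term4: "domb_rec (\<lambda>n. \<Sum>k\<le>n. term4 n k)"
proof -
  define b :: "nat \<Rightarrow> nat \<Rightarrow> rat" where
    "b N k = cb_weight k * fact (N + k) * 4 ^ N
       * inv_fact (int N + 2 - 2 * int k)" for N k
  have f2: "fact (N + 2 + k) = (of_nat N + of_nat (k) + 1) * (of_nat N + of_nat (k) + 2) * (fact (N + k) :: rat)" for N k
    by (simp add: algebra_simps)
  have f1: "fact (N + 1 + k) = (of_nat N + of_nat (k) + 1) * (fact (N + k) :: rat)" for N k
    by (simp add: algebra_simps)
  have i1: "inv_fact (int N + 1 - 2 * int k) = (of_nat N + 2 - 2 * of_nat k) * inv_fact (int N + 2 - 2 * int k)" for N k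
    using inv_fact_pred[of "int N + 2 - 2 * int k"] by (simp add: algebra_simps)
  have i0: "inv_fact (int N - 2 * int k) = (of_nat N + 1 - 2 * of_nat k) * inv_fact (int N + 1 - 2 * int k)" for N k
    using inv_fact_pred[of "int N + 1 - 2 * int k"] by (simp add: algebra_simps)
  have F2: "term4 (N + 2) k = 16 * (of_nat N + of_nat k + 1) * (of_nat N + of_nat k + 2) * b N k" for N k
    unfolding term4_def b_def f2 of_nat_add by (simp add: power_add)
  have F1: "term4 (N + 1) k = 4 * (of_nat N + of_nat k + 1) * (of_nat N + 2 - 2 * of_nat k) * b N k" for N k
    unfolding term4_def b_def f1 of_nat_add of_nat_1 i1 by (simp add: power_add)
  have F0: "term4 N k = (of_nat N + 2 - 2 * of_nat k) * (of_nat N + 1 - 2 * of_nat k) * b N k" for N k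
    unfolding term4_def b_def i0 i1 by simp
  define B :: "nat \<Rightarrow> nat \<Rightarrow> rat" where "B N k = of_nat k ^ 4 * b N k" for N k
  have step: "8 * B N (Suc k) = (2 * of_nat k + 1) * (of_nat N + of_nat k + 1)
       * (of_nat N + 2 - 2 * of_nat k) * (of_nat N + 1 - 2 * of_nat k) * b N k" for N k
  proof -
    have "inv_fact (int N + 2 - 2 * int (Suc k)) = (of_nat N + 2 - 2 * of_nat k) * (of_nat N + 1 - 2 * of_nat k) * inv_fact (int N + 2 - 2 * int k)"
      using i0[of N k] i1[of N k] by simp
    moreover have "fact (N + Suc k) = (of_nat N + of_nat k + 1) * (fact (N + k) :: rat)"
      by (simp add: algebra_simps)
    moreover have "8 * (z * (w' * (y * f) * c * (x1 * x2 * g))) = v * y * x1 * x2 * (w * f * c * g)"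
      if "8 * (z * w') = v * w" for z w' y f c x1 x2 g v w :: rat
      using arg_cong[OF that, of "\<lambda>t. t * (y * f * c * x1 * x2 * g)"] by (simp add: mult_ac)
    ultimately show ?thesis
      unfolding B_def b_def by (simp only: cb_weight_Suc)
  qed
  show ?thesis
  proof (rule domb_rec_sumI[where G = "\<lambda>N k. - 192 * (3 * of_nat N + 4) * B N k"])
    fix N k
    have e: "- 192 * (3 * of_nat N + 4) * B N (Suc k) = - 24 * (3 * of_nat N + 4) * (8 * B N (Suc k))" by simp
    show "(of_nat N + 2) ^ 3 * term4 (N + 2) k
     - 2 * (2 * of_nat N + 3) * (5 * (of_nat N + 1)\<^sup>2 + 5 * (of_nat N + 1) + 2) * term4 (N + 1) k
     + 64 * (of_nat N + 1) ^ 3 * term4 N k = - 192 * (3 * of_nat N + 4) * B N (Suc k) - (- 192 * (3 * of_nat N + 4) * B N k)"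
      unfolding e step F2 F1 unfolding F0 B_def
      by (simp add: algebra_simps eval_nat_numeral)
  qed (auto simp: B_def b_def inv_fact_def term4_def)
qed

text \<open>This is \<open>(-1)\<^sup>k C(2k,k)\<^sup>2 C(3k,k) C(n+2k,3k) 16^(n-k)\<close>.\<close>

definition term16 :: "nat \<Rightarrow> nat \<Rightarrow> rat" where
  "term16 n k = (- 1) ^ k * cb_weight k * fact (n + 2 * k) * 16 ^ n
     * inv_fact (int n - int k)"

lemma domb_rec_term16: "domb_rec (\<lambda>n. \<Sum>k\<le>n. term16 n k)"
proof -
  define b :: "nat \<Rightarrow> nat \<Rightarrow> rat" where
    "b N k = (- 1) ^ k * cb_weight k * fact (N + 2 * k) * 16 ^ N
       * inv_fact (int N + 2 - int k)" for N k
  have f2: "fact (N + 2 + 2 * k) = (of_nat N + of_nat (2 * k) + 1) * (of_nat N + of_nat (2 * k) + 2) * (fact (N + 2 * k) :: rat)" for N k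
    by (simp add: algebra_simps)
  have f1: "fact (N + 1 + 2 * k) = (of_nat N + of_nat (2 * k) + 1) * (fact (N + 2 * k) :: rat)" for N k
    by (simp add: algebra_simps)
  have i1: "inv_fact (int N + 1 - int k) = (of_nat N + 2 - of_nat k) * inv_fact (int N + 2 - int k)" for N k
    using inv_fact_pred[of "int N + 2 - int k"] by (simp add: algebra_simps)
  have i0: "inv_fact (int N - int k) = (of_nat N + 1 - of_nat k) * inv_fact (int N + 1 - int k)" for N k
    using inv_fact_pred[of "int N + 1 - int k"] by (simp add: algebra_simps)
  have F2: "term16 (N + 2) k = 256 * (of_nat N + 2 * of_nat k + 1) * (of_nat N + 2 * of_nat k + 2) * b N k" for N k
    unfolding term16_def b_def f2 of_nat_add by (simp add: power_add)
  have F1: "term16 (N + 1) k = 16 * (of_nat N + 2 * of_nat k + 1) * (of_nat N + 2 - of_nat k) * b N k" for N k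
    unfolding term16_def b_def f1 of_nat_add of_nat_1 i1 by (simp add: power_add)
  have F0: "term16 N k = (of_nat N + 2 - of_nat k) * (of_nat N + 1 - of_nat k) * b N k" for N k
    unfolding term16_def b_def i0 i1 by simp
  define B :: "nat \<Rightarrow> nat \<Rightarrow> rat" where "B N k = of_nat k ^ 4 * b N k" for N k
  have step: "8 * B N (Suc k) = - (2 * of_nat k + 1) * (of_nat N + 2 * of_nat k + 1)
       * (of_nat N + 2 * of_nat k + 2) * (of_nat N + 2 - of_nat k) * b N k" for N k
  proof -
    have "inv_fact (int N + 2 - int (Suc k)) = (of_nat N + 2 - of_nat k) * inv_fact (int N + 2 - int k)"
      using i1[of N k] by (simp add: algebra_simps)
    moreover have "fact (N + 2 * Suc k) = (of_nat N + 2 * of_nat k + 1)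
       * (of_nat N + 2 * of_nat k + 2) * (fact (N + 2 * k) :: rat)"
      by (simp add: algebra_simps)
    moreover have "8 * (z * (- 1 * s * w' * (y1 * y2 * f) * c * (x * g))) = - v * y1 * y2 * x * (s * w * f * c * g)"
      if "8 * (z * w') = v * w" for z w' y1 y2 f c x s g v w :: rat
      using arg_cong[OF that, of "\<lambda>t. t * (s * y1 * y2 * f * c * x * g)"] by (simp add: mult_ac)
    ultimately show ?thesis
      unfolding B_def b_def power_Suc[of "- 1"] by (simp only: cb_weight_Suc)
  qed
  show ?thesis
  proof (rule domb_rec_sumI[where G = "\<lambda>N k. - 768 * (3 * of_nat N + 5) * B N k"])
    fix N k
    have e: "- 768 * (3 * of_nat N + 5) * B N (Suc k) = - 96 * (3 * of_nat N + 5) * (8 * B N (Suc k))" by simp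
    show "(of_nat N + 2) ^ 3 * term16 (N + 2) k
     - 2 * (2 * of_nat N + 3) * (5 * (of_nat N + 1)\<^sup>2 + 5 * (of_nat N + 1) + 2) * term16 (N + 1) k
     + 64 * (of_nat N + 1) ^ 3 * term16 N k = - 768 * (3 * of_nat N + 5) * B N (Suc k) - (- 768 * (3 * of_nat N + 5) * B N k)"
      unfolding e step F2 F1 unfolding F0 B_def
      by (simp add: algebra_simps eval_nat_numeral)
  qed (auto simp: B_def b_def inv_fact_def term16_def)
qed

text \<open>This is \<open>C(2i,i) / i!\<^sup>2\<close>, extended by zero to the negative integers, for the same reason as
\<open>inv_fact\<close>.\<close>

definition cb_ratio :: "int \<Rightarrow> rat" where
  "cb_ratio i = (if i < 0 then 0 else fact (2 * nat i) / fact (nat i) ^ 4)"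

lemma cb_ratio_pred: "2 * (2 * of_int i - 1) * cb_ratio (i - 1) = of_int i ^ 3 * cb_ratio i"
proof (cases "i \<le> 0")
  case True
  then show ?thesis by (auto simp: cb_ratio_def)
next
  case False
  then obtain m where m: "i = int (Suc m)"
    by (metis gr0_implies_Suc int_nat_eq linorder_not_le pos_int_cases)
  have 1: "nat (1 + int m) = Suc m" by simp
  have "(of_nat m + 1 :: rat) \<noteq> 0" by (metis of_nat_Suc add.commute of_nat_neq_0)
  moreover have "fact (2 * Suc m) = 2 * (2 * of_nat m + 1) * (of_nat m + 1) * (fact (2 * m) :: rat)"
    by (simp add: algebra_simps)
  moreover have "fact (Suc m) ^ 4 = (of_nat m + 1) ^ 4 * (fact m ^ 4 :: rat)"
    by (simp add: power_mult_distrib add.commute)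
  moreover have "2 * (2 * (z :: rat) - 1) * (A / f) = z ^ 3 * (2 * (2 * y + 1) * z * A / (z ^ 4 * f))"
    if "z \<noteq> 0" "z = y + 1" for z y A f
    using that(1) unfolding that(2)[symmetric, THEN eq_diff_eq[THEN iffD2]]
    by (simp add: divide_simps eval_nat_numeral)
  ultimately show ?thesis unfolding m by (simp add: cb_ratio_def 1 add.commute del: fact_Suc)
qed

definition def_term :: "nat \<Rightarrow> nat \<Rightarrow> rat" where
  "def_term n k = fact n ^ 2 * cb_ratio (int k) * cb_ratio (int n - int k)"

lemma domb_rec_def_term: "domb_rec (\<lambda>n. \<Sum>k\<le>n. def_term n k)"
proof -
  define j :: "nat \<Rightarrow> nat \<Rightarrow> int" where "j N k = int N + 2 - int k" for N k
  define d :: "int \<Rightarrow> rat" where "d i = 2 * of_int i - 1" for i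
  have d: "d i \<noteq> 0" for i 
  proof
    assume "d i = 0"
    then have "of_int (2 * i - 1) = (0::rat)" by (simp add: d_def)
    then have "2 * i - 1 = 0" by (simp only: of_int_eq_0_iff)
    then show False by presburger
  qed
  define b :: "nat \<Rightarrow> nat \<Rightarrow> rat" where
    "b N k = fact N ^ 2 * cb_ratio (int k) * cb_ratio (j N k) / (d (j N k) * d (j N k - 1))" for N k
  have c1: "cb_ratio (i - 1) = of_int i ^ 3 * cb_ratio i / (2 * d i)" for i
    using cb_ratio_pred[of i] d[of i] unfolding d_def by (simp add: field_simps)
  have c2: "cb_ratio (i - 2) = of_int i ^ 3 * of_int (i - 1) ^ 3 * cb_ratio i / (4 * d i * d (i - 1))" for i
    using c1[of "i - 1"] c1[of i] by (simp add: mult_ac)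
  have F2: "def_term (N + 2) k = ((of_nat N + 1) * (of_nat N + 2))\<^sup>2 * d (j N k) * d (j N k - 1) * b N k" for N k
  proof -
    have "int (N + 2) - int k = j N k" by (simp add: j_def)
    moreover have "fact (N + 2) = (of_nat N + 1) * (of_nat N + 2) * (fact N :: rat)" by (simp add: algebra_simps)
    ultimately show ?thesis
      using d unfolding def_term_def b_def by (simp add: power_mult_distrib del: fact_Suc)
  qed
  have F1: "def_term (N + 1) k = (of_nat N + 1)\<^sup>2 * of_int (j N k) ^ 3 / 2 * d (j N k - 1) * b N k" for N k
  proof -
    have *: "int (N + 1) - int k = j N k - 1" by (simp add: j_def)
    have "fact (N + 1) = (of_nat N + 1) * (fact N :: rat)" by (simp add: algebra_simps)
    then show ?thesis
      using d unfolding def_term_def b_def * c1 by (simp add: power_mult_distrib del: fact_Suc)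
  qed
  have F0: "def_term N k = of_int (j N k) ^ 3 * of_int (j N k - 1) ^ 3 / 4 * b N k" for N k
  proof -
    have *: "int N - int k = j N k - 2" by (simp add: j_def)
    show ?thesis
      using d unfolding def_term_def b_def * c2 by (simp add: field_simps)
  qed
  define B :: "nat \<Rightarrow> nat \<Rightarrow> rat" where "B N k = of_nat k ^ 3 * d (j N k - 1) * b N k" for N k
  have step: "B N (Suc k) = (2 * of_nat k + 1) * of_int (j N k) ^ 3 * b N k" for N k
  proof -
    have "(of_nat k + 1 :: rat) \<noteq> 0" by (metis of_nat_Suc add.commute of_nat_neq_0)
    moreover have "of_nat (Suc k) ^ 3 * cb_ratio (int (Suc k)) = 2 * (2 * of_nat k + 1) * cb_ratio (int k)"
      using cb_ratio_pred[of "int (Suc k)"] by (simp add: algebra_simps)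
    moreover have "j N (Suc k) = j N k - 1" by (simp add: j_def)
    moreover have "B N (Suc k) = of_nat (Suc k) ^ 3 * cb_ratio (int (Suc k)) * d (j N (Suc k) - 1) *
       (fact N ^ 2 * cb_ratio (j N (Suc k)) / (d (j N (Suc k)) * d (j N (Suc k) - 1)))"
       unfolding B_def b_def by simp
    moreover have "2 * v * c0 * e * (f * (q3 * c / (2 * d1)) / (d2 * e)) = v * q3 * (f * c0 * c / (d1 * d2))"
      if "e \<noteq> 0" for e f q3 c d1 d2 v c0 :: rat
      using that by simp
    ultimately show ?thesis
      using d unfolding b_def by (simp only: c1 simp_thms)
  qed
  define c :: "nat \<Rightarrow> nat \<Rightarrow> rat" where "c N k' = (let x = of_nat N; k = of_nat k' in
     -56 + 74*k - 30*k^2 + 4*k^3 - 216*x + 237*x*k - 78*x*k^2 + 8*x*k^3 - 326*x^2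
      + 278*x^2*k - 66*x^2*k^2 + 4*x^2*k^3 - 240*x^3 + 141*x^3*k - 18*x^3*k^2 - 86*x^4 + 26*x^4*k - 12*x^5)" for N k'
  show ?thesis
  proof (rule domb_rec_sumI[where G = "\<lambda>N k. c N k * B N k"])
    fix N k
    have dj: "d (j N k) = 2 * of_nat N + 3 - 2 * of_nat k" "d (j N k - 1) = 2 * of_nat N + 1 - 2 * of_nat k"
         "of_int (j N k) = (of_nat N + 2 - of_nat k :: rat)"
      by (simp_all add: d_def j_def)
    show "(of_nat N + 2) ^ 3 * def_term (N + 2) k
     - 2 * (2 * of_nat N + 3) * (5 * (of_nat N + 1)\<^sup>2 + 5 * (of_nat N + 1) + 2) * def_term (N + 1) k
     + 64 * (of_nat N + 1) ^ 3 * def_term N k = c N (Suc k) * B N (Suc k) - c N k * B N k"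
      unfolding F2 F1 step unfolding F0 B_def dj of_int_diff c_def Let_def of_nat_Suc of_int_1
      by (simp add: field_simps eval_nat_numeral)
  next
    fix N
    have "j N (N + 2) = 0" by (simp add: j_def)
    then show "c N (N + 3) * B N (N + 3) = 0"
      using step[of N "N + 2"] by (simp add: numeral_3_eq_3)
  qed (auto simp: B_def def_term_def cb_ratio_def)
qed

lemma domb_eq_def_term: "of_nat (domb n) = (\<Sum>k\<le>n. def_term n k)"
proof -
  have "of_nat ((n choose k)\<^sup>2 * (2 * k choose k) * ((2 * n - 2 * k) choose (n - k))) = def_term n k" if "k \<le> n" for k
  proof -
    have "nat (int n - int k) = n - k" using that by simp
    moreover have "2 * k - k = k" "2 * n - 2 * k - (n - k) = n - k" "2 * (n - k) = 2 * n - 2 * k" using that by auto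
    ultimately show ?thesis using that
      by (simp add: def_term_def cb_ratio_def binomial_fact eval_nat_numeral)
  qed
  then show ?thesis unfolding domb_def of_nat_sum by (simp add: atMost_atLeast0)
qed

lemma domb_eq_term4: "of_nat (domb n) = (\<Sum>k\<le>n. term4 n k)"
proof -
  have "(\<Sum>k\<le>n. def_term n k) = (\<Sum>k\<le>n. term4 n k)"
    by (rule domb_rec_unique[OF domb_rec_def_term domb_rec_term4])
       (simp_all add: term4_def cb_weight_def def_term_def cb_ratio_def inv_fact_def atMost_Suc)
  then show ?thesis by (simp add: domb_eq_def_term)
qed

lemma domb_eq_term16: "of_nat (domb n) = (\<Sum>k\<le>n. term16 n k)"
proof -
  have "(\<Sum>k\<le>n. def_term n k) = (\<Sum>k\<le>n. term16 n k)"
    by (rule domb_rec_unique[OF domb_rec_def_term domb_rec_term16])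
       (simp_all add: term16_def cb_weight_def def_term_def cb_ratio_def inv_fact_def atMost_Suc fact_numeral)
  then show ?thesis by (simp add: domb_eq_def_term)
qed

section \<open>Congruences between rational numbers\<close>

text \<open>The condition on the reduced fraction can be tested on any fraction; this makes the
closure properties below easy.\<close>

lemma padic_int_rats_iff:
  assumes p: "prime p"
  shows "x \<in> padic_int_rats p \<longleftrightarrow> (\<exists>a b. \<not> int p dvd b \<and> x = of_int a / of_int b)"
proof
  assume "x \<in> padic_int_rats p"
  then have *: "\<not> int p dvd snd (quotient_of x)" by (simp add: padic_int_rats_def)
  have "x = of_int (fst (quotient_of x)) / of_int (snd (quotient_of x))"
    by (simp add: quotient_of_div)
  with * show "\<exists>a b. \<not> int p dvd b \<and> x = of_int a / of_int b" by blast
next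
  assume "\<exists>a b. \<not> int p dvd b \<and> x = of_int a / of_int b"
  then obtain a b where b: "\<not> int p dvd b" and x: "x = of_int a / of_int b" by blast
  obtain c d where q: "quotient_of x = (c, d)" by (metis surj_pair)
  have d: "d > 0" and cop: "coprime c d" and x': "x = of_int c / of_int d"
    using quotient_of_denom_pos[OF q] quotient_of_coprime[OF q] quotient_of_div[OF q] by auto
  have "b \<noteq> 0" using b by auto
  then have "of_int (c * b) = (of_int (a * d) :: rat)" using x x' d by (simp add: field_simps)
  then have eq: "c * b = a * d" by (simp only: of_int_eq_iff)
  show "x \<in> padic_int_rats p"
  proof (rule ccontr)
    assume "x \<notin> padic_int_rats p"
    then have pd: "int p dvd d" by (simp add: padic_int_rats_def q)
    then have "int p dvd c * b" using eq by simp
    then have "int p dvd c" using b p by (simp add: prime_dvd_mult_iff)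
    with pd cop have "is_unit (int p)" by (rule coprime_common_divisor[rotated -1])
    then show False using p not_prime_unit[of "int p"] by simp
  qed
qed

locale prime_gt_3 =
  fixes p :: nat
  assumes prime_p: "prime p" and p_gt_3: "p > 3"
begin

abbreviation Zp :: "rat set" where "Zp \<equiv> padic_int_rats p"
abbreviation P :: rat where "P \<equiv> of_nat p"
abbreviation cong_p :: "nat \<Rightarrow> rat \<Rightarrow> rat \<Rightarrow> bool" where "cong_p r a b \<equiv> rat_cong p r a b"

lemma P_nz [simp]: "P \<noteq> 0" "p \<noteq> 0" "p > 0"
  using p_gt_3 by auto

lemma Zp_of_int [simp, intro]: "of_int a \<in> Zp"
proof -
  have "\<not> int p dvd 1" using p_gt_3 by simp
  then show ?thesis unfolding padic_int_rats_iff[OF prime_p]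
    by (intro exI[of _ a] exI[of _ 1]) auto
qed

lemma Zp_of_nat [simp, intro]: "of_nat a \<in> Zp"
  using Zp_of_int[of "int a"] by simp

lemma Zp_numeral [simp, intro]: "numeral a \<in> Zp" "1 \<in> Zp" "0 \<in> Zp"
  using Zp_of_int[of "numeral a"] Zp_of_int[of 1] Zp_of_int[of 0] by auto

lemma Zp_mult [simp, intro]: assumes "x \<in> Zp" "y \<in> Zp" shows "x * y \<in> Zp"
proof -
  obtain a b c d where *: "\<not> int p dvd b" "x = of_int a / of_int b" "\<not> int p dvd d" "y = of_int c / of_int d"
    using assms unfolding padic_int_rats_iff[OF prime_p] by blast
  have "\<not> int p dvd b * d" using * prime_p by (simp add: prime_dvd_mult_iff)
  moreover have "x * y = of_int (a * c) / of_int (b * d)" using * by simp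
  ultimately show ?thesis unfolding padic_int_rats_iff[OF prime_p] by blast
qed

lemma Zp_add [simp, intro]: assumes "x \<in> Zp" "y \<in> Zp" shows "x + y \<in> Zp"
proof -
  obtain a b c d where *: "\<not> int p dvd b" "x = of_int a / of_int b" "\<not> int p dvd d" "y = of_int c / of_int d"
    using assms unfolding padic_int_rats_iff[OF prime_p] by blast
  have "\<not> int p dvd b * d" using * prime_p by (simp add: prime_dvd_mult_iff)
  moreover have "b \<noteq> 0" "d \<noteq> 0" using * by auto
  then have "x + y = of_int (a * d + c * b) / of_int (b * d)" using * by (simp add: field_simps)
  ultimately show ?thesis unfolding padic_int_rats_iff[OF prime_p] by blast
qed

lemma Zp_minus [simp, intro]: "x \<in> Zp \<Longrightarrow> - x \<in> Zp"
  using Zp_mult[OF Zp_of_int[of "- 1"], of x] by simp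

lemma Zp_diff [simp, intro]: "x \<in> Zp \<Longrightarrow> y \<in> Zp \<Longrightarrow> x - y \<in> Zp"
  using Zp_add[of x "- y"] by simp

lemma Zp_power [simp, intro]: "x \<in> Zp \<Longrightarrow> x ^ n \<in> Zp"
  by (induction n) auto

lemma Zp_sum [simp, intro]: "(\<And>i. i \<in> A \<Longrightarrow> f i \<in> Zp) \<Longrightarrow> sum f A \<in> Zp"
  by (induction A rule: infinite_finite_induct) auto

lemma Zp_prod [simp, intro]: "(\<And>i. i \<in> A \<Longrightarrow> f i \<in> Zp) \<Longrightarrow> prod f A \<in> Zp"
  by (induction A rule: infinite_finite_induct) auto

definition unit_p :: "rat \<Rightarrow> bool" where
  "unit_p u \<longleftrightarrow> u \<noteq> 0 \<and> u \<in> Zp \<and> inverse u \<in> Zp"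

lemma unit_nz: "unit_p u \<Longrightarrow> u \<noteq> 0"
  by (simp add: unit_p_def)

lemma unit_Zp [simp, intro]: "unit_p u \<Longrightarrow> u \<in> Zp" "unit_p u \<Longrightarrow> inverse u \<in> Zp"
  by (simp_all add: unit_p_def)

lemma Zp_divide [simp, intro]: "x \<in> Zp \<Longrightarrow> unit_p u \<Longrightarrow> x / u \<in> Zp"
  by (simp add: divide_inverse)

lemma unit_mult [simp, intro]: "unit_p u \<Longrightarrow> unit_p v \<Longrightarrow> unit_p (u * v)"
  unfolding unit_p_def by auto

lemma unit_inverse [simp, intro]: "unit_p u \<Longrightarrow> unit_p (inverse u)"
  unfolding unit_p_def by auto

lemma unit_divide [simp, intro]: "unit_p u \<Longrightarrow> unit_p v \<Longrightarrow> unit_p (u / v)"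
  by (simp add: divide_inverse)

lemma unit_minus [simp]: "unit_p (- u) \<longleftrightarrow> unit_p u"
  unfolding unit_p_def by (metis Zp_minus add.inverse_inverse inverse_minus_eq neg_equal_0_iff_equal)

lemma unit_1 [simp]: "unit_p 1" unfolding unit_p_def by auto

lemma unit_power [simp, intro]: "unit_p u \<Longrightarrow> unit_p (u ^ n)"
  by (induction n) auto

lemma unit_prod [simp, intro]: "(\<And>i. i \<in> A \<Longrightarrow> unit_p (f i)) \<Longrightarrow> unit_p (prod f A)"
  by (induction A rule: infinite_finite_induct) auto

lemma unit_of_int: "unit_p (of_int a)" if "\<not> int p dvd a"
proof -
  have "a \<noteq> 0" using that by auto
  moreover have "inverse (of_int a) \<in> Zp"
    unfolding padic_int_rats_iff[OF prime_p] using that by (intro exI[of _ 1] exI[of _ a]) (auto simp: divide_inverse)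
  ultimately show ?thesis unfolding unit_p_def by auto
qed

lemma unit_of_nat: "unit_p (of_nat a)" if "\<not> p dvd a"
  using unit_of_int[of "int a"] that by simp

lemma unit_of_nat_less: "unit_p (of_nat a)" if "0 < a" "a < p"
  using that by (intro unit_of_nat) (auto dest: dvd_imp_le)

lemma unit_2 [simp]: "unit_p 2" and unit_3 [simp]: "unit_p 3"
  using unit_of_nat_less[of 2] unit_of_nat_less[of 3] p_gt_3 by auto

lemma unit_smooth [simp]:
  "unit_p 4" "unit_p 6" "unit_p 8" "unit_p 9" "unit_p 12" "unit_p 16" "unit_p 18" "unit_p 24" "unit_p 36"
  "unit_p 48" "unit_p 72"
  using unit_power[OF unit_2, of 2] unit_mult[OF unit_2 unit_3] unit_power[OF unit_2, of 3]
    unit_power[OF unit_3, of 2] unit_mult[OF unit_power[OF unit_2, of 2] unit_3]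
    unit_power[OF unit_2, of 4] unit_mult[OF unit_2 unit_power[OF unit_3, of 2]]
    unit_mult[OF unit_power[OF unit_2, of 3] unit_3]
    unit_mult[OF unit_power[OF unit_2, of 2] unit_power[OF unit_3, of 2]]
    unit_mult[OF unit_power[OF unit_2, of 4] unit_3]
    unit_mult[OF unit_power[OF unit_2, of 3] unit_power[OF unit_3, of 2]]
  by simp_all

lemma cong_iff: "cong_p r x y \<longleftrightarrow> (\<exists>z\<in>Zp. x = y + P ^ r * z)"
  unfolding rat_cong_def by (metis add_diff_cancel_left' diff_add_cancel add.commute)

lemma congI: "x = y + P ^ r * z \<Longrightarrow> z \<in> Zp \<Longrightarrow> cong_p r x y"
  unfolding cong_iff by blast

lemma congE: assumes "cong_p r x y" obtains z where "z \<in> Zp" "x = y + P ^ r * z"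
  using assms unfolding cong_iff by blast

lemma cong_refl [simp, intro]: "cong_p r x x"
  by (rule congI[of _ _ _ 0]) auto

lemma cong_sym: assumes "cong_p r x y" shows "cong_p r y x"
proof -
  obtain z where "z \<in> Zp" "x = y + P ^ r * z" using assms by (rule congE)
  then show ?thesis by (intro congI[of _ _ _ "- z"]) auto
qed

lemma cong_trans [trans]: assumes "cong_p r x y" "cong_p r y z" shows "cong_p r x z"
proof -
  obtain a b where "a \<in> Zp" "x = y + P ^ r * a" "b \<in> Zp" "y = z + P ^ r * b"
    using assms by (meson congE)
  then show ?thesis by (intro congI[of _ _ _ "a + b"]) (auto simp: algebra_simps)
qed

lemma cong_eq_trans [trans]: "cong_p r x y \<Longrightarrow> y = z \<Longrightarrow> cong_p r x z" "x = y \<Longrightarrow> cong_p r y z \<Longrightarrow> cong_p r x z"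
  by auto

lemma cong_add: assumes "cong_p r x y" "cong_p r x' y'" shows "cong_p r (x + x') (y + y')"
proof -
  obtain a b where "a \<in> Zp" "x = y + P ^ r * a" "b \<in> Zp" "x' = y' + P ^ r * b"
    using assms by (meson congE)
  then show ?thesis by (intro congI[of _ _ _ "a + b"]) (auto simp: algebra_simps)
qed

lemma cong_minus: assumes "cong_p r x y" shows "cong_p r (- x) (- y)"
proof -
  obtain z where "z \<in> Zp" "x = y + P ^ r * z" using assms by (rule congE)
  then show ?thesis by (intro congI[of _ _ _ "- z"]) auto
qed

lemma cong_diff: "cong_p r x y \<Longrightarrow> cong_p r x' y' \<Longrightarrow> cong_p r (x - x') (y - y')"
  using cong_add[of r x y "- x'" "- y'"] cong_minus[of r x' y'] by simp

lemma cong_mult: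
  assumes "cong_p r x y" "cong_p r x' y'" "y \<in> Zp" "y' \<in> Zp"
  shows "cong_p r (x * x') (y * y')"
proof -
  obtain a b where ab: "a \<in> Zp" "x = y + P ^ r * a" "b \<in> Zp" "x' = y' + P ^ r * b"
    using assms by (meson congE)
  show ?thesis
    by (rule congI[of _ _ _ "y * b + a * y' + P ^ r * a * b"]) (use ab assms in \<open>auto simp: algebra_simps\<close>)
qed

lemma cong_mult_left: assumes "cong_p r x y" "c \<in> Zp" shows "cong_p r (c * x) (c * y)"
proof -
  obtain z where "z \<in> Zp" "x = y + P ^ r * z" using assms(1) by (rule congE)
  then show ?thesis using assms(2) by (intro congI[of _ _ _ "c * z"]) (auto simp: algebra_simps)
qed

lemma cong_mult_right: "cong_p r x y \<Longrightarrow> c \<in> Zp \<Longrightarrow> cong_p r (x * c) (y * c)"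
  using cong_mult_left[of r x y c] by (simp add: mult.commute)

lemma cong_sum: "(\<And>i. i \<in> A \<Longrightarrow> cong_p r (f i) (g i)) \<Longrightarrow> cong_p r (sum f A) (sum g A)"
  by (induction A rule: infinite_finite_induct) (auto intro: cong_add)

lemma cong_prod: "(\<And>i. i \<in> A \<Longrightarrow> cong_p r (f i) (g i)) \<Longrightarrow> (\<And>i. i \<in> A \<Longrightarrow> g i \<in> Zp) \<Longrightarrow> cong_p r (prod f A) (prod g A)"
  by (induction A rule: infinite_finite_induct) (auto intro: cong_mult)

lemma cong_power: "cong_p r x y \<Longrightarrow> y \<in> Zp \<Longrightarrow> cong_p r (x ^ n) (y ^ n)"
  by (induction n) (auto intro: cong_mult)

lemma cong_mono: assumes "cong_p r x y" "s \<le> r" shows "cong_p s x y"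
proof -
  obtain z where z: "z \<in> Zp" "x = y + P ^ r * z" using assms(1) by (rule congE)
  have "P ^ r = P ^ s * P ^ (r - s)" using assms(2) by (simp add: power_add[symmetric])
  then show ?thesis using z by (intro congI[of _ _ _ "P ^ (r - s) * z"]) auto
qed

lemma cong_P_mult: assumes "cong_p r x y" shows "cong_p (s + r) (P ^ s * x) (P ^ s * y)"
proof -
  obtain z where "z \<in> Zp" "x = y + P ^ r * z" using assms(1) by (rule congE)
  then show ?thesis by (intro congI[of _ _ _ z]) (auto simp: power_add algebra_simps)
qed

lemma cong_mult_P1: "cong_p 2 x y \<Longrightarrow> cong_p 3 (P * x) (P * y)"
  and cong_mult_P2: "cong_p 1 x y \<Longrightarrow> cong_p 3 (P\<^sup>2 * x) (P\<^sup>2 * y)"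
  using cong_P_mult[of 2 x y 1] cong_P_mult[of 1 x y 2] by (simp_all add: numeral_3_eq_3 eval_nat_numeral)

lemma cong_unit_cancel:
  assumes "cong_p r (u * x) (u * y)" "unit_p u" shows "cong_p r x y"
  using cong_mult_left[OF assms(1), of "inverse u"] assms(2) unit_nz[of u] by (simp add: mult.assoc[symmetric])

lemma cong_divide:
  assumes "cong_p r x y" "unit_p u" shows "cong_p r (x / u) (y / u)"
  using cong_mult_right[OF assms(1), of "inverse u"] assms(2) by (simp add: divide_inverse)

text \<open>A unit plus a multiple of \<open>p\<close> is a unit. It suffices to see this for \<open>1 + p z\<close>, whose
numerator differs from its denominator by a multiple of \<open>p\<close>.\<close>

lemma unit_cong:
  assumes c: "cong_p r u v" and r: "r \<ge> 1" and v: "unit_p v" shows "unit_p u"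
proof -
  obtain z where z: "z \<in> Zp" "u = v + P ^ r * z" using c by (rule congE)
  obtain s where s: "r = Suc s" using r by (cases r) auto
  define w where "w = 1 + P * (P ^ s * z / v)"
  have wZ: "P ^ s * z / v \<in> Zp" using z v by auto
  obtain a b where ab: "\<not> int p dvd b" "P ^ s * z / v = of_int a / of_int b"
    using wZ unfolding padic_int_rats_iff[OF prime_p] by blast
  have "b \<noteq> 0" using ab by auto
  then have "w = of_int (b + int p * a) / of_int b" unfolding w_def ab(2) by (simp add: field_simps)
  moreover have "unit_p (of_int (b + int p * a))" "unit_p (of_int b)"
    using ab(1) by (intro unit_of_int; simp add: dvd_add_left_iff)+
  ultimately have "unit_p w" by (simp del: of_int_add)
  moreover have "u = v * w" using z unit_nz[OF v] by (simp add: w_def s field_simps)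
  ultimately show ?thesis using v by simp
qed

lemma cong_inverse:
  assumes c: "cong_p r u v" and r: "r \<ge> 1" and v: "unit_p v" shows "cong_p r (inverse u) (inverse v)"
proof -
  have u: "unit_p u" using assms by (rule unit_cong)
  obtain z where z: "z \<in> Zp" "u = v + P ^ r * z" using c by (rule congE)
  have "inverse u - inverse v = P ^ r * (- z * inverse u * inverse v)"
    using unit_nz[OF u] unit_nz[OF v] z(2) by (simp add: field_simps)
  then show ?thesis using z u v by (intro congI[of _ _ _ "- z * inverse u * inverse v"]) (auto simp: algebra_simps)
qed

lemma cong_divide2:
  assumes "cong_p r x y" "cong_p r u v" "r \<ge> 1" "unit_p v" "y \<in> Zp"
  shows "cong_p r (x / u) (y / v)"
  unfolding divide_inverse using assms by (intro cong_mult cong_inverse) auto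

lemma cong_of_int: "cong_p r (of_int a) (of_int b)" if "[a = b] (mod int p ^ r)"
proof -
  have "int p ^ r dvd a - b" using that by (simp add: cong_iff_dvd_diff)
  then obtain k where "a - b = int p ^ r * k" by (elim dvdE)
  then have "a = b + int p ^ r * k" by simp
  then show ?thesis by (intro congI[of _ _ _ "of_int k"]) auto
qed

section \<open>Logarithmic expansions to second order\<close>

text \<open>\<open>log_exp x l m\<close> says that \<open>x\<close> is the exponential of \<open>p l + p\<^sup>2 m\<close> modulo \<open>p\<^sup>3\<close>. In this form
products of many factors \<open>1 + a p / j\<close> are handled by adding harmonic numbers.\<close>

definition log_exp :: "rat \<Rightarrow> rat \<Rightarrow> rat \<Rightarrow> bool" where
  "log_exp x l m \<longleftrightarrow> cong_p 3 x (1 + P * l + P\<^sup>2 * (l\<^sup>2 / 2 + m)) \<and> l \<in> Zp \<and> m \<in> Zp"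

lemma log_exp_1: "log_exp 1 0 0"
  by (simp add: log_exp_def)

lemma log_exp_mult: 
  assumes "log_exp x l m" "log_exp x' l' m'" shows "log_exp (x * x') (l + l') (m + m')"
proof -
  define q where "q = l\<^sup>2 / 2 + m"
  define q' where "q' = l'\<^sup>2 / 2 + m'"
  have Z: "l \<in> Zp" "m \<in> Zp" "l' \<in> Zp" "m' \<in> Zp" using assms by (auto simp: log_exp_def)
  then have Zq: "q \<in> Zp" "q' \<in> Zp" by (auto simp: q_def q'_def)
  have "cong_p 3 (x * x') ((1 + P * l + P\<^sup>2 * q) * (1 + P * l' + P\<^sup>2 * q'))"
    using assms Z Zq unfolding log_exp_def q_def[symmetric] q'_def[symmetric] by (intro cong_mult) auto
  also have "cong_p 3 \<dots> (1 + P * (l + l') + P\<^sup>2 * ((l + l')\<^sup>2 / 2 + (m + m')))"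
    by (rule congI[of _ _ _ "l * q' + l' * q + P * q * q'"])
      (use Z Zq in \<open>simp_all add: q_def q'_def field_simps power2_eq_square power3_eq_cube\<close>)
  finally show ?thesis using Z by (simp add: log_exp_def)
qed

lemma log_exp_cong_1: assumes "log_exp x l m" shows "cong_p 1 x 1"
proof -
  have "cong_p 1 x (1 + P * l + P\<^sup>2 * (l\<^sup>2 / 2 + m))" using assms by (auto simp: log_exp_def intro: cong_mono)
  also have "cong_p 1 \<dots> 1"
    by (rule congI[of _ _ _ "l + P * (l\<^sup>2 / 2 + m)"]) (use assms in \<open>auto simp: log_exp_def algebra_simps power2_eq_square\<close>)
  finally show ?thesis .
qed

lemma log_exp_unit: "log_exp x l m \<Longrightarrow> unit_p x"
  by (rule unit_cong[OF log_exp_cong_1]) auto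

lemma log_exp_inverse:
  assumes "log_exp x l m" shows "log_exp (inverse x) (- l) (- m)"
proof -
  have Z: "l \<in> Zp" "m \<in> Zp" using assms by (auto simp: log_exp_def)
  define y where "y = 1 + P * (- l) + P\<^sup>2 * ((- l)\<^sup>2 / 2 + - m)"
  have u: "unit_p x" using assms by (rule log_exp_unit)
  have y: "log_exp y (- l) (- m)" using Z by (auto simp: log_exp_def y_def)
  have "log_exp (x * y) (l + - l) (m + - m)" using assms y by (rule log_exp_mult)
  then have "cong_p 3 (x * y) 1" by (simp add: log_exp_def)
  then have "cong_p 3 (inverse x * (x * y)) (inverse x * 1)" using u by (intro cong_mult_left) auto
  moreover have "inverse x * (x * y) = y" using unit_nz[OF u] by simp
  ultimately have "cong_p 3 (inverse x) y" by (simp add: cong_sym)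
  then show ?thesis using Z by (simp add: log_exp_def y_def)
qed

lemma log_exp_divide: "log_exp x l m \<Longrightarrow> log_exp y l' m' \<Longrightarrow> log_exp (x / y) (l - l') (m - m')"
  using log_exp_mult[OF _ log_exp_inverse, of x l m y l' m'] by (simp add: divide_inverse)

lemma log_exp_linear: "a \<in> Zp \<Longrightarrow> log_exp (1 + P * a) a (- (a\<^sup>2) / 2)"
  by (simp add: log_exp_def)

lemma log_exp_prod:
  "finite A \<Longrightarrow> (\<And>i. i \<in> A \<Longrightarrow> log_exp (f i) (l i) (m i)) \<Longrightarrow> log_exp (prod f A) (sum l A) (sum m A)"
  by (induction A rule: finite_induct) (auto intro: log_exp_mult log_exp_1)

text \<open>The first coefficient matters only modulo \<open>p\<^sup>2\<close> and the second only modulo \<open>p\<close>, and a multiple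
\<open>p d\<close> may be moved from the first to the second.\<close>

lemma log_exp_shift:
  assumes "log_exp x l m" "cong_p 2 l (l' + P * d)" "cong_p 1 (m + d) m'" "l' \<in> Zp" "d \<in> Zp" "m' \<in> Zp"
  shows "log_exp x l' m'"
proof -
  obtain z where z: "z \<in> Zp" "l = l' + P * d + P\<^sup>2 * z" using assms(2) by (rule congE)
  obtain t where t: "t \<in> Zp" "m' = m + d + P * t" using cong_sym[OF assms(3)] by (auto elim: congE)
  have m: "m \<in> Zp" using assms by (simp add: log_exp_def)
  define e where "e = d + P * z"
  have e: "e \<in> Zp" "l = l' + P * e" using z assms by (auto simp: e_def algebra_simps power2_eq_square)
  have "cong_p 3 x (1 + P * l + P\<^sup>2 * (l\<^sup>2 / 2 + m))" using assms by (simp add: log_exp_def)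
  also have "cong_p 3 \<dots> (1 + P * l' + P\<^sup>2 * (l'\<^sup>2 / 2 + m'))"
    by (rule congI[of _ _ _ "z - t + l' * e + P * e\<^sup>2 / 2"])
      (use z t e assms m in \<open>simp_all add: algebra_simps power2_eq_square power3_eq_cube e_def field_simps\<close>)
  finally show ?thesis using assms by (simp add: log_exp_def)
qed

lemma log_exp_cong: "log_exp x l m \<Longrightarrow> log_exp y l m \<Longrightarrow> cong_p 3 x y"
  unfolding log_exp_def using cong_trans cong_sym by blast

definition H1 :: "nat \<Rightarrow> rat" where "H1 n = (\<Sum>j=1..n. 1 / of_nat j)"
definition H2 :: "nat \<Rightarrow> rat" where "H2 n = (\<Sum>j=1..n. 1 / of_nat j ^ 2)"
definition shift_quot :: "rat \<Rightarrow> nat \<Rightarrow> rat" where "shift_quot a n = (\<Prod>j=1..n. 1 + a * P / of_nat j)"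

lemma unit_fact: "n < p \<Longrightarrow> unit_p (fact n)"
  unfolding fact_prod of_nat_prod by (intro unit_prod unit_of_nat_less) auto

lemma harmonic_Zp [simp]: "n < p \<Longrightarrow> H1 n \<in> Zp" "n < p \<Longrightarrow> H2 n \<in> Zp"
  unfolding H1_def H2_def by (intro Zp_sum Zp_divide unit_power unit_of_nat_less; simp)+

lemma log_exp_linear_prod:
  assumes "finite A" "a \<in> Zp" and d: "\<And>i. i \<in> A \<Longrightarrow> unit_p (d i)"
  shows "log_exp (\<Prod>i\<in>A. 1 + a * P / d i) (a * (\<Sum>i\<in>A. 1 / d i)) (- (a\<^sup>2) / 2 * (\<Sum>i\<in>A. 1 / d i ^ 2))"
proof -
  have "log_exp (\<Prod>i\<in>A. 1 + a * P / d i) (\<Sum>i\<in>A. a / d i) (\<Sum>i\<in>A. - ((a / d i)\<^sup>2) / 2)"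
  proof (rule log_exp_prod)
    fix i assume "i \<in> A"
    then have "a / d i \<in> Zp" using assms by auto
    from log_exp_linear[OF this] show "log_exp (1 + a * P / d i) (a / d i) (- ((a / d i)\<^sup>2) / 2)" by (simp add: mult.commute)
  qed (rule assms)
  then show ?thesis by (simp add: sum_distrib_left power_divide mult.commute)
qed

lemma log_exp_shift_quot: "n < p \<Longrightarrow> a \<in> Zp \<Longrightarrow> log_exp (shift_quot a n) (a * H1 n) (- (a\<^sup>2) / 2 * H2 n)"
  unfolding shift_quot_def H1_def H2_def by (intro log_exp_linear_prod unit_of_nat_less) auto

lemma prod_shift_eq: "(\<Prod>j=1..n. of_nat j + a * P) = fact n * shift_quot a n"
  unfolding shift_quot_def fact_prod of_nat_prod prod.distrib[symmetric]
  by (rule prod.cong) (auto simp: field_simps)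

end

section \<open>A summation formula of Saalschuetz type\<close>

text \<open>The value at the node \<open>- j\<close> of the Lagrange polynomial that belongs to it, for the nodes
\<open>0, -1, \<dots>, -n\<close>.\<close>

lemma prod_differences_at_node:
  assumes "j \<le> n"
  shows "(\<Prod>i\<in>{..n}-{j}. of_nat i - of_nat j) = ((- 1) ^ j * fact j * fact (n - j) :: rat)"
proof -
  have split: "{..n} - {j} = {..<j} \<union> {j<..n}" using assms by auto
  have "(\<Prod>i<j. of_nat i - of_nat j) = (\<Prod>i<j. (- 1 :: rat) * of_nat (j - i))"
    by (rule prod.cong) (auto simp: of_nat_diff)
  also have "\<dots> = (- 1) ^ j * fact j"
    unfolding prod.distrib by (simp add: fact_prod_rev atLeast0LessThan)
  finally have 1: "(\<Prod>i<j. of_nat i - of_nat j) = ((- 1) ^ j * fact j :: rat)" .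
  have "(\<Prod>i\<in>{j<..n}. of_nat i - of_nat j) = (\<Prod>i=1..n-j. of_nat i :: rat)"
    by (rule prod.reindex_bij_witness[where i = "\<lambda>i. i + j" and j = "\<lambda>i. i - j"]) (auto simp: of_nat_diff)
  then have 2: "(\<Prod>i\<in>{j<..n}. of_nat i - of_nat j) = (fact (n - j) :: rat)"
    by (simp add: fact_prod)
  show ?thesis unfolding split using 1 2 by (subst prod.union_disjoint) auto
qed

text \<open>The partial fraction expansion of \<open>Q(z) / (z (z+1) \<dots> (z+n))\<close>, which is Lagrange
interpolation of \<open>Q\<close> at the points \<open>0, -1, \<dots>, -n\<close>.\<close>

lemma partial_fraction_sum:
  fixes Q :: "rat poly"
  assumes deg: "degree Q \<le> n" and nz: "\<And>k. k \<le> n \<Longrightarrow> z + of_nat k \<noteq> 0"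
  shows "(\<Sum>k\<le>n. (- 1) ^ k * of_nat (n choose k) * poly Q (- of_nat k) / (z + of_nat k))
     = fact n * poly Q z / (\<Prod>i\<le>n. z + of_nat i)"
proof -
  define L where "L k = (\<Prod>i\<in>{..n}-{k}. [:of_nat i :: rat, 1:])" for k :: nat
  define c where "c k = (- 1) ^ k * of_nat (n choose k) * poly Q (- of_nat k)" for k
  have degL: "degree (L k) \<le> n" if "k \<le> n" for k
  proof -
    have "degree (L k) \<le> sum (degree \<circ> (\<lambda>i. [:of_nat i :: rat, 1:])) ({..n}-{k})"
      unfolding L_def by (rule degree_prod_sum_le) simp
    also have "\<dots> = n" using that by simp
    finally show ?thesis .
  qed
  have node: "poly (\<Sum>k\<le>n. smult (c k) (L k)) x = poly (smult (fact n) Q) x"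
    if "x \<in> (\<lambda>k. - of_nat k) ` {..n}" for x
  proof -
    obtain j where j: "j \<le> n" "x = - of_nat j" using \<open>x \<in> _\<close> by auto
    have "poly (L k) x = 0" if "k \<le> n" "k \<noteq> j" for k
      unfolding L_def poly_prod using that j by (intro prod_zero bexI[of _ j]) auto
    then have "poly (\<Sum>k\<le>n. smult (c k) (L k)) x = (\<Sum>k\<in>{j}. c k * poly (L k) x)"
      unfolding poly_sum poly_smult using j by (intro sum.mono_neutral_right) auto
    also have "\<dots> = c j * ((- 1) ^ j * fact j * fact (n - j))"
      using prod_differences_at_node[OF j(1)] by (simp add: L_def poly_prod j(2))
    also have "\<dots> = fact n * poly Q x"
      using j by (simp add: c_def binomial_fact)
    finally show ?thesis by simp
  qed
  have card: "card ((\<lambda>k. - of_nat k :: rat) ` {..n}) = Suc n"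
    by (subst card_image) (auto simp: inj_on_def)
  have "(\<Sum>k\<le>n. smult (c k) (L k)) = smult (fact n) Q"
  proof (rule poly_eqI_degree[OF node])
    have "degree (\<Sum>k\<le>n. smult (c k) (L k)) \<le> n"
      by (rule degree_sum_le) (auto intro: order.trans[OF degree_smult_le] degL)
    then show "degree (\<Sum>k\<le>n. smult (c k) (L k)) < card ((\<lambda>k. - of_nat k :: rat) ` {..n})"
      unfolding card by simp
    show "degree (smult (fact n) Q) < card ((\<lambda>k. - of_nat k :: rat) ` {..n})"
      unfolding card using deg by simp
  qed
  from arg_cong[OF this, of "\<lambda>r. poly r z"]
  have eq: "(\<Sum>k\<le>n. c k * (\<Prod>i\<in>{..n}-{k}. z + of_nat i)) = fact n * poly Q z"
    by (simp add: poly_sum L_def poly_prod add.commute)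
  have full: "(\<Prod>i\<le>n. z + of_nat i) \<noteq> 0" using nz by auto
  have "c k / (z + of_nat k) = c k * (\<Prod>i\<in>{..n}-{k}. z + of_nat i) / (\<Prod>i\<le>n. z + of_nat i)" if "k \<le> n" for k
  proof -
    have "(\<Prod>i\<le>n. z + of_nat i) = (z + of_nat k) * (\<Prod>i\<in>{..n}-{k}. z + of_nat i)"
      using that by (intro prod.remove) auto
    then show ?thesis using full nz[OF that] by (simp add: field_simps)
  qed
  then have "(\<Sum>k\<le>n. c k / (z + of_nat k)) = (\<Sum>k\<le>n. c k * (\<Prod>i\<in>{..n}-{k}. z + of_nat i)) / (\<Prod>i\<le>n. z + of_nat i)"
    unfolding sum_divide_distrib by (intro sum.cong) auto
  then show ?thesis unfolding eq by (simp add: c_def)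
qed

text \<open>Pfaff and Saalschuetz's formula for the balanced series
\<open>\<^sub>3F\<^sub>2(-n, a, z; a-n, z+1; 1)\<close>. For the polynomial \<open>Q(x) = (x+1-a) \<dots> (x+n-a)\<close> the quotient \<open>Q(-k) / Q(0)\<close>
is the product over \<open>j \<le> k\<close> in the summand, because passing from \<open>k\<close> to \<open>k+1\<close> shifts all factors by one;
so the formula is a partial fraction expansion.\<close>

lemma saalschuetz_sum:
  fixes a z :: rat
  assumes nz: "\<And>k. k \<le> n \<Longrightarrow> z + of_nat k \<noteq> 0"
    and nz1: "\<And>i. i \<in> {1..n} \<Longrightarrow> of_nat i - a \<noteq> 0"
    and nz2: "\<And>j. j \<in> {1..n} \<Longrightarrow> a - of_nat n + of_nat j - 1 \<noteq> 0"
  shows "(\<Sum>k\<le>n. (- 1) ^ k * of_nat (n choose k)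
       * (\<Prod>j=1..k. (a + of_nat j - 1) / (a - of_nat n + of_nat j - 1)) / (z + of_nat k))
     = fact n * (\<Prod>i=1..n. z + of_nat i - a) / ((\<Prod>i=1..n. of_nat i - a) * (\<Prod>i\<le>n. z + of_nat i))"
proof -
  define Q where "Q = (\<Prod>i=1..n. [:of_nat i - a, 1:])"
  define q where "q = (\<Prod>i=1..n. of_nat i - a)"
  have q: "q \<noteq> 0" unfolding q_def using nz1 by auto
  have Q: "poly Q x = (\<Prod>i=1..n. x + of_nat i - a)" for x
    unfolding Q_def poly_prod by (rule prod.cong) (auto simp: algebra_simps)
  have deg: "degree Q \<le> n"
  proof -
    have "degree Q \<le> sum (degree \<circ> (\<lambda>i. [:of_nat i - a, 1:])) {1..n}"
      unfolding Q_def by (rule degree_prod_sum_le) simp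
    then show ?thesis by simp
  qed
  have val: "(\<Prod>j=1..k. (a + of_nat j - 1) / (a - of_nat n + of_nat j - 1)) = poly Q (- of_nat k) / q" if "k \<le> n" for k
    using that
  proof (induction k)
    case 0
    then show ?case using q by (simp add: Q q_def)
  next
    case (Suc k)
    have "(\<Prod>i\<in>insert 0 {1..n}. of_nat i - of_nat k - a) = (- of_nat k - a) * (\<Prod>i=1..n. of_nat i - of_nat k - a)"
      by (subst prod.insert) auto
    moreover have "(\<Prod>i\<in>insert 0 {1..n}. of_nat i - of_nat k - a) = (\<Prod>i\<in>insert (Suc n) {1..n}. of_nat i - of_nat (Suc k) - a)"
      by (rule prod.reindex_bij_witness[where i = "\<lambda>i. i - 1" and j = "\<lambda>i. i + 1"]) auto
    moreover have "\<dots> = (of_nat n - of_nat k - a) * (\<Prod>i=1..n. of_nat i - of_nat (Suc k) - a)"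
      by (subst prod.insert) (auto simp: algebra_simps)
    ultimately have *: "(of_nat n - of_nat k - a) * poly Q (- of_nat (Suc k)) = (- of_nat k - a) * poly Q (- of_nat k)"
      unfolding Q by (simp add: algebra_simps)
    have d: "a - of_nat n + of_nat (Suc k) - 1 \<noteq> 0" using nz2[of "Suc k"] Suc.prems by simp
    have "(\<Prod>j=1..Suc k. (a + of_nat j - 1) / (a - of_nat n + of_nat j - 1)) =
        poly Q (- of_nat k) / q * ((a + of_nat k) / (a - of_nat n + of_nat k))"
      using Suc by simp
    also have "\<dots> = poly Q (- of_nat (Suc k)) / q"
    proof -
      have d': "a - of_nat n + of_nat k \<noteq> 0" using d by simp
      have "poly Q (- of_nat k) * (a + of_nat k) = poly Q (- of_nat (Suc k)) * (a - of_nat n + of_nat k)"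
        using * by (simp add: algebra_simps)
      then show ?thesis using d' q by (simp add: divide_simps)
    qed
    finally show ?case .
  qed
  have "(\<Sum>k\<le>n. (- 1) ^ k * of_nat (n choose k)
       * (\<Prod>j=1..k. (a + of_nat j - 1) / (a - of_nat n + of_nat j - 1)) / (z + of_nat k))
     = (\<Sum>k\<le>n. (- 1) ^ k * of_nat (n choose k) * poly Q (- of_nat k) / (z + of_nat k)) / q"
    unfolding sum_divide_distrib by (rule sum.cong) (use val in \<open>auto simp: field_simps\<close>)
  also have "\<dots> = fact n * poly Q z / (\<Prod>i\<le>n. z + of_nat i) / q"
    by (subst partial_fraction_sum[OF deg nz]) auto
  finally show ?thesis by (simp add: Q q_def mult.commute)
qed

section \<open>The sums of Domb numbers as single sums\<close>

text \<open>The hockey stick identity for binomial coefficients, multiplied by a factorial.\<close>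

lemma sum_fact_inv_fact:
  "(\<Sum>n<N. fact (n + u) * inv_fact (int n - int v)) = fact (N + u) * inv_fact (int N - 1 - int v) / of_nat (u + v + 1)"
proof (induction N)
  case 0
  then show ?case by (simp add: inv_fact_def)
next
  case (Suc N)
  have i1: "inv_fact (int N - 1 - int v) = (of_nat N - of_nat v) * inv_fact (int N - int v)"
    using inv_fact_pred[of "int N - int v"] by (simp add: algebra_simps)
  have D: "of_nat (u + v + 1) \<noteq> (0 :: rat)" by (metis add_is_0 of_nat_eq_0_iff zero_neq_one)
  have i2: "int (Suc N) - 1 - int v = int N - int v" by simp
  have f: "fact (Suc N + u) = (of_nat N + of_nat u + 1) * (fact (N + u) :: rat)"
    by (simp add: algebra_simps)
  have "f * ((x - v) * g) / (u + v + 1) + f * g = (x + u + 1) * f * g / (u + v + 1)"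
    if "u + v + 1 \<noteq> 0" for f g x u v :: rat
    using that by (simp add: field_simps)
  from this[of "of_nat u" "of_nat v"] show ?case
    using D unfolding sum.lessThan_Suc Suc.IH i1 i2 f of_nat_add of_nat_1 by blast
qed

text \<open>This is \<open>C(2k,k) / 4\<^sup>k\<close>, the quotient of the rising factorial of \<open>1/2\<close> by that of \<open>1\<close>.\<close>

definition half_poch :: "nat \<Rightarrow> rat" where
  "half_poch k = fact (2 * k) / (4 ^ k * fact k ^ 2)"

lemma cb_weight_half_poch: "cb_weight k * fact k * fact (2 * k) = half_poch k ^ 2"
proof -
  have "(16 :: rat) ^ k = (4 ^ k)\<^sup>2" by (simp add: power_mult[symmetric] power2_eq_square power_mult_distrib[symmetric])
  then show ?thesis
    by (simp add: cb_weight_def half_poch_def power_divide power_mult_distrib eval_nat_numeral)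
qed

lemma half_poch_prod: "half_poch k = (\<Prod>j=1..k. (2 * of_nat j - 1) / (2 * of_nat j))"
proof (induction k)
  case 0
  then show ?case by (simp add: half_poch_def)
next
  case (Suc k)
  have "(of_nat k + 1 :: rat) \<noteq> 0" by (metis of_nat_Suc add.commute of_nat_neq_0)
  moreover have "fact (2 * Suc k) = 2 * (2 * of_nat k + 1) * (of_nat k + 1) * (fact (2 * k) :: rat)"
    by (simp add: algebra_simps)
  moreover have "fact (Suc k) ^ 2 = (of_nat k + 1) ^ 2 * (fact k ^ 2 :: rat)"
    by (simp add: power_mult_distrib add.commute)
  moreover have "2 * y * z * A / (4 * q * (z ^ 2 * f)) = A / (q * f) * (y / (2 * z))" if "z \<noteq> 0" for y z A q f :: rat
    using that by (simp add: field_simps power2_eq_square)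
  ultimately have "half_poch (Suc k) = half_poch k * ((2 * of_nat k + 1) / (2 * (of_nat k + 1)))"
    unfolding half_poch_def power_Suc[of 4] by (simp only: simp_thms)
  then show ?case using Suc by (simp add: algebra_simps)
qed

lemma domb_sum_4:
  "(\<Sum>n<N. of_nat (domb n) / 4 ^ n)
   = (\<Sum>k<N. cb_weight k * (fact (N + k) * inv_fact (int N - 1 - 2 * int k)) / (3 * of_nat k + 1))"
proof -
  have "(\<Sum>n<N. of_nat (domb n) / 4 ^ n :: rat) = (\<Sum>n<N. \<Sum>k<N. term4 n k / 4 ^ n)"
    unfolding domb_eq_term4 sum_divide_distrib
    by (intro sum.cong refl sum.mono_neutral_left) (auto simp: term4_def inv_fact_def)
  also have "\<dots> = (\<Sum>k<N. cb_weight k * (\<Sum>n<N. fact (n + k) * inv_fact (int n - int (2 * k))))"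
    by (subst sum.swap) (simp add: term4_def sum_distrib_left mult_ac)
  finally show ?thesis unfolding sum_fact_inv_fact by (simp add: algebra_simps)
qed

lemma domb_sum_16:
  "(\<Sum>n<N. of_nat (domb n) / 16 ^ n)
   = (\<Sum>k<N. (- 1) ^ k * cb_weight k * (fact (N + 2 * k) * inv_fact (int N - 1 - int k)) / (3 * of_nat k + 1))"
proof -
  have "(\<Sum>n<N. of_nat (domb n) / 16 ^ n :: rat) = (\<Sum>n<N. \<Sum>k<N. term16 n k / 16 ^ n)"
    unfolding domb_eq_term16 sum_divide_distrib
    by (intro sum.cong refl sum.mono_neutral_left) (auto simp: term16_def inv_fact_def)
  also have "\<dots> = (\<Sum>k<N. (- 1) ^ k * cb_weight k * (\<Sum>n<N. fact (n + 2 * k) * inv_fact (int n - int k)))"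
    by (subst sum.swap) (simp add: term16_def sum_distrib_left mult_ac)
  finally show ?thesis unfolding sum_fact_inv_fact by (simp add: algebra_simps)
qed

context prime_gt_3
begin

lemma fact_add_p: "fact (p + u) = P * fact (p - 1) * (fact u * shift_quot 1 u)"
proof (induction u)
  case 0
  show ?case using fact_reduce[of p] by (simp add: shift_quot_def)
next
  case (Suc u)
  have "of_nat (Suc u) \<noteq> (0 :: rat)" by simp
  then have "fact (Suc u) * shift_quot 1 (Suc u) = (of_nat (Suc u) + P) * (fact u * shift_quot 1 u)"
    unfolding shift_quot_def by (simp add: field_simps)
  moreover have "fact (p + Suc u) = (of_nat (Suc u) + P) * (fact (p + u) :: rat)" by (simp add: algebra_simps)
  ultimately show ?case using Suc by simp
qed

text \<open>The left side is the product of the integers from \<open>p-v\<close> to \<open>p+u\<close>; it is sorted into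
\<open>p\<close>, the factors above \<open>p\<close> and those below \<open>p\<close>.\<close>

lemma fact_inv_fact_split:
  assumes "v < p"
  shows "fact (p + u) * inv_fact (int p - 1 - int v)
    = P * (- 1) ^ v * fact u * fact v * shift_quot 1 u * shift_quot (- 1) v"
proof -
  have down: "fact (p - 1) * inv_fact (int p - 1 - int v) = (- 1) ^ v * (fact v * shift_quot (- 1) v)"
    using assms
  proof (induction v)
    case 0
    have "nat (int p - 1) = p - 1" by simp
    then show ?case by (simp add: shift_quot_def inv_fact_def)
  next
    case (Suc v)
    have "inv_fact (int p - 1 - int (Suc v)) = (P - of_nat (Suc v)) * inv_fact (int p - 1 - int v)"
      using inv_fact_pred[of "int p - 1 - int v"] by (simp add: algebra_simps)
    moreover have "of_nat (Suc v) \<noteq> (0 :: rat)" by simp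
    then have "fact (Suc v) * shift_quot (- 1) (Suc v) = (of_nat (Suc v) - P) * (fact v * shift_quot (- 1) v)"
      unfolding shift_quot_def by (simp add: field_simps)
    moreover have "fact (p - 1) * ((P - of_nat (Suc v)) * inv_fact (int p - 1 - int v))
       = (P - of_nat (Suc v)) * ((- 1) ^ v * (fact v * shift_quot (- 1) v))"
      using Suc by simp
    moreover have "(x - y) * (s * z) = - 1 * s * ((y - x) * z)" for x y s z :: rat by (simp add: algebra_simps)
    ultimately show ?case unfolding power_Suc by simp
  qed
  have "fact (p + u) * inv_fact (int p - 1 - int v) = P * (fact (p - 1) * inv_fact (int p - 1 - int v)) * (fact u * shift_quot 1 u)"
    unfolding fact_add_p by simp
  then show ?thesis unfolding down by simp
qed

definition hp :: nat where "hp = (p - 1) div 2"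

lemma p_odd: "odd p" using prime_p p_gt_3 prime_odd_nat by auto

lemma p_hp: "p = 2 * hp + 1" using p_odd unfolding hp_def by (elim oddE) simp

lemma P_hp: "P = 2 * of_nat hp + 1" by (subst p_hp) simp

lemma hp_less: "hp < p" "2 * hp < p" using p_hp by auto

definition S4 :: rat where "S4 = (\<Sum>k=0..p-1. of_nat (domb k) / 4 ^ k)"
definition S16 :: rat where "S16 = (\<Sum>k=0..p-1. of_nat (domb k) / 16 ^ k)"

abbreviation summand :: "nat \<Rightarrow> rat \<Rightarrow> rat" where
  "summand k x \<equiv> P / (3 * of_nat k + 1) * (half_poch k)\<^sup>2 * x"

lemma S4_eq: "S4 = (\<Sum>k\<le>hp. summand k (shift_quot 1 k * shift_quot (- 1) (2 * k)))"
proof -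
  have "{0..p-1} = {..<p}" using p_gt_3 by auto
  then have "S4 = (\<Sum>k<p. cb_weight k * (fact (p + k) * inv_fact (int p - 1 - 2 * int k)) / (3 * of_nat k + 1))"
    unfolding S4_def by (simp only: domb_sum_4)
  also have "\<dots> = (\<Sum>k\<le>hp. cb_weight k * (fact (p + k) * inv_fact (int p - 1 - 2 * int k)) / (3 * of_nat k + 1))"
    using p_hp by (intro sum.mono_neutral_right) (auto simp: inv_fact_def)
  also have "\<dots> = (\<Sum>k\<le>hp. summand k (shift_quot 1 k * shift_quot (- 1) (2 * k)))"
  proof (rule sum.cong)
    fix k assume "k \<in> {..hp}"
    then have "2 * k < p" using p_hp by simp
    then show "cb_weight k * (fact (p + k) * inv_fact (int p - 1 - 2 * int k)) / (3 * of_nat k + 1)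
      = summand k (shift_quot 1 k * shift_quot (- 1) (2 * k))"
      using fact_inv_fact_split[of "2 * k" k] cb_weight_half_poch[of k, symmetric] by (simp add: power_mult)
  qed simp
  finally show ?thesis .
qed

lemma S16_eq: "S16 = (\<Sum>k<p. summand k (shift_quot 1 (2 * k) * shift_quot (- 1) k))"
proof -
  have "{0..p-1} = {..<p}" using p_gt_3 by auto
  then have "S16 = (\<Sum>k<p. (- 1) ^ k * cb_weight k * (fact (p + 2 * k) * inv_fact (int p - 1 - int k)) / (3 * of_nat k + 1))"
    unfolding S16_def by (simp only: domb_sum_16)
  also have "\<dots> = (\<Sum>k<p. summand k (shift_quot 1 (2 * k) * shift_quot (- 1) k))"
  proof (rule sum.cong)
    fix k assume "k \<in> {..<p}"
    moreover have "(- 1) ^ k * ((- 1) ^ k * x) = (x :: rat)" for x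
      by (simp add: mult.assoc[symmetric] power_mult_distrib[symmetric])
    ultimately show "(- 1) ^ k * cb_weight k * (fact (p + 2 * k) * inv_fact (int p - 1 - int k)) / (3 * of_nat k + 1)
      = summand k (shift_quot 1 (2 * k) * shift_quot (- 1) k)"
      using fact_inv_fact_split[of k "2 * k"] cb_weight_half_poch[of k, symmetric] by (simp add: mult_ac)
  qed simp
  finally show ?thesis .
qed

section \<open>Comparison with a summable series\<close>

text \<open>The analogue of \<open>shift_quot\<close> for odd denominators.\<close>

definition odd_quot :: "rat \<Rightarrow> nat \<Rightarrow> rat" where
  "odd_quot a k = (\<Prod>j=1..k. 1 + a * P / (2 * of_nat j - 1))"

lemma odd_nz: "2 * of_nat j - 1 \<noteq> (0 :: rat)"
proof
  assume "2 * of_nat j - 1 = (0 :: rat)"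
  then have "of_int (2 * int j - 1) = (of_int 0 :: rat)" by simp
  then have "2 * int j - 1 = 0" by (simp only: of_int_eq_iff)
  then show False by presburger
qed

text \<open>The denominators up to \<open>2k\<close> are the odd ones and twice the ones up to \<open>k\<close>.\<close>

lemma shift_quot_double: "shift_quot a (2 * k) = odd_quot a k * shift_quot (a / 2) k"
proof (induction k)
  case (Suc k)
  have "shift_quot a (2 * Suc k) = shift_quot a (2 * k) * (1 + a * P / (2 * of_nat k + 1)) * (1 + a * P / (2 * of_nat k + 2))"
    by (simp add: shift_quot_def algebra_simps)
  moreover have "odd_quot a (Suc k) = odd_quot a k * (1 + a * P / (2 * of_nat k + 1))"
    by (simp add: odd_quot_def algebra_simps)
  moreover have "a * P / (2 * of_nat k + 2) = a / 2 * P / of_nat (Suc k)" by (simp add: algebra_simps)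
  then have "shift_quot (a / 2) (Suc k) = shift_quot (a / 2) k * (1 + a * P / (2 * of_nat k + 2))"
    by (simp add: shift_quot_def)
  ultimately show ?case using Suc by simp
qed (simp add: shift_quot_def odd_quot_def)

lemma unit_odd: "1 \<le> j \<Longrightarrow> j \<le> hp \<Longrightarrow> unit_p (2 * of_nat j - 1)"
  using unit_of_nat_less[of "2 * j - 1"] p_hp by (simp add: of_nat_diff)

definition O1 :: "nat \<Rightarrow> rat" where "O1 n = (\<Sum>j=1..n. 1 / (2 * of_nat j - 1))"
definition O2 :: "nat \<Rightarrow> rat" where "O2 n = (\<Sum>j=1..n. 1 / (2 * of_nat j - 1) ^ 2)"

lemma odd_harmonic_Zp [simp]: "n \<le> hp \<Longrightarrow> O1 n \<in> Zp" "n \<le> hp \<Longrightarrow> O2 n \<in> Zp"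
  unfolding O1_def O2_def by (intro Zp_sum Zp_divide unit_power unit_odd; simp)+

lemma O1_eq: "O1 n = H1 (2 * n) - H1 n / 2" and O2_eq: "O2 n = H2 (2 * n) - H2 n / 4"
proof -
  have "O1 n + H1 n / 2 = H1 (2 * n) \<and> O2 n + H2 n / 4 = H2 (2 * n)"
  proof (induction n)
    case (Suc n)
    have oe: "2 * of_nat (Suc n) - 1 = (of_nat (2 * n + 1) :: rat)"  "(of_nat (2 * n + 2) :: rat) = 2 * of_nat (Suc n)" by simp_all
    have q: "1 / of_nat (Suc n) / 2 = 1 / (2 * of_nat (Suc n) :: rat)" "1 / of_nat (Suc n) ^ 2 / 4 = 1 / (2 * of_nat (Suc n) :: rat) ^ 2"
      by (simp_all add: power_mult_distrib del: of_nat_Suc)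
    have h: "H1 (2 * Suc n) = H1 (2 * n) + 1 / of_nat (2 * n + 1) + 1 / of_nat (2 * n + 2)"
       "H2 (2 * Suc n) = H2 (2 * n) + 1 / of_nat (2 * n + 1) ^ 2 + 1 / of_nat (2 * n + 2) ^ 2"
       "H1 (Suc n) = H1 n + 1 / of_nat (Suc n)" "H2 (Suc n) = H2 n + 1 / of_nat (Suc n) ^ 2"
       "O1 (Suc n) = O1 n + 1 / (2 * of_nat (Suc n) - 1)" "O2 (Suc n) = O2 n + 1 / (2 * of_nat (Suc n) - 1) ^ 2"
      by (simp_all add: H1_def H2_def O1_def O2_def)
    show ?case using Suc unfolding h oe add_divide_distrib q by linarith
  qed (simp add: O1_def O2_def H1_def H2_def)
  then show "O1 n = H1 (2 * n) - H1 n / 2" "O2 n = H2 (2 * n) - H2 n / 4" by (simp_all add: algebra_simps)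
qed

lemma log_exp_odd_quot: "n \<le> hp \<Longrightarrow> a \<in> Zp \<Longrightarrow> log_exp (odd_quot a n) (a * O1 n) (- (a\<^sup>2) / 2 * O2 n)"
  unfolding odd_quot_def O1_def O2_def by (intro log_exp_linear_prod unit_odd) auto

lemma unit_half_poch: "k \<le> hp \<Longrightarrow> unit_p (half_poch k)"
  unfolding half_poch_def using p_hp by (intro unit_divide unit_mult unit_power unit_fact) auto

text \<open>With \<open>p = 2 hp + 1\<close>, the factor \<open>hp - j + 1\<close> of the binomial coefficient is
\<open>- (2j-1-p) / 2\<close>.\<close>

lemma binomial_half_poch: "k \<le> hp \<Longrightarrow> (- 1) ^ k * of_nat (hp choose k) = half_poch k * odd_quot (- 1) k"
proof (induction k)
  case (Suc k)
  have "Suc k * (hp choose Suc k) = (hp - k) * (hp choose k)"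
    using binomial_absorb_comp[of hp k] Suc_times_binomial_eq
    by (metis Suc_le_D Suc.prems binomial_absorption diff_Suc_1)
  then have "of_nat (Suc k) * of_nat (hp choose Suc k) = (of_nat hp - of_nat k) * (of_nat (hp choose k) :: rat)"
    using Suc.prems by (metis Suc_leD of_nat_diff of_nat_mult)
  then have eq: "of_nat (hp choose Suc k) = (of_nat hp - of_nat k) * of_nat (hp choose k) / (of_nat (Suc k) :: rat)"
    by (simp add: field_simps)
  have "(- 1) ^ Suc k * of_nat (hp choose Suc k) = ((- 1) ^ k * of_nat (hp choose k)) * ((of_nat k - of_nat hp) / of_nat (Suc k) :: rat)"
    unfolding eq by (simp add: divide_inverse algebra_simps del: of_nat_Suc)
  also have "(- 1) ^ k * of_nat (hp choose k) = half_poch k * odd_quot (- 1) k" using Suc by simp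
  also have "(of_nat k - of_nat hp) / of_nat (Suc k) = (2 * of_nat (Suc k) - 1) / (2 * of_nat (Suc k)) * (1 + - 1 * P / (2 * of_nat (Suc k) - 1))"
  proof -
    have "D * (1 + - 1 * P / D) = D - P" if "D \<noteq> 0" for D
      using that by (simp add: field_simps)
    from this[OF odd_nz] have "(2 * of_nat (Suc k) - 1) * (1 + - 1 * P / (2 * of_nat (Suc k) - 1)) = 2 * of_nat (Suc k) - 1 - P" .
    also have "\<dots> = 2 * (of_nat k - of_nat hp)" unfolding P_hp by simp
    finally have X: "(2 * of_nat (Suc k) - 1) * (1 + - 1 * P / (2 * of_nat (Suc k) - 1)) = 2 * (of_nat k - of_nat hp)" .
    show ?thesis unfolding times_divide_eq_left X by (rule mult_divide_mult_cancel_left[symmetric]) simp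
  qed
  finally show ?case by (simp add: half_poch_prod odd_quot_def)
qed (simp add: half_poch_def odd_quot_def)

text \<open>The parameter \<open>q\<close> will be \<open>0\<close> for the powers of \<open>4\<close> and \<open>1\<close> for the powers of \<open>16\<close>. The products
in \<open>S4\<close> and \<open>S16\<close> have linear terms in \<open>p\<close> with coefficient \<open>\<mp>1\<close> at the odd and \<open>\<plusminus>1/2\<close> at all
reciprocals, and among the products with these coefficients, \<open>V 0\<close> and \<open>V 1\<close> make the series \<open>T\<close> below
terminating and balanced.\<close>

definition V :: "rat \<Rightarrow> nat \<Rightarrow> rat" where
  "V q k = odd_quot (- 1) k * odd_quot (2 * q) k / shift_quot (q - 1/2) k"

definition T :: "rat \<Rightarrow> rat" where
  "T q = (\<Sum>k\<le>hp. (half_poch k)\<^sup>2 * V q k / (3 * of_nat k + 1))"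

lemma unit_shift: "unit_p u \<Longrightarrow> x \<in> Zp \<Longrightarrow> unit_p (u + x * P)"
  by (rule unit_cong[of 1 _ u]) (auto intro!: congI[of _ _ _ x])

text \<open>The summand is that of \<open>saalschuetz_sum\<close> with \<open>n = hp\<close>, \<open>a = 1/2 + q p\<close> and \<open>z = 1/3\<close>.\<close>

lemma T_eq:
  assumes q: "q \<in> Zp"
  shows "T q = fact hp * (\<Prod>i=1..hp. of_nat i - 1/6 - q * P) / ((\<Prod>i=1..hp. of_nat i - 1/2 - q * P) * (\<Prod>i=1..hp. of_nat i + 1/3))"
proof -
  define a where "a = 1/2 + q * P"
  have az: "a - of_nat hp + of_nat j - 1 = of_nat j + (q - 1/2) * P" for j
    unfolding a_def by (simp add: P_hp field_simps)
  have u1: "unit_p (of_nat i - a)" if "i \<in> {1..hp}" for i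
  proof -
    have "unit_p ((2 * of_nat i - 1) / 2 + (- q) * P)" using that q by (intro unit_shift unit_divide unit_odd) auto
    then show ?thesis by (simp add: a_def field_simps)
  qed
  have u2: "unit_p (a - of_nat hp + of_nat j - 1)" if "j \<in> {1..hp}" for j
    unfolding az using that q hp_less by (intro unit_shift unit_of_nat_less) auto
  have z: "1/3 + of_nat k = (3 * of_nat k + 1) / (3 :: rat)" for k by simp
  have pos: "3 * of_nat k + 1 \<noteq> (0 :: rat)" for k
    by (metis of_nat_Suc of_nat_mult of_nat_numeral add.commute of_nat_neq_0)
  have nz: "1/3 + of_nat k \<noteq> (0 :: rat)" for k unfolding z using pos[of k] by simp
  have R: "(\<Prod>j=1..k. (a + of_nat j - 1) / (a - of_nat hp + of_nat j - 1)) = half_poch k * odd_quot (2 * q) k / shift_quot (q - 1/2) k" for k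
  proof -
    have "(a + of_nat j - 1) / (a - of_nat hp + of_nat j - 1) =
      (2 * of_nat j - 1) / (2 * of_nat j) * (1 + 2 * q * P / (2 * of_nat j - 1)) / (1 + (q - 1/2) * P / of_nat j)" if "j \<in> {1..k}" for j
    proof -
      have j: "of_nat j \<noteq> (0 :: rat)" using that by simp
      have "(2 * of_nat j - 1) / (2 * of_nat j) * (1 + 2 * q * P / (2 * of_nat j - 1)) = (2 * of_nat j - 1 + 2 * q * P) / (2 * of_nat j)"
        using odd_nz[of j] by (simp add: distrib_left add_divide_distrib)
      also have "\<dots> = (a + of_nat j - 1) / of_nat j" unfolding a_def using j by (simp add: field_simps)
      finally have "(2 * of_nat j - 1) / (2 * of_nat j) * (1 + 2 * q * P / (2 * of_nat j - 1)) = (a + of_nat j - 1) / of_nat j" .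
      moreover have "1 + (q - 1/2) * P / of_nat j = (a - of_nat hp + of_nat j - 1) / of_nat j"
        unfolding az using j by (simp add: field_simps)
      ultimately show ?thesis using j by simp
    qed
    then have "(\<Prod>j=1..k. (a + of_nat j - 1) / (a - of_nat hp + of_nat j - 1)) = (\<Prod>j=1..k. (2 * of_nat j - 1) / (2 * of_nat j) * (1 + 2 * q * P / (2 * of_nat j - 1)) / (1 + (q - 1/2) * P / of_nat j))"
      by (intro prod.cong) auto
    then show ?thesis
      by (simp add: half_poch_prod odd_quot_def shift_quot_def prod.distrib prod_dividef)
  qed
  have "T q = (\<Sum>k\<le>hp. (- 1) ^ k * of_nat (hp choose k)
       * (\<Prod>j=1..k. (a + of_nat j - 1) / (a - of_nat hp + of_nat j - 1)) / (1/3 + of_nat k)) / 3"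
    unfolding T_def sum_divide_distrib
  proof (rule sum.cong)
    fix k assume "k \<in> {..hp}"
    then show "(half_poch k)\<^sup>2 * V q k / (3 * of_nat k + 1) = (- 1) ^ k * of_nat (hp choose k)
       * (\<Prod>j=1..k. (a + of_nat j - 1) / (a - of_nat hp + of_nat j - 1)) / (1/3 + of_nat k) / 3"
      unfolding R z using pos[of k] by (simp add: binomial_half_poch V_def power2_eq_square)
  qed simp
  also have "\<dots> = fact hp * (\<Prod>i=1..hp. 1/3 + of_nat i - a) / ((\<Prod>i=1..hp. of_nat i - a) * (\<Prod>i\<le>hp. 1/3 + of_nat i)) / 3"
    by (rule arg_cong[where f = "\<lambda>x. x / 3"], rule saalschuetz_sum[OF nz unit_nz[OF u1] unit_nz[OF u2]])
  also have "(\<Prod>i\<le>hp. 1/3 + of_nat i) = 1/3 * (\<Prod>i=1..hp. of_nat i + 1/3 :: rat)"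
  proof -
    have "{..hp} = insert 0 {1..hp}" by auto
    then show ?thesis by (simp add: add.commute)
  qed
  also have "(\<Prod>i=1..hp. 1/3 + of_nat i - a) = (\<Prod>i=1..hp. of_nat i - 1/6 - q * P)"
    by (rule prod.cong) (auto simp: a_def)
  also have "(\<Prod>i=1..hp. of_nat i - a) = (\<Prod>i=1..hp. of_nat i - 1/2 - q * P)"
    by (rule prod.cong) (auto simp: a_def)
  finally show ?thesis by simp
qed

lemma log_exp_eqI: "log_exp x l m \<Longrightarrow> l = l' \<Longrightarrow> m = m' \<Longrightarrow> log_exp x l' m'"
  by simp

lemma log_exp_0D: "log_exp x 0 m \<Longrightarrow> cong_p 3 x (1 + P\<^sup>2 * m)"
  by (simp add: log_exp_def)

lemma log_exp_0D': "log_exp x 0 m \<Longrightarrow> cong_p 2 x 1"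
  by (rule cong_trans[OF cong_mono[OF log_exp_0D]], assumption, simp, rule congI[of _ _ _ m])
     (auto simp: log_exp_def)

lemma log_exp_add_P2:
  assumes "log_exp x l m" "d \<in> Zp" shows "log_exp (x + P\<^sup>2 * d) l (m + d)"
proof -
  have "cong_p 3 (x + P\<^sup>2 * d) (1 + P * l + P\<^sup>2 * (l\<^sup>2 / 2 + m) + P\<^sup>2 * d)"
    using assms by (intro cong_add) (auto simp: log_exp_def)
  then show ?thesis using assms by (simp add: log_exp_def algebra_simps)
qed

text \<open>The quotients of the products in \<open>S4\<close> and \<open>S16\<close> by \<open>V 0\<close> and \<open>V 1\<close>. They are \<open>1\<close>
modulo \<open>p\<^sup>2\<close>; the second order terms are needed for the one term with \<open>3k+1 = p\<close>.\<close>

definition W4 :: "nat \<Rightarrow> rat" where "W4 k = shift_quot 1 k * shift_quot (- 1/2) k * shift_quot (- 1/2) k"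
definition W16 :: "nat \<Rightarrow> rat" where
  "W16 k = odd_quot 1 k / (odd_quot (- 1) k * odd_quot 2 k) * (shift_quot (1/2) k * shift_quot (1/2) k * shift_quot (- 1) k)"

lemma log_exp_W4: assumes "k \<le> hp" shows "log_exp (W4 k) 0 (- (3/4) * H2 k)"
proof -
  have k: "k < p" using assms hp_less by simp
  have "log_exp (W4 k) (1 * H1 k + - 1/2 * H1 k + - 1/2 * H1 k)
    (- (1\<^sup>2) / 2 * H2 k + - ((- 1/2)\<^sup>2) / 2 * H2 k + - ((- 1/2)\<^sup>2) / 2 * H2 k)"
    unfolding W4_def using k by (intro log_exp_mult log_exp_shift_quot) auto
  then show ?thesis by (rule log_exp_eqI) (simp_all add: field_simps power2_eq_square)
qed

lemma log_exp_W16: assumes "k \<le> hp" shows "log_exp (W16 k) 0 (2 * O2 k - 3/4 * H2 k)"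
proof -
  have k: "k < p" using assms hp_less by simp
  have "log_exp (W16 k) (1 * O1 k - (- 1 * O1 k + 2 * O1 k) + (1/2 * H1 k + 1/2 * H1 k + - 1 * H1 k))
    (- (1\<^sup>2) / 2 * O2 k - (- ((- 1)\<^sup>2) / 2 * O2 k + - (2\<^sup>2) / 2 * O2 k)
      + (- ((1/2)\<^sup>2) / 2 * H2 k + - ((1/2)\<^sup>2) / 2 * H2 k + - ((- 1)\<^sup>2) / 2 * H2 k))"
    unfolding W16_def using k assms by (intro log_exp_mult log_exp_divide log_exp_shift_quot log_exp_odd_quot) auto
  then show ?thesis by (rule log_exp_eqI) (simp_all add: field_simps power2_eq_square)
qed

lemma unit_odd_quot: "k \<le> hp \<Longrightarrow> a \<in> Zp \<Longrightarrow> unit_p (odd_quot a k)"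
  using log_exp_odd_quot log_exp_unit by blast

lemma unit_shift_quot: "k < p \<Longrightarrow> a \<in> Zp \<Longrightarrow> unit_p (shift_quot a k)"
  using log_exp_shift_quot log_exp_unit by blast

lemma unit_V: "k \<le> hp \<Longrightarrow> q \<in> Zp \<Longrightarrow> unit_p (V q k)"
  unfolding V_def using hp_less by (intro unit_divide unit_mult unit_odd_quot unit_shift_quot) auto

lemma V_W4: assumes "k \<le> hp" shows "shift_quot 1 k * shift_quot (- 1) (2 * k) = V 0 k * W4 k"
proof -
  have "shift_quot (- 1/2) k \<noteq> 0" using assms hp_less by (intro unit_nz unit_shift_quot) auto
  moreover have "odd_quot 0 k = 1" by (simp add: odd_quot_def)
  ultimately show ?thesis unfolding shift_quot_double V_def W4_def by (simp add: field_simps)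
qed

lemma V_W16: assumes "k \<le> hp" shows "shift_quot 1 (2 * k) * shift_quot (- 1) k = V 1 k * W16 k"
proof -
  have "shift_quot (1/2) k \<noteq> 0" using assms hp_less by (intro unit_nz unit_shift_quot) auto
  moreover have "odd_quot (- 1) k \<noteq> 0" "odd_quot 2 k \<noteq> 0" using assms by (auto intro!: unit_nz unit_odd_quot)
  ultimately show ?thesis unfolding shift_quot_double V_def W16_def by (simp add: field_simps)
qed

text \<open>A factor that is \<open>1\<close> modulo \<open>p\<^sup>2\<close> may be dropped, because the term is \<open>p\<close> times an
element of \<open>Zp\<close>.\<close>

lemma regular_term:
  assumes k: "k \<le> hp" and q: "q \<in> Zp" and u: "unit_p (3 * of_nat k + 1)" and W: "cong_p 2 W 1"
  shows "cong_p 3 (summand k (V q k * W)) (P * ((half_poch k)\<^sup>2 * V q k / (3 * of_nat k + 1)))"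
proof -
  have "cong_p 2 ((half_poch k)\<^sup>2 * V q k / (3 * of_nat k + 1) * W) ((half_poch k)\<^sup>2 * V q k / (3 * of_nat k + 1) * 1)"
    using k q u W unit_V[OF k q] unit_half_poch[OF k] by (intro cong_mult_left) auto
  then have "cong_p 3 (P * ((half_poch k)\<^sup>2 * V q k / (3 * of_nat k + 1) * W)) (P * ((half_poch k)\<^sup>2 * V q k / (3 * of_nat k + 1) * 1))"
    by (rule cong_mult_P1)
  then show ?thesis by (simp add: mult_ac)
qed

text \<open>The bound is \<open>2 p\<close> and not \<open>p\<close>: the factor with \<open>j = p\<close> is \<open>2\<close>.\<close>

lemma shift_quot_1_Zp: assumes "n < 2 * p" shows "shift_quot 1 n \<in> Zp"
  unfolding shift_quot_def
proof (rule Zp_prod)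
  fix j assume j: "j \<in> {1..n}"
  show "1 + 1 * P / of_nat j \<in> Zp"
  proof (cases "j = p")
    case False
    have "\<not> p dvd j"
    proof
      assume "p dvd j"
      then obtain c where c: "j = p * c" by (elim dvdE)
      then have "c \<noteq> 0" "c \<noteq> 1" using j False by auto
      then have "2 \<le> c" by simp
      then have "2 * p \<le> j" unfolding c by simp
      then show False using j assms by simp
    qed
    then show ?thesis by (intro Zp_add Zp_divide unit_of_nat) auto
  qed simp
qed

text \<open>For such \<open>k\<close> the factorial of \<open>2k\<close> contains \<open>p\<close>, that of \<open>k\<close> does not.\<close>

lemma half_poch_large:
  assumes "hp < k" "k < p" shows "half_poch k \<in> Zp" "cong_p 1 (half_poch k) 0"
proof -
  have "p \<le> 2 * k" using assms p_hp by simp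
  then have "p dvd fact (2 * k)" using p_gt_3 by (intro dvd_fact) auto
  then obtain c where c: "fact (2 * k) = p * c" by (elim dvdE)
  have eq: "half_poch k = P * (of_nat c / (4 ^ k * fact k ^ 2))"
    using arg_cong[OF c, of "of_nat :: nat \<Rightarrow> rat"] by (simp add: half_poch_def)
  have Z: "of_nat c / (4 ^ k * fact k ^ 2) \<in> Zp" using assms by (intro Zp_divide unit_mult unit_power unit_fact) auto
  show "half_poch k \<in> Zp" unfolding eq using Z by (intro Zp_mult) auto
  show "cong_p 1 (half_poch k) 0" using eq Z by (intro congI[of _ _ _ "of_nat c / (4 ^ k * fact k ^ 2)"]) auto
qed

lemma large_term:
  assumes k: "hp < k" "k < p" and u: "unit_p (3 * of_nat k + 1)"
  shows "cong_p 3 (summand k (shift_quot 1 (2 * k) * shift_quot (- 1) k)) 0"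
proof -
  obtain z where z: "z \<in> Zp" "half_poch k = P * z" using half_poch_large(2)[OF k] by (auto elim: congE)
  have "shift_quot 1 (2 * k) \<in> Zp" using k by (intro shift_quot_1_Zp) auto
  moreover have "shift_quot (- 1) k \<in> Zp" using k by (intro unit_Zp unit_shift_quot) auto
  ultimately show ?thesis using z u
    by (intro congI[of _ _ _ "z\<^sup>2 * (shift_quot 1 (2 * k) * shift_quot (- 1) k) / (3 * of_nat k + 1)"])
       (auto simp: power_mult_distrib eval_nat_numeral)
qed

lemma P_T: "P * T q = (\<Sum>k\<le>hp. P * ((half_poch k)\<^sup>2 * V q k / (3 * of_nat k + 1)))"
  by (simp add: T_def sum_distrib_left)

lemma unit_denominator: "\<not> p dvd 3 * k + 1 \<Longrightarrow> unit_p (3 * of_nat k + 1)"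
  using unit_of_nat[of "3 * k + 1"] by (simp add: add.commute)

lemma singular_denominator: assumes "p dvd 3 * k + 1" "k < p" shows "3 * k + 1 = p \<or> 3 * k + 1 = 2 * p"
proof -
  obtain c where c: "3 * k + 1 = p * c" using assms(1) by (elim dvdE)
  have "c \<noteq> 0" using c by (intro notI) simp
  moreover have "c < 3"
  proof (rule ccontr)
    assume "\<not> c < 3"
    then have "p * 3 \<le> p * c" by (intro mult_le_mono2) simp
    then show False using c assms(2) by linarith
  qed
  ultimately have "c = 1 \<or> c = 2" by auto
  then show ?thesis using c by auto
qed

text \<open>For \<open>k \<le> hp\<close> the number \<open>3k+1\<close> is less than \<open>2p\<close>, and it is not \<open>p\<close>, so all terms are regular.\<close>

lemma S4_cong_nonsplit:
  assumes "p mod 3 = 2" shows "cong_p 3 S4 (P * T 0)"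
  unfolding S4_eq P_T
proof (rule cong_sum)
  fix k assume "k \<in> {..hp}"
  then have k: "k \<le> hp" by simp
  have "\<not> p dvd 3 * k + 1"
  proof
    assume "p dvd 3 * k + 1"
    from singular_denominator[OF this] have "3 * k + 1 = p \<or> 3 * k + 1 = 2 * p" using k hp_less by simp
    then have "3 * k + 1 = p" using k p_hp by linarith
    then show False using assms by presburger
  qed
  then show "cong_p 3 (summand k (shift_quot 1 k * shift_quot (- 1) (2 * k)))
     (P * ((half_poch k)\<^sup>2 * V 0 k / (3 * of_nat k + 1)))"
    unfolding V_W4[OF k] using k by (intro regular_term unit_denominator log_exp_0D'[OF log_exp_W4]) auto
qed

lemma S16_split_sum: "S16 = (\<Sum>k\<le>hp. summand k (V 1 k * W16 k))
   + (\<Sum>k\<in>{hp<..<p}. summand k (shift_quot 1 (2 * k) * shift_quot (- 1) k))"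
proof -
  have "{..<p} = {..hp} \<union> {hp<..<p}" using hp_less by auto
  then have "S16 = (\<Sum>k\<le>hp. summand k (shift_quot 1 (2 * k) * shift_quot (- 1) k))
   + (\<Sum>k\<in>{hp<..<p}. summand k (shift_quot 1 (2 * k) * shift_quot (- 1) k))"
    unfolding S16_eq by (simp only: sum.union_disjoint[OF finite_atMost finite_greaterThanLessThan, of hp hp p] ivl_disj_int)
  then show ?thesis by (simp add: V_W16)
qed

text \<open>Here \<open>k\<close> runs up to \<open>p-1\<close>. The terms with \<open>k > hp\<close> contain \<open>p\<^sup>3\<close>, except that \<open>3k+1 = 2p\<close>
takes one factor away from the term with \<open>k = K\<close>.\<close>

lemma S16_cong_nonsplit:
  assumes K: "3 * K + 1 = 2 * p"
  shows "cong_p 3 S16 (P * T 1 + 1/2 * (half_poch K)\<^sup>2 * (shift_quot 1 (2 * K) * shift_quot (- 1) K))"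
proof -
  have nd: "p dvd 3 * k + 1 \<longleftrightarrow> k = K" if "k < p" for k
  proof
    assume "p dvd 3 * k + 1"
    from singular_denominator[OF this that] have "3 * k + 1 = 2 * p" using K by presburger
    then show "k = K" using K by simp
  qed (use K in auto)
  have "K < p" using K p_gt_3 by simp
  have "hp < K" using K p_hp p_gt_3 by simp
  have 3: "P / (3 * of_nat K + 1) = 1/2"
  proof -
    have "3 * of_nat K + 1 = 2 * P" using arg_cong[OF K, of "of_nat :: nat \<Rightarrow> rat"] by simp
    then show ?thesis by simp
  qed
  have "cong_p 3 (\<Sum>k\<le>hp. summand k (V 1 k * W16 k)) (P * T 1)"
    unfolding P_T using \<open>hp < K\<close> hp_less nd
    by (intro cong_sum regular_term unit_denominator log_exp_0D'[OF log_exp_W16]) auto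
  moreover have "cong_p 3 (\<Sum>k\<in>{hp<..<p}. summand k (shift_quot 1 (2 * k) * shift_quot (- 1) k))
     (\<Sum>k\<in>{hp<..<p}. if k = K then 1/2 * (half_poch K)\<^sup>2 * (shift_quot 1 (2 * K) * shift_quot (- 1) K) else 0)"
  proof (rule cong_sum)
    fix k assume k: "k \<in> {hp<..<p}"
    show "cong_p 3 (summand k (shift_quot 1 (2 * k) * shift_quot (- 1) k))
       (if k = K then 1/2 * (half_poch K)\<^sup>2 * (shift_quot 1 (2 * K) * shift_quot (- 1) K) else 0)"
    proof (cases "k = K")
      case True
      then show ?thesis using 3 by simp
    next
      case False
      then show ?thesis using k nd[of k] large_term[OF _ _ unit_denominator, of k] by simp
    qed
  qed
  ultimately show ?thesis
    unfolding S16_split_sum using \<open>hp < K\<close> \<open>K < p\<close> by (auto dest: cong_add)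
qed

text \<open>The term with \<open>3k+1 = p\<close> has no factor \<open>p\<close>, so the second order part of \<open>W\<close> survives in it.\<close>

lemma singular_sum:
  assumes m: "3 * m + 1 = p" and q: "q \<in> Zp" and W: "\<And>k. k \<le> hp \<Longrightarrow> log_exp (W k) 0 (w k)"
  shows "cong_p 3 (\<Sum>k\<le>hp. summand k (V q k * W k))
     (P * T q + P\<^sup>2 * ((half_poch m)\<^sup>2 * V q m * w m))"
proof -
  have nd: "p dvd 3 * k + 1 \<longleftrightarrow> k = m" if "k \<le> hp" for k
  proof
    assume "p dvd 3 * k + 1"
    from singular_denominator[OF this] have "3 * k + 1 = p \<or> 3 * k + 1 = 2 * p" using that hp_less by simp
    then show "k = m" using that m p_hp by linarith
  qed (use m in auto)
  have mh: "m \<le> hp" using m p_hp by simp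
  have Pm: "3 * of_nat m + 1 = P" using arg_cong[OF m, of "of_nat :: nat \<Rightarrow> rat"] by simp
  have Z: "(half_poch m)\<^sup>2 * V q m \<in> Zp" using unit_half_poch[OF mh] unit_V[OF mh q] by auto
  have "cong_p 3 (\<Sum>k\<le>hp. summand k (V q k * W k))
     (\<Sum>k\<le>hp. P * ((half_poch k)\<^sup>2 * V q k / (3 * of_nat k + 1)) + (if k = m then P\<^sup>2 * ((half_poch m)\<^sup>2 * V q m * w m) else 0))"
  proof (rule cong_sum)
    fix k assume "k \<in> {..hp}"
    then have k: "k \<le> hp" by simp
    show "cong_p 3 (summand k (V q k * W k))
       (P * ((half_poch k)\<^sup>2 * V q k / (3 * of_nat k + 1)) + (if k = m then P\<^sup>2 * ((half_poch m)\<^sup>2 * V q m * w m) else 0))"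
    proof (cases "k = m")
      case True
      have "cong_p 3 ((half_poch m)\<^sup>2 * V q m * W m) ((half_poch m)\<^sup>2 * V q m * (1 + P\<^sup>2 * w m))"
        using Z log_exp_0D[OF W[OF mh]] by (intro cong_mult_left)
      then show ?thesis unfolding True Pm by (simp add: algebra_simps)
    next
      case False
      then show ?thesis using regular_term[OF k q unit_denominator log_exp_0D'[OF W[OF k]]] nd[OF k] by simp
    qed
  qed
  also have "(\<Sum>k\<le>hp. P * ((half_poch k)\<^sup>2 * V q k / (3 * of_nat k + 1)) + (if k = m then P\<^sup>2 * ((half_poch m)\<^sup>2 * V q m * w m) else 0))
    = P * T q + P\<^sup>2 * ((half_poch m)\<^sup>2 * V q m * w m)"
    using mh by (simp add: sum.distrib P_T)
  finally show ?thesis .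
qed

lemma S4_cong_split:
  assumes m: "3 * m + 1 = p"
  shows "cong_p 3 S4 (P * T 0 + P\<^sup>2 * ((half_poch m)\<^sup>2 * V 0 m * (- (3/4) * H2 m)))"
proof -
  have "S4 = (\<Sum>k\<le>hp. summand k (V 0 k * W4 k))"
    unfolding S4_eq by (simp add: V_W4)
  then show ?thesis using singular_sum[OF m _ log_exp_W4, of 0] by simp
qed

lemma S16_cong_split:
  assumes m: "3 * m + 1 = p"
  shows "cong_p 3 S16 (P * T 1 + P\<^sup>2 * ((half_poch m)\<^sup>2 * V 1 m * (2 * O2 m - 3/4 * H2 m)))"
proof -
  have nd: "\<not> p dvd 3 * k + 1" if "hp < k" "k < p" for k
  proof
    assume "p dvd 3 * k + 1"
    from singular_denominator[OF this that(2)] have "3 * k + 1 = 2 * p" using that m p_hp by linarith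
    then show False using m by presburger
  qed
  have "cong_p 3 (\<Sum>k\<in>{hp<..<p}. summand k (shift_quot 1 (2 * k) * shift_quot (- 1) k)) (\<Sum>k\<in>{hp<..<p}. 0)"
    using nd by (intro cong_sum large_term unit_denominator) auto
  from cong_add[OF singular_sum[OF m _ log_exp_W16, of 1] this]
  show ?thesis unfolding S16_split_sum by simp
qed

section \<open>Harmonic numbers\<close>

lemma inverse_reflect:
  assumes j: "unit_p j"
  shows "cong_p 2 (1 / (P - j)) (- (1 / j) - P / j\<^sup>2)" "cong_p 1 (1 / (P - j)\<^sup>2) (1 / j\<^sup>2)"
proof -
  have u: "unit_p (P - j)" using unit_shift[of "- j" 1] j by simp
  have nz: "j \<noteq> 0" "P - j \<noteq> 0" using unit_nz[OF j] unit_nz[OF u] by auto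
  have "1 / (P - j) = - (1 / j) - P / j\<^sup>2 + P ^ 2 * (1 / (j\<^sup>2 * (P - j)))"
    using nz by (simp add: divide_simps power2_eq_square) (simp add: algebra_simps)
  then show "cong_p 2 (1 / (P - j)) (- (1 / j) - P / j\<^sup>2)"
    using j u by (intro congI[of _ _ _ "1 / (j\<^sup>2 * (P - j))"]) auto
  have "1 / (P - j)\<^sup>2 = 1 / j\<^sup>2 + P ^ 1 * ((2 * j - P) / (j\<^sup>2 * (P - j)\<^sup>2))"
    using nz by (simp add: divide_simps power2_eq_square) (simp add: algebra_simps)
  then show "cong_p 1 (1 / (P - j)\<^sup>2) (1 / j\<^sup>2)"
    using j u by (intro congI[of _ _ _ "(2 * j - P) / (j\<^sup>2 * (P - j)\<^sup>2)"]) auto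
qed

text \<open>The terms with index above \<open>p-1-u\<close> are \<open>1 / (p-i)\<close> with \<open>i \<le> u\<close>, and these are expanded in powers of
\<open>p\<close>.\<close>

lemma H1_reflect:
  "u < p \<Longrightarrow> cong_p 2 (H1 (p - 1 - u)) (H1 (p - 1) + H1 u + P * H2 u)"
  and H2_reflect: "u < p \<Longrightarrow> cong_p 1 (H2 (p - 1 - u)) (H2 (p - 1) - H2 u)"
proof -
  have "cong_p 2 (H1 (p - 1 - u)) (H1 (p - 1) + H1 u + P * H2 u) \<and> cong_p 1 (H2 (p - 1 - u)) (H2 (p - 1) - H2 u)"
    if "u < p" for u
    using that
  proof (induction u)
    case 0
    then show ?case by (simp add: H1_def H2_def)
  next
    case (Suc u)
    define i :: rat where "i = of_nat (Suc u)"
    have e: "p - 1 - u = Suc (p - 1 - Suc u)" using Suc.prems by simp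
    have iu: "unit_p i" unfolding i_def using Suc.prems by (intro unit_of_nat_less) auto
    have H: "H1 (p - 1 - Suc u) = H1 (p - 1 - u) - 1 / (P - i)" "H2 (p - 1 - Suc u) = H2 (p - 1 - u) - 1 / (P - i)\<^sup>2"
      unfolding e H1_def H2_def i_def using Suc.prems by (simp_all add: of_nat_diff)
    note c1 = inverse_reflect(1)[OF iu] and c2 = inverse_reflect(2)[OF iu]
    have "cong_p 2 (H1 (p - 1 - Suc u)) (H1 (p - 1) + H1 u + P * H2 u - (- (1 / i) - P / i\<^sup>2))"
      unfolding H using Suc c1 by (intro cong_diff) auto
    moreover have "H1 (p - 1) + H1 u + P * H2 u - (- (1 / i) - P / i\<^sup>2) = H1 (p - 1) + H1 (Suc u) + P * H2 (Suc u)"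
      by (simp add: H1_def H2_def i_def distrib_left)
    moreover have "cong_p 1 (H2 (p - 1 - Suc u)) (H2 (p - 1) - H2 u - 1 / i\<^sup>2)"
      unfolding H using Suc c2 by (intro cong_diff) auto
    moreover have "H2 (p - 1) - H2 u - 1 / i\<^sup>2 = H2 (p - 1) - H2 (Suc u)"
      by (simp add: H2_def i_def)
    ultimately show ?case by (simp only: simp_thms)
  qed
  then show "u < p \<Longrightarrow> cong_p 2 (H1 (p - 1 - u)) (H1 (p - 1) + H1 u + P * H2 u)"
    "u < p \<Longrightarrow> cong_p 1 (H2 (p - 1 - u)) (H2 (p - 1) - H2 u)" by auto
qed

text \<open>The odd number \<open>2j-1\<close> is \<open>p - 2i\<close> with \<open>i = hp + 1 - j\<close>, so a sum over odd numbers becomes one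
over the numbers from \<open>hp - N + 1\<close> to \<open>hp\<close>.\<close>

lemma O1_reflect: "N \<le> hp \<Longrightarrow> cong_p 2 (O1 N) (- (H1 hp - H1 (hp - N)) / 2 - P * (H2 hp - H2 (hp - N)) / 4)"
  and O2_reflect: "N \<le> hp \<Longrightarrow> cong_p 1 (O2 N) ((H2 hp - H2 (hp - N)) / 4)"
proof -
  have "cong_p 2 (O1 N) (- (H1 hp - H1 (hp - N)) / 2 - P * (H2 hp - H2 (hp - N)) / 4)
    \<and> cong_p 1 (O2 N) ((H2 hp - H2 (hp - N)) / 4)" if "N \<le> hp" for N
    using that
  proof (induction N)
    case 0
    then show ?case by (simp add: O1_def O2_def)
  next
    case (Suc N)
    define i :: rat where "i = of_nat (hp - N)"
    have e: "hp - N = Suc (hp - Suc N)" using Suc.prems by simp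
    have iu: "unit_p i" unfolding i_def using Suc.prems hp_less by (intro unit_of_nat_less) auto
    have o: "2 * of_nat (Suc N) - 1 = P - 2 * i" unfolding i_def P_hp using Suc.prems by (simp add: of_nat_diff)
    have H: "H1 (hp - Suc N) = H1 (hp - N) - 1 / i" "H2 (hp - Suc N) = H2 (hp - N) - 1 / i\<^sup>2"
      unfolding e H1_def H2_def i_def using Suc.prems by (simp_all add: of_nat_diff)
    have O: "O1 (Suc N) = O1 N + 1 / (P - 2 * i)" "O2 (Suc N) = O2 N + 1 / (P - 2 * i)\<^sup>2"
      unfolding o[symmetric] O1_def O2_def by simp_all
    have nz: "i \<noteq> 0" using iu by (rule unit_nz)
    have "unit_p (2 * i)" using iu by simp
    note c = inverse_reflect[OF this]
    have c1: "cong_p 2 (1 / (P - 2 * i)) (- (1 / (2 * i)) - P / (4 * i\<^sup>2))"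
      and c2: "cong_p 1 (1 / (P - 2 * i)\<^sup>2) (1 / (4 * i\<^sup>2))"
      using c by (simp_all add: power_mult_distrib)
    have "cong_p 2 (O1 (Suc N)) (- (H1 hp - H1 (hp - N)) / 2 - P * (H2 hp - H2 (hp - N)) / 4 + (- (1 / (2 * i)) - P / (4 * i\<^sup>2)))"
      unfolding O using Suc c1 by (intro cong_add) auto
    moreover have "- (H1 hp - H1 (hp - N)) / 2 - P * (H2 hp - H2 (hp - N)) / 4 + (- (1 / (2 * i)) - P / (4 * i\<^sup>2)) = (- (H1 hp - H1 (hp - Suc N)) / 2 - P * (H2 hp - H2 (hp - Suc N)) / 4)"
      unfolding H using nz by (simp add: field_simps power2_eq_square)
    moreover have "cong_p 1 (O2 (Suc N)) ((H2 hp - H2 (hp - N)) / 4 + 1 / (4 * i\<^sup>2))"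
      unfolding O using Suc c2 by (intro cong_add) auto
    moreover have "(H2 hp - H2 (hp - N)) / 4 + 1 / (4 * i\<^sup>2) = (H2 hp - H2 (hp - Suc N)) / 4"
      unfolding H using nz by (simp add: field_simps)
    ultimately show ?case by (simp only: simp_thms)
  qed
  then show "N \<le> hp \<Longrightarrow> cong_p 2 (O1 N) (- (H1 hp - H1 (hp - N)) / 2 - P * (H2 hp - H2 (hp - N)) / 4)"
    "N \<le> hp \<Longrightarrow> cong_p 1 (O2 N) ((H2 hp - H2 (hp - N)) / 4)" by auto
qed

text \<open>Modulo \<open>p\<close>, reflection makes the full sum of \<open>1/j\<^sup>2\<close> twice the sum up to \<open>hp\<close>, whereas splitting it
by parity makes it half of that sum. Hence both vanish, as \<open>3\<close> is a unit. For the sum of \<open>1/j\<close>, the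
reflection formula modulo \<open>p\<^sup>2\<close> then gives twice the sum equal to zero.\<close>

lemma H2_hp: "cong_p 1 (H2 hp) 0" and H2_full: "cong_p 1 (H2 (p - 1)) 0"
  and H1_full: "cong_p 2 (H1 (p - 1)) 0"
proof -
  have e: "p - 1 = 2 * hp" "p - 1 - hp = hp" using p_hp by auto
  have 1: "cong_p 1 (H2 (p - 1) - H2 hp / 4) (H2 hp / 4)"
    using O2_reflect[of hp] unfolding O2_eq e(1)[symmetric] by (simp add: H2_def)
  have 2: "cong_p 1 (H2 hp) (H2 (p - 1) - H2 hp)"
    using H2_reflect[of hp] hp_less unfolding e(2) by simp
  obtain z where z: "z \<in> Zp" "H2 (p - 1) - H2 hp / 4 = H2 hp / 4 + P * z" using 1 by (auto elim: congE)
  obtain t where t: "t \<in> Zp" "H2 hp = H2 (p - 1) - H2 hp + P * t" using 2 by (auto elim: congE)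
  have h: "H2 hp = P * ((z + t) * 2 / 3)" using z t by (simp add: field_simps)
  show hp0: "cong_p 1 (H2 hp) 0"
    by (rule congI[of _ _ _ "(z + t) * 2 / 3"]) (use h z t in auto)
  have f: "H2 (p - 1) = P * ((z + t) / 3 + z)" using z h by (simp add: field_simps)
  show full: "cong_p 1 (H2 (p - 1)) 0"
    by (rule congI[of _ _ _ "(z + t) / 3 + z"]) (use f z t in auto)
  have "cong_p 2 (H1 (p - 1 - (p - 1))) (H1 (p - 1) + H1 (p - 1) + P * H2 (p - 1))"
    using H1_reflect[of "p - 1"] by simp
  then obtain s where s: "s \<in> Zp" "0 = 2 * H1 (p - 1) + P * H2 (p - 1) + P ^ 2 * s"
    by (auto elim!: congE simp: H1_def)
  have "H1 (p - 1) = P ^ 2 * (- (s + ((z + t) / 3 + z)) / 2)"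
    using s(2) unfolding f by (simp add: power2_eq_square algebra_simps)
  then show "cong_p 2 (H1 (p - 1)) 0"
    using s z t by (intro congI[of _ _ _ "- (s + ((z + t) / 3 + z)) / 2"]) auto
qed

lemma log_exp_shift_quot_full:
  assumes "a \<in> Zp" shows "log_exp (shift_quot a (p - 1)) 0 0"
proof (rule log_exp_shift[OF log_exp_shift_quot[of "p - 1" a], where d = 0])
  show "cong_p 2 (a * H1 (p - 1)) (0 + P * 0)"
    using cong_mult_left[OF H1_full assms] by simp
  show "cong_p 1 (- a\<^sup>2 / 2 * H2 (p - 1) + 0) 0"
    using cong_mult_left[OF H2_full, of "- a\<^sup>2 / 2"] assms by simp
qed (use assms in auto)

section \<open>Shifted factorials\<close>

definition shift_fact :: "rat \<Rightarrow> nat \<Rightarrow> rat" where "shift_fact x n = (\<Prod>j=1..n. of_nat j + x * P)"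

lemma shift_fact_eq: "shift_fact x n = fact n * shift_quot x n"
  unfolding shift_fact_def by (rule prod_shift_eq)

text \<open>The factors with \<open>j > p-1-u\<close> are rewritten by \<open>j \<mapsto> p - j\<close>.\<close>

lemma shift_fact_reflect: "u < p \<Longrightarrow> shift_fact x (p - 1) = shift_fact x (p - 1 - u) * ((- 1) ^ u * shift_fact (- 1 - x) u)"
proof (induction u)
  case (Suc u)
  have e: "p - 1 - u = Suc (p - 1 - Suc u)" using Suc.prems by simp
  define w where "w = of_nat (Suc u) + (- 1 - x) * P"
  have "shift_fact x (p - 1 - u) = shift_fact x (p - 1 - Suc u) * (of_nat (p - 1 - u) + x * P)"
    unfolding e shift_fact_def by simp
  also have "of_nat (p - 1 - u) + x * P = - w"
    using Suc.prems by (simp add: of_nat_diff algebra_simps w_def)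
  finally have 1: "shift_fact x (p - 1 - u) = shift_fact x (p - 1 - Suc u) * - w" .
  have 2: "shift_fact (- 1 - x) (Suc u) = shift_fact (- 1 - x) u * w"
    by (simp add: shift_fact_def w_def)
  have "shift_fact x (p - 1) = shift_fact x (p - 1 - u) * ((- 1) ^ u * shift_fact (- 1 - x) u)" using Suc by simp
  then show ?case unfolding 1 2 by (simp add: mult_ac)
qed (simp add: shift_fact_def)

lemma shift_fact_interval: "(\<Prod>i=1..n. of_nat i + of_nat m + x * P) = shift_fact x (m + n) / shift_fact x m" if "shift_fact x m \<noteq> 0"
proof -
  have "shift_fact x (m + n) = shift_fact x m * (\<Prod>i=1..n. of_nat i + of_nat m + x * P)"
    by (induction n) (simp_all add: shift_fact_def algebra_simps)
  then show ?thesis using that by simp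
qed

lemma shift_quot_0: "shift_quot 0 n = 1"
  by (simp add: shift_quot_def)

lemma unit_shift_fact: "n < p \<Longrightarrow> x \<in> Zp \<Longrightarrow> unit_p (shift_fact x n)"
  unfolding shift_fact_eq by (intro unit_mult unit_fact unit_shift_quot)

text \<open>This product is common to both residue classes of \<open>p\<close>: \<open>1/2\<close> is \<open>p/2 - hp\<close>.\<close>

lemma T_denominator:
  "(\<Prod>i=1..hp. of_nat i - 1/2 - q * P) = (- 1) ^ hp * shift_fact (q - 1/2) hp"
proof -
  have "(\<Prod>i=1..hp. of_nat i - 1/2 - q * P) = (\<Prod>j=1..hp. - 1 * (of_nat j + (q - 1/2) * P))"
  proof (rule prod.reindex_bij_witness[where i = "\<lambda>j. hp + 1 - j" and j = "\<lambda>i. hp + 1 - i"])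
    fix i assume i: "i \<in> {1..hp}"
    then have "of_nat (hp + 1 - i) = (of_nat hp + 1 - of_nat i :: rat)" by (simp add: of_nat_diff)
    then show "- 1 * (of_nat (hp + 1 - i) + (q - 1/2) * P) = of_nat i - 1/2 - q * P"
      by (simp add: P_hp field_simps)
  qed auto
  then show ?thesis unfolding prod.distrib by (simp add: shift_fact_def)
qed

end

section \<open>Primes congruent to 1 modulo 3: the value of the sums\<close>

text \<open>A prime \<open>p \<equiv> 1 (mod 3)\<close> splits in the field generated by \<open>\<surd>(-3)\<close>, hence the name.\<close>

locale split_prime = prime_gt_3 +
  fixes h :: nat
  assumes p_eq: "p = 6 * h + 1"
begin

lemma hp_eq: "hp = 3 * h" and P_eq: "P = 6 * of_nat h + 1" and h_pos: "h > 0"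
  using p_hp p_eq p_gt_3 by auto

lemma h_less: "h < p" "2 * h < p" "3 * h < p" "6 * h < p"
  using p_eq by auto

definition C :: rat where "C = of_nat (3 * h choose h)"

lemma C_eq: "C = fact (3 * h) / (fact h * fact (2 * h))"
  by (simp add: C_def binomial_fact)

lemma unit_C: "unit_p C"
  unfolding C_eq using h_less by (intro unit_divide unit_mult unit_fact) auto

text \<open>The products of factors \<open>1 + a p / j\<close> that remain of \<open>P * T q\<close> after the factorials have been
collected in \<open>C\<close>.\<close>

definition E :: "rat \<Rightarrow> rat" where
  "E q = shift_quot (- 1/6 - q) (p - 1) * shift_quot (- 1) (3 * h) / (shift_quot (q - 5/6) (2 * h) * shift_quot (- 1/6 - q) h
     * shift_quot (q - 1/2) (3 * h) * shift_quot (- 1/3) (2 * h) * shift_quot (1/3) h)"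

text \<open>Modulo \<open>p\<close> the number \<open>1/6\<close> is \<open>- h\<close>; precisely, \<open>1/6 = p/6 - h\<close>.\<close>

lemma T_numerator:
  assumes "q \<in> Zp"
  shows "(\<Prod>i=1..hp. of_nat i - 1/6 - q * P) = shift_fact (- 1/6 - q) (4 * h) / shift_fact (- 1/6 - q) h"
proof -
  have "unit_p (shift_fact (- 1/6 - q) h)" using assms h_less by (intro unit_shift_fact) auto
  then have "(\<Prod>i=1..hp. of_nat i + of_nat h + (- 1/6 - q) * P) = shift_fact (- 1/6 - q) (h + hp) / shift_fact (- 1/6 - q) h"
    by (intro shift_fact_interval unit_nz)
  moreover have "of_nat i + of_nat h + (- 1/6 - q) * P = of_nat i - 1/6 - q * P" for i
    by (simp add: P_eq field_simps)
  moreover have "h + hp = 4 * h" by (simp add: hp_eq)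
  ultimately show ?thesis by (simp only:)
qed

text \<open>Since \<open>1/3 = p/3 - 2h\<close>, the factors are shifts of the integers from \<open>1 - 2h\<close> to \<open>h\<close>. The one
belonging to \<open>0\<close> is \<open>p/3\<close>, and the factor \<open>-1/3\<close> that completes the negative ones to a shifted
factorial removes its denominator.\<close>

lemma T_third:
  "(\<Prod>i=1..hp. of_nat i + 1/3) = P * shift_fact (- 1/3) (2 * h) * shift_fact (1/3) h"
proof -
  obtain g where g: "2 * h = Suc g" using h_pos by (cases "2 * h") auto
  have gP: "of_nat g + 1 = (P - 1) / 3" using arg_cong[OF g, of "of_nat :: nat \<Rightarrow> rat"] by (simp add: P_eq)
  have "{1..hp} = {1..g} \<union> {Suc g} \<union> {Suc g + 1..Suc g + h}" using g by (auto simp: hp_eq)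
  then have "(\<Prod>i=1..hp. of_nat i + 1/3) = (\<Prod>i=1..g. of_nat i + 1/3) * (of_nat (Suc g) + 1/3) * (\<Prod>i=Suc g + 1..Suc g + h. of_nat i + 1/3 :: rat)"
    by (simp add: prod.union_disjoint)
  also have "(\<Prod>i=Suc g + 1..Suc g + h. of_nat i + 1/3) = shift_fact (1/3) h"
    unfolding shift_fact_def
    by (rule prod.reindex_bij_witness[where i = "\<lambda>i. i + Suc g" and j = "\<lambda>i. i - Suc g"]) (use gP in \<open>auto simp: of_nat_diff field_simps\<close>)
  also have "(\<Prod>i=1..g. of_nat i + 1/3) = (\<Prod>j=1..g. - 1 * (of_nat j + (- 1/3) * P))"
    by (rule prod.reindex_bij_witness[where i = "\<lambda>i. Suc g - i" and j = "\<lambda>i. Suc g - i"]) (use gP in \<open>auto simp: of_nat_diff field_simps\<close>)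
  also have "\<dots> = (- 1) ^ g * shift_fact (- 1/3) g"
    unfolding prod.distrib shift_fact_def by simp
  also have "of_nat (Suc g) + 1/3 = P / 3" using gP by (simp add: field_simps)
  also have "(- 1) ^ g = (- 1 :: rat)"
  proof -
    have "odd g" using g by presburger
    then show ?thesis by simp
  qed
  moreover have "shift_fact (- 1/3) (2 * h) = shift_fact (- 1/3) g * (- 1/3)"
  proof -
    have "of_nat (Suc g) + (- 1/3) * P = - 1/3" using gP by (simp add: field_simps)
    then show ?thesis unfolding g by (simp add: shift_fact_def)
  qed
  ultimately show ?thesis by simp
qed

text \<open>All factorials reduce to those of \<open>h\<close>, \<open>2h\<close> and \<open>3h\<close> by reflection, since \<open>4h = p-1-2h\<close> and
\<open>3h = p-1-3h\<close>.\<close>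

lemma P_T_eval:
  assumes q: "q \<in> Zp"
  shows "P * T q = C\<^sup>2 * E q"
proof -
  have r: "p - 1 - 2 * h = 4 * h" "p - 1 - 3 * h = 3 * h" "p - 1 = 6 * h" using p_eq by auto
  have s1: "shift_fact (- 1/6 - q) (p - 1) = shift_fact (- 1/6 - q) (4 * h) * shift_fact (q - 5/6) (2 * h)"
    using shift_fact_reflect[of "2 * h" "- 1/6 - q"] h_less unfolding r(1) by (simp add: algebra_simps)
  have s2: "fact (p - 1) = fact (3 * h) * ((- 1) ^ (3 * h) * (fact (3 * h) * shift_quot (- 1) (3 * h)))"
    using shift_fact_reflect[of "3 * h" 0] h_less unfolding r(2) shift_fact_eq by (simp add: shift_quot_0)
  have u: "shift_fact (- 1/6 - q) h \<noteq> 0" "shift_fact (q - 5/6) (2 * h) \<noteq> 0" "shift_fact (q - 1/2) (3 * h) \<noteq> 0" "shift_fact (- 1/3) (2 * h) \<noteq> 0" "shift_fact (1/3) h \<noteq> 0"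
    using q h_less by (auto intro!: unit_nz unit_shift_fact)
  have sg: "(- 1) ^ (3 * h) \<noteq> (0 :: rat)" by simp
  have "P * T q = P * (fact (3 * h) * (shift_fact (- 1/6 - q) (4 * h) / shift_fact (- 1/6 - q) h) /
      ((- 1) ^ (3 * h) * shift_fact (q - 1/2) (3 * h) * (P * shift_fact (- 1/3) (2 * h) * shift_fact (1/3) h)))"
    unfolding T_eq[OF q] T_numerator[OF q] T_denominator T_third by (simp add: hp_eq)
  also have "\<dots> = fact (3 * h) * shift_fact (- 1/6 - q) (4 * h) / (shift_fact (- 1/6 - q) h *
      ((- 1) ^ (3 * h) * shift_fact (q - 1/2) (3 * h) * (shift_fact (- 1/3) (2 * h) * shift_fact (1/3) h)))"
    using u by (simp add: field_simps)
  also have "shift_fact (- 1/6 - q) (4 * h) = shift_fact (- 1/6 - q) (p - 1) / shift_fact (q - 5/6) (2 * h)"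
    using s1 u by simp
  also have "fact (3 * h) * (shift_fact (- 1/6 - q) (p - 1) / shift_fact (q - 5/6) (2 * h)) / (shift_fact (- 1/6 - q) h *
      ((- 1) ^ (3 * h) * shift_fact (q - 1/2) (3 * h) * (shift_fact (- 1/3) (2 * h) * shift_fact (1/3) h))) = C\<^sup>2 * E q"
    using u unfolding shift_fact_eq s2 C_eq E_def by (simp add: power2_eq_square mult_ac)
  finally show ?thesis .
qed

abbreviation "a1 \<equiv> H1 h"
abbreviation "b1 \<equiv> H1 (2 * h)"
abbreviation "c1 \<equiv> H1 (3 * h)"
abbreviation "a2 \<equiv> H2 h"
abbreviation "b2 \<equiv> H2 (2 * h)"
abbreviation "c2 \<equiv> H2 (3 * h)"

lemma abc_Zp [simp]: "a1 \<in> Zp" "b1 \<in> Zp" "c1 \<in> Zp" "a2 \<in> Zp" "b2 \<in> Zp" "c2 \<in> Zp"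
  using h_less by auto

lemma c2_cong: "cong_p 1 c2 0"
  using H2_hp by (simp add: hp_eq)

text \<open>The sum over the odd numbers below \<open>2h\<close>, computed once by parity and once by reflection.\<close>

lemma a2_cong: "cong_p 1 a2 (5 * b2)"
proof -
  obtain z where z: "z \<in> Zp" "c2 = P * z" using c2_cong by (auto elim: congE)
  have "cong_p 1 (b2 - a2 / 4) ((c2 - b2) / 4)"
    using O2_reflect[of h] by (simp add: O2_eq hp_eq)
  then obtain t where t: "t \<in> Zp" "b2 - a2 / 4 = (c2 - b2) / 4 + P * t" by (auto elim: congE)
  have "a2 = 5 * b2 + P * (- z - 4 * t)" using t(2) unfolding z by (simp add: field_simps)
  then show ?thesis using z t by (intro congI[of _ _ _ "- z - 4 * t"]) auto
qed

lemma a1_cong: "cong_p 2 a1 (b1 + c1 - P * b2 / 2)"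
proof -
  obtain z where z: "z \<in> Zp" "c2 = P * z" using c2_cong by (auto elim: congE)
  have "cong_p 2 (b1 - a1 / 2) (- (c1 - b1) / 2 - P * (c2 - b2) / 4)"
    using O1_reflect[of h] by (simp add: O1_eq hp_eq)
  then obtain t where t: "t \<in> Zp" "b1 - a1 / 2 = - (c1 - b1) / 2 - P * (c2 - b2) / 4 + P ^ 2 * t" by (auto elim: congE)
  have "a1 = b1 + c1 - P * b2 / 2 + P ^ 2 * (z / 2 - 2 * t)" using t(2) unfolding z by (simp add: field_simps power2_eq_square)
  then show ?thesis using z t by (intro congI[of _ _ _ "z / 2 - 2 * t"]) auto
qed

text \<open>The three relations eliminate everything but \<open>b1\<close>, \<open>c1\<close> and \<open>b2\<close>. The term \<open>- \<alpha> / 2\<close> in the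
second coefficient comes from the part of \<open>a1\<close> that is divisible by \<open>p\<close>.\<close>

lemma log_exp_normalize:
  assumes x: "log_exp x (\<alpha> * a1 + \<beta> * b1 + \<gamma> * c1) (\<alpha>' * a2 + \<beta>' * b2 + \<gamma>' * c2)"
    and Z: "\<alpha> \<in> Zp" "\<beta> \<in> Zp" "\<gamma> \<in> Zp" "\<alpha>' \<in> Zp" "\<beta>' \<in> Zp" "\<gamma>' \<in> Zp"
  shows "log_exp x ((\<alpha> + \<beta>) * b1 + (\<alpha> + \<gamma>) * c1) ((5 * \<alpha>' + \<beta>' - \<alpha> / 2) * b2)"
proof (rule log_exp_shift[OF x, where d = "- (\<alpha> / 2) * b2"])
  have "cong_p 2 (\<alpha> * a1 + (\<beta> * b1 + \<gamma> * c1)) (\<alpha> * (b1 + c1 - P * b2 / 2) + (\<beta> * b1 + \<gamma> * c1))"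
    using a1_cong Z by (intro cong_add cong_mult_left) auto
  then show "cong_p 2 (\<alpha> * a1 + \<beta> * b1 + \<gamma> * c1) ((\<alpha> + \<beta>) * b1 + (\<alpha> + \<gamma>) * c1 + P * (- (\<alpha> / 2) * b2))"
    by (simp add: algebra_simps)
  have "cong_p 1 (\<alpha>' * a2 + \<beta>' * b2 + \<gamma>' * c2 + - (\<alpha> / 2) * b2) (\<alpha>' * (5 * b2) + \<beta>' * b2 + \<gamma>' * 0 + - (\<alpha> / 2) * b2)"
    using a2_cong c2_cong Z by (intro cong_add cong_mult_left) auto
  then show "cong_p 1 (\<alpha>' * a2 + \<beta>' * b2 + \<gamma>' * c2 + - (\<alpha> / 2) * b2) ((5 * \<alpha>' + \<beta>' - \<alpha> / 2) * b2)"
    by (simp add: algebra_simps)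
qed (use Z in auto)

lemma log_exp_E:
  assumes q: "q \<in> Zp"
  shows "log_exp (E q) (b1 - 2/3 * c1)
    ((5 * ((1/6 + q)\<^sup>2 / 2 + 1/18) + (q - 5/6)\<^sup>2 / 2 + 1/18 - (q - 1/6) / 2) * b2)"
proof -
  have "log_exp (E q) (0 + - 1 * c1 - ((q - 5/6) * b1 + (- 1/6 - q) * a1 + (q - 1/2) * c1 + - 1/3 * b1 + 1/3 * a1))
    (0 + - ((- 1)\<^sup>2) / 2 * c2 - (- ((q - 5/6)\<^sup>2) / 2 * b2 + - ((- 1/6 - q)\<^sup>2) / 2 * a2 + - ((q - 1/2)\<^sup>2) / 2 * c2
       + - ((- 1/3)\<^sup>2) / 2 * b2 + - ((1/3)\<^sup>2) / 2 * a2))"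
    unfolding E_def using q h_less by (intro log_exp_mult log_exp_divide log_exp_shift_quot log_exp_shift_quot_full) auto
  then have "log_exp (E q) ((q - 1/6) * a1 + (7/6 - q) * b1 + (- 1/2 - q) * c1)
    (((1/6 + q)\<^sup>2 / 2 + 1/18) * a2 + ((q - 5/6)\<^sup>2 / 2 + 1/18) * b2 + ((q - 1/2)\<^sup>2 / 2 - 1/2) * c2)"
    by (rule log_exp_eqI) (simp_all add: field_simps power2_eq_square)
  from log_exp_normalize[OF this] show ?thesis
    by (rule log_exp_eqI) (use q in \<open>auto simp: field_simps\<close>)
qed

text \<open>Modulo \<open>p\<close> all products of factors \<open>1 + a p / j\<close> are \<open>1\<close>, and \<open>half_poch (2h)\<close> is a binomial
coefficient.\<close>

lemma singular_weight: assumes q: "q \<in> Zp" shows "cong_p 1 ((half_poch (2 * h))\<^sup>2 * V q (2 * h)) (C\<^sup>2)"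
proof -
  have k: "2 * h \<le> hp" "2 * h < p" using hp_eq h_less by auto
  have "C = of_nat (hp choose (2 * h))"
    using binomial_symmetric[of h "3 * h"] by (simp add: C_def hp_eq)
  then have Ch: "C = half_poch (2 * h) * odd_quot (- 1) (2 * h)"
    using binomial_half_poch[OF k(1)] by simp
  have "log_exp (V q (2 * h) / (odd_quot (- 1) (2 * h) * odd_quot (- 1) (2 * h))) 
     (- 1 * O1 (2 * h) + 2 * q * O1 (2 * h) - (q - 1/2) * H1 (2 * h) - (- 1 * O1 (2 * h) + - 1 * O1 (2 * h)))
     (- ((- 1)\<^sup>2) / 2 * O2 (2 * h) + - ((2 * q)\<^sup>2) / 2 * O2 (2 * h) - - ((q - 1/2)\<^sup>2) / 2 * H2 (2 * h)
       - (- ((- 1)\<^sup>2) / 2 * O2 (2 * h) + - ((- 1)\<^sup>2) / 2 * O2 (2 * h)))"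
    unfolding V_def using k q by (intro log_exp_mult log_exp_divide log_exp_shift_quot log_exp_odd_quot) auto
  from log_exp_cong_1[OF this] have "cong_p 1 (V q (2 * h) / (odd_quot (- 1) (2 * h) * odd_quot (- 1) (2 * h))) 1" .
  then have "cong_p 1 (C\<^sup>2 * (V q (2 * h) / (odd_quot (- 1) (2 * h) * odd_quot (- 1) (2 * h)))) (C\<^sup>2 * 1)"
    using unit_C by (intro cong_mult_left) auto
  moreover have "odd_quot (- 1) (2 * h) \<noteq> 0" using k by (intro unit_nz unit_odd_quot) auto
  ultimately show ?thesis unfolding Ch by (simp add: power2_eq_square field_simps)
qed

text \<open>The second order coefficient of \<open>E q\<close> and the correction \<open>w'\<close> from the singular term have
different values for the two sums, but the same total \<open>1/12\<close>.\<close>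

lemma singular_combine:
  assumes q: "q \<in> Zp" and w: "cong_p 1 w (w' * b2)" "w' \<in> Zp"
    and S: "cong_p 3 S (P * T q + P\<^sup>2 * ((half_poch (2 * h))\<^sup>2 * V q (2 * h) * w))"
    and eq: "5 * ((1/6 + q)\<^sup>2 / 2 + 1/18) + (q - 5/6)\<^sup>2 / 2 + 1/18 - (q - 1/6) / 2 + w' = 1/12"
    and F: "log_exp F (b1 - 2/3 * c1) (1/12 * b2)"
  shows "cong_p 3 S (C\<^sup>2 * F)"
proof -
  have "cong_p 3 (P * T q + P\<^sup>2 * ((half_poch (2 * h))\<^sup>2 * V q (2 * h) * w)) (C\<^sup>2 * E q + P\<^sup>2 * (C\<^sup>2 * (w' * b2)))"
    unfolding P_T_eval[OF q]
    by (intro cong_add cong_refl cong_mult_P2 cong_mult singular_weight w q) (use w unit_C in auto)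
  also have "C\<^sup>2 * E q + P\<^sup>2 * (C\<^sup>2 * (w' * b2)) = C\<^sup>2 * (E q + P\<^sup>2 * (w' * b2))"
    by (simp add: algebra_simps)
  also have "cong_p 3 \<dots> (C\<^sup>2 * F)"
  proof (rule cong_mult_left)
    have "log_exp (E q + P\<^sup>2 * (w' * b2)) (b1 - 2/3 * c1) ((5 * ((1/6 + q)\<^sup>2 / 2 + 1/18) + (q - 5/6)\<^sup>2 / 2 + 1/18 - (q - 1/6) / 2) * b2 + w' * b2)"
      using w q by (intro log_exp_add_P2 log_exp_E) auto
    also have "(5 * ((1/6 + q)\<^sup>2 / 2 + 1/18) + (q - 5/6)\<^sup>2 / 2 + 1/18 - (q - 1/6) / 2) * b2 + w' * b2 = 1/12 * b2"
      unfolding distrib_right[symmetric] eq ..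
    finally show "cong_p 3 (E q + P\<^sup>2 * (w' * b2)) F" using F by (rule log_exp_cong)
    show "C\<^sup>2 \<in> Zp" using unit_C by auto
  qed
  finally show ?thesis using S cong_trans by blast
qed

lemma S4_split:
  assumes "log_exp F (b1 - 2/3 * c1) (1/12 * b2)" shows "cong_p 3 S4 (C\<^sup>2 * F)"
proof (rule singular_combine[OF _ _ _ S4_cong_split _ assms])
  show "3 * (2 * h) + 1 = p" using p_eq by simp
  show "cong_p 1 (- (3/4) * H2 (2 * h)) (- (3/4) * b2)" by simp
qed (auto simp: power2_eq_square)

text \<open>The sum over odd numbers in the correction is expressed by \<open>b2\<close> through reflection, since
\<open>4h = p-1-2h\<close>; the correction is \<open>-13/4 b2\<close>.\<close>

lemma S16_split:
  assumes "log_exp F (b1 - 2/3 * c1) (1/12 * b2)" shows "cong_p 3 S16 (C\<^sup>2 * F)"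
proof (rule singular_combine[OF _ _ _ S16_cong_split _ assms])
  show "3 * (2 * h) + 1 = p" using p_eq by simp
  have r: "p - 1 - 2 * h = 4 * h" using p_eq by simp
  have "cong_p 1 (H2 (4 * h)) (H2 (p - 1) - b2)" using H2_reflect[of "2 * h"] h_less unfolding r by simp
  also have "cong_p 1 \<dots> (0 - b2)" by (intro cong_diff H2_full cong_refl)
  finally have "cong_p 1 (2 * (H2 (4 * h) - b2 / 4) - 3/4 * b2) (2 * ((0 - b2) - b2 / 4) - 3/4 * b2)"
    by (intro cong_diff cong_mult_left cong_refl) auto
  then show "cong_p 1 (2 * O2 (2 * h) - 3/4 * H2 (2 * h)) (- 13/4 * b2)"
    unfolding O2_eq by (simp add: algebra_simps)
qed (auto simp: power2_eq_square)

end

section \<open>Primes congruent to 2 modulo 3\<close>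

context prime_gt_3
begin

lemma cong_p_wilson: "cong_p 1 (fact (p - 1)) (- 1)"
proof -
  have "[fact (p - 1) = - 1 :: int] (mod int p ^ 1)" using wilson_theorem[OF prime_p] by simp
  from cong_of_int[OF this] show ?thesis by simp
qed

lemma cong_p_fermat: "\<not> p dvd a \<Longrightarrow> cong_p 1 (of_nat a ^ (p - 1)) 1"
proof -
  assume "\<not> p dvd a"
  then have "[a ^ (p - 1) = 1] (mod p)" by (rule fermat_theorem[OF prime_p])
  then have "[int (a ^ (p - 1)) = int 1] (mod int p)" by (simp only: cong_int_iff)
  then have "[int (a ^ (p - 1)) = 1] (mod int p ^ 1)" by simp
  from cong_of_int[OF this] show ?thesis by simp
qed

lemma shift_fact_cong: assumes "n < p" "x \<in> Zp" shows "cong_p 1 (shift_fact x n) (fact n)"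
proof -
  have "cong_p 1 (shift_fact x n) (\<Prod>j=1..n. of_nat j)"
    unfolding shift_fact_def
    by (rule cong_prod) (auto intro!: congI[of _ _ _ x] assms simp: mult.commute)
  then show ?thesis by (simp add: fact_prod)
qed

lemma shift_quot_cong: assumes "n < p" "x \<in> Zp" shows "cong_p 1 (shift_quot x n) 1"
  using shift_fact_cong[OF assms] cong_unit_cancel[of 1 "fact n" "shift_quot x n" 1] unit_fact[OF assms(1)] unfolding shift_fact_eq by simp

lemma fact_reflect: assumes "u < p" shows "cong_p 1 (fact (p - 1 - u) * fact u) (- ((- 1) ^ u))"
proof -
  have f: "fact n = shift_fact 0 n" for n by (simp add: shift_fact_eq shift_quot_0)
  have s: "(- 1) ^ u * (- 1) ^ u = (1 :: rat)" by (simp add: power_mult_distrib[symmetric])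
  have "cong_p 1 (fact (p - 1 - u) * fact u) (fact (p - 1 - u) * shift_fact (- 1) u)"
    using assms by (intro cong_mult_left cong_sym[OF shift_fact_cong] unit_Zp(1)[OF unit_fact]) auto
  also have "fact (p - 1 - u) * shift_fact (- 1) u = (- 1) ^ u * (fact (p - 1 - u) * ((- 1) ^ u * shift_fact (- 1) u))"
    using s by simp
  also have "fact (p - 1 - u) * ((- 1) ^ u * shift_fact (- 1) u) = fact (p - 1)"
    using shift_fact_reflect[OF assms, of 0] by (simp add: f)
  also have "cong_p 1 ((- 1) ^ u * fact (p - 1)) ((- 1) ^ u * - 1)"
    by (intro cong_mult_left cong_p_wilson) auto
  finally show ?thesis by simp
qed

text \<open>Beyond \<open>p\<close> only the factor with \<open>j = p\<close>, which is \<open>2\<close>, is visible modulo \<open>p\<close>.\<close>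

lemma shift_quot_past_p: assumes "u < p" shows "cong_p 1 (shift_quot 1 (p + u)) 2"
  using assms
proof (induction u)
  case 0
  have "{1..p} = insert p {1..p-1}" using p_gt_3 by auto
  then have "shift_quot 1 p = 2 * shift_quot 1 (p - 1)" unfolding shift_quot_def using p_gt_3 by simp
  moreover have "cong_p 1 (2 * shift_quot 1 (p - 1)) (2 * 1)" using p_gt_3 by (intro cong_mult_left shift_quot_cong) auto
  ultimately show ?case by simp
next
  case (Suc u)
  have u: "unit_p (of_nat (p + Suc u))" using Suc.prems by (intro unit_of_nat) (metis dvd_add_right_iff dvd_refl nat_dvd_not_less zero_less_Suc)
  have "shift_quot 1 (p + Suc u) = shift_quot 1 (p + u) * (1 + P / of_nat (p + Suc u))" by (simp add: shift_quot_def)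
  moreover have "cong_p 1 (shift_quot 1 (p + u) * (1 + P / of_nat (p + Suc u))) (2 * 1)"
    using Suc u by (intro cong_mult congI[of "1 + P / of_nat (p + Suc u)" 1 1 "1 / of_nat (p + Suc u)"]) auto
  ultimately show ?case by simp
qed

end

text \<open>A prime \<open>p \<equiv> 2 (mod 3)\<close> is inert in the field generated by \<open>\<surd>(-3)\<close>.\<close>

locale inert_prime = prime_gt_3 +
  fixes h :: nat
  assumes p_eq: "p = 6 * h + 5"
begin

lemma hp_eq: "hp = 3 * h + 2" and P_eq: "P = 6 * of_nat h + 5"
  using p_hp p_eq by auto

lemma h_less: "h < p" "h + 1 < p" "2 * h + 1 < p" "2 * h + 2 < p" "3 * h + 2 < p" "4 * h + 2 < p" "4 * h + 3 < p" "h + 1 \<le> hp"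
  using p_eq hp_eq by auto

abbreviation f where "f \<equiv> (fact h :: rat)"
text \<open>These factorials are constants, and not abbreviations, to keep the simplifier from unfolding them.\<close>

definition g :: rat where "g = fact (2 * h + 1)"
definition G :: rat where "G = fact (3 * h + 2)"
definition A :: rat where "A = fact (4 * h + 2)"
definition B :: rat where "B = fact (2 * h + 2)"
abbreviation s where "s \<equiv> ((- 1) ^ h :: rat)"

text \<open>The unit in terms of which everything is expressed: the two sums and the right side of the
congruence are \<open>p\<^sup>2 M\<close> times constants.\<close>

definition M :: rat where "M = - s * f\<^sup>2 * g\<^sup>2 / 3"

lemma s_sq: "s * s = 1" by (simp add: power_mult_distrib[symmetric])

lemma units: "unit_p f" "unit_p g" "unit_p G" "unit_p A" "unit_p B"
  "unit_p s"
  unfolding g_def G_def A_def B_def using h_less by (auto intro!: unit_fact simp del: fact_Suc)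

text \<open>Wilson's theorem: \<open>3h+2\<close> is \<open>(p-1)/2\<close>.\<close>

lemma G_sq: "cong_p 1 (G * G) (- s)"
proof -
  have "p - 1 - (3 * h + 2) = 3 * h + 2" using p_eq by simp
  moreover have "(- 1) ^ (3 * h + 2) = s" by (simp add: power_add power_mult)
  ultimately show ?thesis using fact_reflect[of "3 * h + 2"] h_less unfolding G_def by (simp del: fact_Suc)
qed

lemma B_eq: "B = (P + 1) / 3 * g"
  by (simp add: P_eq field_simps B_def g_def)

lemma B_cong: "cong_p 1 B (g / 3)"
  unfolding B_eq using units by (intro congI[of _ _ _ "g / 3"]) (auto simp: field_simps)

lemma inverse_A_cong: "cong_p 1 (1 / A) (- g / 3)"
proof -
  have "p - 1 - (2 * h + 2) = 4 * h + 2" using p_eq by simp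
  then have "cong_p 1 (A * B) (- 1)" using fact_reflect[of "2 * h + 2"] h_less unfolding A_def B_def by (simp del: fact_Suc)
  then have "cong_p 1 (A * B) (A * (- 1 / A))" using unit_nz[OF units(4)] by simp
  then have "cong_p 1 B (- 1 / A)" by (rule cong_unit_cancel) (rule units)
  then have "cong_p 1 (- (- 1 / A)) (- B)" by (rule cong_minus[OF cong_sym])
  then have "cong_p 1 (1 / A) (- B)" by simp
  also have "cong_p 1 \<dots> (- (g / 3))" by (intro cong_minus B_cong)
  finally show ?thesis by simp
qed

text \<open>Here \<open>1/6 = h + 1 - p/6\<close>, so the factor with \<open>i = h+1\<close> is divisible by \<open>p\<close>. This is the second
factor \<open>p\<close> of \<open>P * T q\<close>.\<close>

lemma T_numerator:
  "(\<Prod>i=1..hp. of_nat i - 1/6 - q * P) = (1/6 - q) * P * (s * shift_fact (q - 1/6) h * shift_fact (1/6 - q) (2 * h + 1))"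
proof -
  have "{1..hp} = {1..h} \<union> {h + 1} \<union> {h + 2..hp}" by (auto simp: hp_eq)
  then have "(\<Prod>i=1..hp. of_nat i - 1/6 - q * P) = (\<Prod>i=1..h. of_nat i - 1/6 - q * P) * (of_nat (h + 1) - 1/6 - q * P) * (\<Prod>i=h + 2..hp. of_nat i - 1/6 - q * P)"
    by (simp add: prod.union_disjoint)
  also have "(\<Prod>i=h + 2..hp. of_nat i - 1/6 - q * P) = shift_fact (1/6 - q) (2 * h + 1)"
    unfolding shift_fact_def
    by (rule prod.reindex_bij_witness[where i = "\<lambda>i. i + (h + 1)" and j = "\<lambda>i. i - (h + 1)"])
       (auto simp: of_nat_diff P_eq hp_eq field_simps)
  also have "(\<Prod>i=1..h. of_nat i - 1/6 - q * P) = (\<Prod>j=1..h. - 1 * (of_nat j + (q - 1/6) * P))"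
    by (rule prod.reindex_bij_witness[where i = "\<lambda>i. h + 1 - i" and j = "\<lambda>i. h + 1 - i"])
       (auto simp: of_nat_diff P_eq field_simps)
  also have "\<dots> = s * shift_fact (q - 1/6) h" unfolding prod.distrib shift_fact_def by simp
  also have "of_nat (h + 1) - 1/6 - q * P = (1/6 - q) * P" by (simp add: P_eq field_simps)
  finally show ?thesis by simp
qed

text \<open>Here \<open>1/3 = 2p/3 - (4h+3)\<close>, and the integers from \<open>h+1\<close> to \<open>4h+2\<close> are prime to \<open>p\<close>.\<close>

lemma T_third:
  "(\<Prod>i=1..hp. of_nat i + 1/3) = s * shift_fact (- 2/3) (4 * h + 2) / shift_fact (- 2/3) h"
proof -
  have "(\<Prod>i=1..hp. of_nat i + 1/3) = (\<Prod>j=1..hp. - 1 * (of_nat j + of_nat h + (- 2/3) * P))"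
    by (rule prod.reindex_bij_witness[where i = "\<lambda>i. hp + 1 - i" and j = "\<lambda>i. hp + 1 - i"])
       (auto simp: of_nat_diff P_eq hp_eq field_simps)
  also have "\<dots> = (- 1) ^ hp * (shift_fact (- 2/3) (h + hp) / shift_fact (- 2/3) h)"
    unfolding prod.distrib using h_less by (subst shift_fact_interval) (auto intro!: unit_nz unit_shift_fact)
  also have "(- 1) ^ hp = s" by (simp add: hp_eq power_add power_mult)
  also have "h + hp = 4 * h + 2" by (simp add: hp_eq)
  finally show ?thesis by simp
qed

lemma P_T_cong:
  assumes q: "q \<in> Zp"
  shows "cong_p 3 (P * T q) (P\<^sup>2 * ((1/6 - q) * M))"
proof -
  have u: "unit_p (shift_fact (q - 1/2) (3 * h + 2))" "unit_p (shift_fact (- 2/3) (4 * h + 2))" "unit_p (shift_fact (- 2/3) h)"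
    using q h_less by (auto intro!: unit_shift_fact)
  have sg: "(- 1) ^ hp = s" by (simp add: hp_eq power_add power_mult)
  have "P * T q = P\<^sup>2 * ((1/6 - q) * (s * (G * shift_fact (q - 1/6) h * shift_fact (1/6 - q) (2 * h + 1) * shift_fact (- 2/3) h / shift_fact (q - 1/2) (3 * h + 2) * (1 / shift_fact (- 2/3) (4 * h + 2)))))"
  proof -
    have "s \<noteq> 0" by simp
    then show ?thesis
      unfolding T_eq[OF q] T_numerator T_denominator T_third sg G_def using u[THEN unit_nz]
      by (simp add: hp_eq power2_eq_square field_simps del: fact_Suc)
  qed
  also have "cong_p 3 \<dots> (P\<^sup>2 * ((1/6 - q) * (s * (G * f * g * f / G * (- g / 3)))))"
  proof (intro cong_mult_P2 cong_mult_left cong_mult[OF cong_divide2])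
    have "cong_p 1 (1 / shift_fact (- 2/3) (4 * h + 2)) (1 / A)"
      using h_less units unfolding A_def by (intro cong_divide2 shift_fact_cong cong_refl) auto
    also note inverse_A_cong
    finally show "cong_p 1 (1 / shift_fact (- 2/3) (4 * h + 2)) (- g / 3)" .
    show "cong_p 1 (G * shift_fact (q - 1/6) h * shift_fact (1/6 - q) (2 * h + 1) * shift_fact (- 2/3) h) (G * f * g * f)"
      using q h_less units unfolding g_def G_def by (intro cong_mult shift_fact_cong cong_refl) (auto simp del: fact_Suc)
    show "cong_p 1 (shift_fact (q - 1/2) (3 * h + 2)) G" using q h_less unfolding G_def by (intro shift_fact_cong) auto
  qed (use q units in auto)
  also have "G * f * g * f / G * (- g / 3) = - (f\<^sup>2 * g\<^sup>2 / 3)"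
    using unit_nz[OF units(3)] by (simp add: power2_eq_square)
  finally show ?thesis by (simp add: M_def mult_ac)
qed

lemma inverse_binomial_sq: "cong_p 1 (inverse ((of_nat (hp choose h))\<^sup>2)) (M / 3)"
proof -
  have "of_nat (hp choose h) = G / (f * B)"
    unfolding G_def B_def using binomial_fact[of h hp] by (simp add: hp_eq del: fact_Suc)
  then have "inverse ((of_nat (hp choose h))\<^sup>2) = f\<^sup>2 * (B)\<^sup>2 / (G * G)"
    by (simp add: power2_eq_square divide_inverse mult_ac)
  also have "cong_p 1 \<dots> (f\<^sup>2 * (g / 3)\<^sup>2 / (- s))"
    using units by (intro cong_divide2 cong_mult_left cong_power B_cong G_sq) auto
  also have "f\<^sup>2 * (g / 3)\<^sup>2 / (- s) = M / 3"
  proof -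
    have "x / - s = - s * x" for x using s_sq by (simp add: field_simps)
    then show ?thesis by (simp add: M_def power2_eq_square)
  qed
  finally show ?thesis .
qed

text \<open>The binomial coefficient \<open>C(3h+2,h+1)\<close> is, up to sign, \<open>C(2h+2,h+1) / 4^(h+1)\<close> modulo \<open>p\<close>. This
says \<open>2 g\<^sup>2 \<equiv> \<plusminus> 4^(h+1) f G\<close>; squaring removes the sign, and Fermat's theorem adapts the power of
\<open>16\<close>.\<close>

lemma g_fourth_power: "cong_p 1 (g ^ 4 / 16 ^ (4 * h + 3)) (- s * f\<^sup>2 / 4)"
proof -
  have k: "h + 1 \<le> hp" "h + 1 < p" using h_less by auto
  have o: "cong_p 1 (odd_quot (- 1) (h + 1)) 1"
  proof -
    have "cong_p 1 (odd_quot (- 1) (h + 1)) (\<Prod>j=1..h+1. 1)"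
      unfolding odd_quot_def
    proof (rule cong_prod)
      fix j assume "j \<in> {1..h+1}"
      then have "unit_p (2 * of_nat j - 1)" using k by (intro unit_odd) auto
      then show "cong_p 1 (1 + - 1 * P / (2 * of_nat j - 1)) 1"
        by (intro congI[of _ _ _ "- 1 / (2 * of_nat j - 1)"]) auto
    qed simp
    then show ?thesis by simp
  qed
  have "cong_p 1 ((- 1) ^ (h + 1) * of_nat (hp choose (h + 1))) (half_poch (h + 1) * 1)"
    unfolding binomial_half_poch[OF k(1)] using unit_half_poch[OF k(1)] o by (intro cong_mult_left) auto
  moreover have "of_nat (hp choose (h + 1)) = G / (of_nat (h + 1) * f * g)"
    unfolding G_def g_def using binomial_fact[of "h + 1" hp] by (simp add: hp_eq)
  moreover have "half_poch (h + 1) = 2 * g / (4 ^ (h + 1) * (of_nat (h + 1) * f\<^sup>2))"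
  proof -
    have "fact (2 * (h + 1)) = 2 * of_nat (h + 1) * g" by (simp add: algebra_simps g_def)
    moreover have "of_nat (h + 1) \<noteq> (0 :: rat)" by simp
    ultimately show ?thesis unfolding half_poch_def by (simp add: power2_eq_square power_mult_distrib del: of_nat_Suc)
  qed
  ultimately have c: "cong_p 1 ((- 1) ^ (h + 1) * (G / (of_nat (h + 1) * f * g))) (2 * g / (4 ^ (h + 1) * (of_nat (h + 1) * f\<^sup>2)))" by simp
  define Q where "Q = 4 ^ (h + 1) * (of_nat (h + 1) * f\<^sup>2) * g"
  have uh: "unit_p (of_nat (h + 1))" using k by (intro unit_of_nat_less) auto
  have "Q \<in> Zp" unfolding Q_def using units by auto
  from cong_mult_left[OF c this]
  have "cong_p 1 ((- 1) ^ (h + 1) * 4 ^ (h + 1) * f * G) (2 * g\<^sup>2)"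
  proof -
    have nz: "of_nat (h + 1) \<noteq> (0 :: rat)" by simp
    have "Q * ((- 1) ^ (h + 1) * (G / (of_nat (h + 1) * f * g))) = (- 1) ^ (h + 1) * 4 ^ (h + 1) * f * G"
      unfolding Q_def using nz unit_nz[OF units(2)] by (simp add: power2_eq_square del: of_nat_add of_nat_Suc power_Suc)
    moreover have "Q * (2 * g / (4 ^ (h + 1) * (of_nat (h + 1) * f\<^sup>2))) = 2 * g\<^sup>2"
      unfolding Q_def using nz unit_nz[OF units(2)] by (simp add: power2_eq_square del: of_nat_add of_nat_Suc power_Suc)
    ultimately show ?thesis using cong_mult_left[OF c \<open>Q \<in> Zp\<close>] by simp
  qed
  then have "cong_p 1 (((- 1) ^ (h + 1) * 4 ^ (h + 1) * f * G)\<^sup>2) ((2 * g\<^sup>2)\<^sup>2)"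
    using units by (intro cong_power) auto
  moreover have "((- 1) ^ (h + 1) * 4 ^ (h + 1) * f * G)\<^sup>2 = 16 ^ (h + 1) * f\<^sup>2 * (G * G)"
  proof -
    have "((- 1) ^ (h + 1))\<^sup>2 = (1 :: rat)" by (simp add: power_mult[symmetric])
    moreover have "(4 ^ (h + 1))\<^sup>2 = (16 :: rat) ^ (h + 1)" by (simp add: power2_eq_square power_mult_distrib[symmetric])
    ultimately show ?thesis unfolding power_mult_distrib by (simp add: power2_eq_square)
  qed
  moreover have "(2 * g\<^sup>2)\<^sup>2 = 4 * g ^ 4" by (simp add: power_mult_distrib)
  ultimately have c4: "cong_p 1 (16 ^ (h + 1) * f\<^sup>2 * (G * G)) (4 * g ^ 4)" by simp
  have "cong_p 1 (4 * g ^ 4) (16 ^ (h + 1) * f\<^sup>2 * (- s))"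
    by (rule cong_trans[OF cong_sym[OF c4] cong_mult_left[OF G_sq]]) (use units in auto)
  then have 1: "cong_p 1 (4 * g ^ 4 / (4 * 16 ^ (h + 1))) (16 ^ (h + 1) * f\<^sup>2 * (- s) / (4 * 16 ^ (h + 1)))"
    by (rule cong_divide) (intro unit_mult unit_power unit_smooth)
  have 16: "cong_p 1 (16 ^ (3 * h + 2)) 1"
  proof -
    have "p - 1 = 2 * (3 * h + 2)" using p_eq by simp
    moreover have "\<not> p dvd 2 ^ 2"
    proof
      assume "p dvd 2 ^ 2"
      then have "p dvd 2" using prime_p prime_dvd_power by blast
      then show False using p_gt_3 by (auto dest: dvd_imp_le)
    qed
    ultimately show ?thesis using cong_p_fermat[of "2 ^ 2"] by (simp add: power_mult)
  qed
  have "g ^ 4 / 16 ^ (4 * h + 3) = 4 * g ^ 4 / (4 * 16 ^ (h + 1)) / 16 ^ (3 * h + 2)"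
  proof -
    have "(16 :: rat) ^ (4 * h + 3) = 16 ^ (h + 1) * 16 ^ (3 * h + 2)"
      unfolding power_add[symmetric] by (rule arg_cong[where f = "power 16"]) simp
    then show ?thesis by (simp only: mult_divide_mult_cancel_left_if divide_divide_eq_left) simp
  qed
  also have "cong_p 1 \<dots> (16 ^ (h + 1) * f\<^sup>2 * (- s) / (4 * 16 ^ (h + 1)) / 1)"
  proof (rule cong_divide2[OF 1 16])
    show "16 ^ (h + 1) * f\<^sup>2 * - s / (4 * 16 ^ (h + 1)) \<in> Zp"
      using units by (intro Zp_divide Zp_mult Zp_power unit_mult unit_power unit_smooth) auto
  qed auto
  also have "16 ^ (h + 1) * f\<^sup>2 * (- s) / (4 * 16 ^ (h + 1)) / 1 = - s * f\<^sup>2 / 4" by simp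
  finally show ?thesis .
qed

text \<open>The term with \<open>3k+1 = 2p\<close>. Both factors \<open>half_poch k\<close> contain \<open>p\<close>, so modulo \<open>p\<^sup>3\<close> everything
else may be taken modulo \<open>p\<close>.\<close>

lemma extra_term:
  "cong_p 3 (1/2 * (half_poch (4 * h + 3))\<^sup>2 * (shift_quot 1 (2 * (4 * h + 3)) * shift_quot (- 1) (4 * h + 3))) (P\<^sup>2 * (3/4 * M))"
proof -
  define K where "K = 4 * h + 3"
  have K2: "2 * K = p + (2 * h + 1)" using p_eq by (simp add: K_def)
  define z where "z = fact (p - 1) * (g * shift_quot 1 (2 * h + 1)) / (4 ^ K * (fact K * fact K))"
  have hz: "half_poch K = P * z"
    unfolding half_poch_def K2 fact_add_p z_def g_def by (simp add: power2_eq_square del: fact_Suc)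
  have uK: "unit_p (fact K)" unfolding K_def using h_less by (intro unit_fact) auto
  have "p - 1 - (2 * h + 1) = K" using p_eq by (simp add: K_def)
  then have Kg: "cong_p 1 (fact K * g) 1" using fact_reflect[of "2 * h + 1"] h_less unfolding g_def by (simp del: fact_Suc)
  have "cong_p 1 z (- 1 * (g * 1) / (4 ^ K * (fact K * fact K)))"
    unfolding z_def using h_less units uK by (intro cong_divide cong_mult cong_p_wilson shift_quot_cong cong_refl) auto
  also have "- 1 * (g * 1) / (4 ^ K * (fact K * fact K)) = - (g ^ 3) / (4 ^ K * ((fact K * g) * (fact K * g)))"
    using unit_nz[OF units(2)] by (simp add: eval_nat_numeral)
  also have "cong_p 1 \<dots> (- (g ^ 3) / (4 ^ K * (1 * 1)))"
    using units Kg by (intro cong_divide2 cong_mult cong_refl) auto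
  finally have z: "cong_p 1 z (- (g ^ 3) / 4 ^ K)" by simp
  have "1/2 * (half_poch K)\<^sup>2 * (shift_quot 1 (2 * K) * shift_quot (- 1) K) = P\<^sup>2 * (1/2 * z\<^sup>2 * (shift_quot 1 (p + (2 * h + 1)) * shift_quot (- 1) K))"
    unfolding hz K2 by (simp add: power_mult_distrib)
  also have "cong_p 3 \<dots> (P\<^sup>2 * (1/2 * (- (g ^ 3) / 4 ^ K)\<^sup>2 * (2 * 1)))"
    using h_less units z unfolding K_def
    by (intro cong_mult_P2 cong_mult cong_power shift_quot_past_p shift_quot_cong cong_refl) auto
  also have "1/2 * (- (g ^ 3) / 4 ^ K)\<^sup>2 * (2 * 1) = g ^ 4 / 16 ^ K * g\<^sup>2"
  proof -
    have "(4 ^ K)\<^sup>2 = (16 :: rat) ^ K" by (simp add: power2_eq_square power_mult_distrib[symmetric])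
    moreover have "(g ^ 3)\<^sup>2 = g ^ 4 * g\<^sup>2" by (simp add: power_mult[symmetric] power_add[symmetric])
    ultimately show ?thesis by (simp add: power_divide)
  qed
  also have "cong_p 3 (P\<^sup>2 * (g ^ 4 / 16 ^ K * g\<^sup>2)) (P\<^sup>2 * (- s * f\<^sup>2 / 4 * g\<^sup>2))"
    using units unfolding K_def by (intro cong_mult_P2 cong_mult_right g_fourth_power) auto
  also have "- s * f\<^sup>2 / 4 * g\<^sup>2 = 3/4 * M" by (simp add: M_def)
  finally show ?thesis unfolding K_def .
qed

lemma M_Zp [simp]: "M \<in> Zp"
  unfolding M_def using units by auto

lemma inert_target: "cong_p 3 (P\<^sup>2 / 2 * inverse ((of_nat (hp choose h))\<^sup>2)) (P\<^sup>2 * (1/6 * M))"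
proof -
  have "cong_p 3 (P\<^sup>2 * (1/2 * inverse ((of_nat (hp choose h))\<^sup>2))) (P\<^sup>2 * (1/2 * (M / 3)))"
    by (intro cong_mult_P2 cong_mult_left inverse_binomial_sq) auto
  then show ?thesis by simp
qed

lemma inert_S4: "cong_p 3 S4 (P\<^sup>2 * (1/6 * M))"
proof -
  have "p mod 3 = 2" using p_eq by presburger
  then have "cong_p 3 S4 (P * T 0)" by (rule S4_cong_nonsplit)
  also have "cong_p 3 \<dots> (P\<^sup>2 * ((1/6 - 0) * M))" by (rule P_T_cong) simp
  finally show ?thesis by simp
qed

text \<open>The two contributions are \<open>-5/6\<close> and \<open>3/4\<close> times \<open>p\<^sup>2 M\<close>.\<close>

lemma inert_S16: "cong_p 3 (- 2 * S16) (P\<^sup>2 * (1/6 * M))"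
proof -
  have "3 * (4 * h + 3) + 1 = 2 * p" using p_eq by simp
  then have "cong_p 3 S16 (P * T 1 + 1/2 * (half_poch (4 * h + 3))\<^sup>2 * (shift_quot 1 (2 * (4 * h + 3)) * shift_quot (- 1) (4 * h + 3)))"
    by (rule S16_cong_nonsplit)
  also have "cong_p 3 \<dots> (P\<^sup>2 * ((1/6 - 1) * M) + P\<^sup>2 * (3/4 * M))"
    by (intro cong_add P_T_cong extra_term) simp
  finally have "cong_p 3 (- 2 * S16) (- 2 * (P\<^sup>2 * ((1/6 - 1) * M) + P\<^sup>2 * (3/4 * M)))"
    by (intro cong_mult_left) auto
  then show ?thesis by (simp add: algebra_simps)
qed

end

section \<open>Six binomial coefficients\<close>

text \<open>The cofactor of \<open>x\<^sup>3\<close> in the following identity, found by expanding it.\<close>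

definition jacobi_remainder :: "rat \<Rightarrow> rat \<Rightarrow> rat \<Rightarrow> rat \<Rightarrow> rat" where
  "jacobi_remainder x b c t = -6048 - 3339*t - 1368*c - 444*c^2 + 3240*b + 1080*b*c - 1215*b^2 + 9504*x + 15201*x*t + 4608*x*c +
      2472*x*c^2 - 9504*x*b - 6624*x*b*c + 6885*x*b^2 - 26829*x^2*t - 4392*x^2*c - 4932*x^2*c^2 +
      7992*x^2*b + 14184*x^2*b*c - 14121*x^2*b^2 + 15111*x^3*t + 3096*x^3*c^2 - 9216*x^3*b*c +
      8883*x^3*b^2"

text \<open>The expansion of \<open>jacobi_binom\<close> to second order, multiplied by the common
denominator. The five values of \<open>e\<close> on the left are the truncated exponentials in the lemmas
\<open>log_exp_e1\<close> to \<open>log_exp_e5\<close>, with \<open>x\<close> for \<open>p\<close>. That they combine to one exponential shows that the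
constants \<open>15\<close>, \<open>-10\<close>, \<open>3\<close> are the right ones.\<close>

lemma jacobi_expansion_identity:
  fixes x b c t :: rat
  defines "e \<equiv> \<lambda>l m. 1 + x * l + x\<^sup>2 * (l\<^sup>2 / 2 + m)"
  shows "(x - 1) * (15 * ((9*x-3) * (15*x-9) * (15*x-3))
       - 10 * ((15*x-9) * (15*x-3)) * ((7*x-1) * e (- b) (3*t) + (8*x-2) * e (c - b) (t/2))
       + 3 * (9*x-3) * ((13*x-7) * (13*x-1) * e (- 2*b) (11*t) + (14*x-8) * (14*x-2) * e (2*c - 2*b) (2*t)
          + 2 * ((8*x-2) * (7*x-1)) * e (c - 2*b) (7/2*t)))
     = - 8 * ((9*x-3) * (15*x-9) * (15*x-3)) * e (b/2 - c/3) (t/24) + x^3 * jacobi_remainder x b c t"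
  unfolding e_def jacobi_remainder_def by (simp add: field_simps eval_nat_numeral)

context split_prime
begin

definition jacobi_binom :: rat where
  "jacobi_binom = 15 * of_nat (3*h choose (2*h)) - 10 * (of_nat (9*h choose (2*h)) + of_nat (9*h choose (8*h)))
     + 3 * (of_nat (15*h choose (2*h)) + of_nat (15*h choose (8*h)) + of_nat (15*h choose (14*h)))"

text \<open>The quotients of the binomial coefficients in \<open>jacobi_binom\<close> by \<open>C\<close> are rational functions of \<open>p\<close>
times these products.\<close>

definition e1 where "e1 = shift_quot 1 (3*h) / shift_quot 1 h"
definition e2 where "e2 = shift_quot 1 (3*h) / shift_quot 1 (2*h)"
definition e3 where "e3 = shift_quot 2 (3*h) / shift_quot 2 h"
definition e4 where "e4 = shift_quot 2 (3*h) / shift_quot 2 (2*h)"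
definition e5 where "e5 = shift_quot 1 (p - 1) * (shift_quot 2 (3*h) / (shift_quot 1 (2*h) * shift_quot 1 h))"

lemma log_exp_quot_h:
  assumes "\<alpha> \<in> Zp" shows "log_exp (shift_quot \<alpha> (3*h) / shift_quot \<alpha> h) (- \<alpha> * b1) ((5 * \<alpha>\<^sup>2 + \<alpha>) / 2 * b2)"
proof -
  have "log_exp (shift_quot \<alpha> (3*h) / shift_quot \<alpha> h) (\<alpha> * c1 - \<alpha> * a1) (- (\<alpha>\<^sup>2) / 2 * c2 - - (\<alpha>\<^sup>2) / 2 * a2)"
    using h_less assms by (intro log_exp_divide log_exp_shift_quot)
  then have "log_exp (shift_quot \<alpha> (3*h) / shift_quot \<alpha> h) (- \<alpha> * a1 + 0 * b1 + \<alpha> * c1) (\<alpha>\<^sup>2 / 2 * a2 + 0 * b2 + - (\<alpha>\<^sup>2 / 2) * c2)"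
    by (rule log_exp_eqI) (simp_all add: field_simps)
  from log_exp_normalize[OF this] show ?thesis by (rule log_exp_eqI) (use assms in \<open>auto simp: field_simps\<close>)
qed

lemma log_exp_quot_2h:
  assumes "\<alpha> \<in> Zp" shows "log_exp (shift_quot \<alpha> (3*h) / shift_quot \<alpha> (2*h)) (\<alpha> * (c1 - b1)) (\<alpha>\<^sup>2 / 2 * b2)"
proof -
  have "log_exp (shift_quot \<alpha> (3*h) / shift_quot \<alpha> (2*h)) (\<alpha> * c1 - \<alpha> * b1) (- (\<alpha>\<^sup>2) / 2 * c2 - - (\<alpha>\<^sup>2) / 2 * b2)"
    using h_less assms by (intro log_exp_divide log_exp_shift_quot)
  then have "log_exp (shift_quot \<alpha> (3*h) / shift_quot \<alpha> (2*h)) (0 * a1 + - \<alpha> * b1 + \<alpha> * c1) (0 * a2 + \<alpha>\<^sup>2 / 2 * b2 + - (\<alpha>\<^sup>2 / 2) * c2)"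
    by (rule log_exp_eqI) (simp_all add: field_simps)
  from log_exp_normalize[OF this] show ?thesis by (rule log_exp_eqI) (use assms in \<open>auto simp: field_simps\<close>)
qed

lemma log_exp_e1: "log_exp e1 (- b1) (3 * b2)" and log_exp_e2: "log_exp e2 (c1 - b1) (b2 / 2)"
  and log_exp_e3: "log_exp e3 (- 2 * b1) (11 * b2)" and log_exp_e4: "log_exp e4 (2 * c1 - 2 * b1) (2 * b2)"
  using log_exp_quot_h[of 1] log_exp_quot_2h[of 1] log_exp_quot_h[of 2] log_exp_quot_2h[of 2]
  by (simp_all add: e1_def e2_def e3_def e4_def right_diff_distrib)

lemma log_exp_e5: "log_exp e5 (c1 - 2 * b1) (7/2 * b2)"
proof -
  have "log_exp e5 (0 + (2 * c1 - (1 * b1 + 1 * a1))) (0 + (- (2\<^sup>2) / 2 * c2 - (- (1\<^sup>2) / 2 * b2 + - (1\<^sup>2) / 2 * a2)))"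
    unfolding e5_def using h_less by (intro log_exp_mult log_exp_divide log_exp_shift_quot log_exp_shift_quot_full) auto
  then have "log_exp e5 (- 1 * a1 + - 1 * b1 + 2 * c1) (1/2 * a2 + 1/2 * b2 + - 2 * c2)"
    by (rule log_exp_eqI) (simp_all add: field_simps)
  from log_exp_normalize[OF this] show ?thesis by (rule log_exp_eqI) auto
qed

text \<open>The arguments \<open>7h\<close>, \<open>8h\<close>, \<open>9h\<close> are \<open>p-1\<close> plus \<open>h\<close>, \<open>2h\<close>, \<open>3h\<close>. Keeping the factor \<open>n + 1\<close>
on the left avoids \<open>h - 1\<close>; likewise below, where \<open>h - 2\<close> could be negative.\<close>

lemma fact_p_shift: "n + 1 = p + k \<Longrightarrow> (of_nat n + 1) * fact n = fact p * shift_fact 1 k"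
proof -
  assume "n + 1 = p + k"
  then have "fact (Suc n) = (fact (p + k) :: rat)" by simp
  also have "\<dots> = fact p * shift_fact 1 k"
  proof -
    have "fact p = P * (fact (p - 1) :: rat)" using fact_reduce[of p] by simp
    then show ?thesis unfolding fact_add_p shift_fact_eq by simp
  qed
  finally show ?thesis by (simp add: algebra_simps)
qed

lemma fact_2p_shift: "n + 2 = 2 * p + k \<Longrightarrow> (of_nat n + 1) * (of_nat n + 2) * fact n = fact (2 * p) * shift_fact 2 k"
proof -
  assume n: "n + 2 = 2 * p + k"
  have *: "fact (2 * p + k) = fact (2 * p) * shift_fact 2 k" for k
  proof (induction k)
    case (Suc k)
    then show ?case by (simp add: shift_fact_def algebra_simps)
  qed (simp add: shift_fact_def)
  have "n + 2 = Suc (Suc n)" by simp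
  then have "fact (Suc (Suc n)) = (fact (2 * p + k) :: rat)" using n by simp
  then show ?thesis unfolding * by (simp add: algebra_simps)
qed

lemma fact_2p: "fact (2 * p) = 2 * shift_quot 1 (p - 1) * (fact p)\<^sup>2"
proof -
  have "{1..p} = insert p {1..p - 1}" using p_gt_3 by auto
  then have "shift_fact 1 p = 2 * P * shift_fact 1 (p - 1)" unfolding shift_fact_def using p_gt_3 by simp
  moreover have "fact (2 * p) = P * fact (p - 1) * shift_fact 1 p"
    using fact_add_p[of p] unfolding shift_fact_eq[symmetric] by (simp add: mult_2)
  moreover have "fact p = P * (fact (p - 1) :: rat)" using fact_reduce[of p] by simp
  ultimately show ?thesis by (simp add: shift_fact_eq power2_eq_square)
qed

lemma jacobi_binom_eq:
  "((9*P-3) * (15*P-9) * (15*P-3)) * jacobi_binom = C * (15 * ((9*P-3) * (15*P-9) * (15*P-3))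
       - 10 * ((15*P-9) * (15*P-3)) * ((7*P-1) * e1 + (8*P-2) * e2)
       + 3 * (9*P-3) * ((13*P-7) * (13*P-1) * e3 + (14*P-8) * (14*P-2) * e4
          + 2 * ((8*P-2) * (7*P-1)) * e5))"
proof -
  have hP: "of_nat h = (P - 1) / 6" by (simp add: P_eq)
  define Fp :: rat where "Fp = fact p"
  define F2 :: rat where "F2 = fact (2 * p)"
  have Fnz: "Fp \<noteq> 0" "F2 \<noteq> 0" by (simp_all add: Fp_def F2_def)
  have f9: "(9*P-3)/6 * fact (9*h) = Fp * shift_fact 1 (3*h)" and f7: "(7*P-1)/6 * fact (7*h) = Fp * shift_fact 1 h"
    and f8: "(8*P-2)/6 * fact (8*h) = Fp * shift_fact 1 (2*h)"
  proof -
    have e: "of_nat (9*h) + 1 = (9*P-3)/6" "of_nat (7*h) + 1 = (7*P-1)/6" "of_nat (8*h) + 1 = (8*P-2)/6"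
      by (simp_all add: hP field_simps)
    have l: "9*h + 1 = p + 3*h" "7*h + 1 = p + h" "8*h + 1 = p + 2*h" using p_eq by auto
    show "(9*P-3)/6 * fact (9*h) = Fp * shift_fact 1 (3*h)" "(7*P-1)/6 * fact (7*h) = Fp * shift_fact 1 h"
      "(8*P-2)/6 * fact (8*h) = Fp * shift_fact 1 (2*h)"
      using l[THEN fact_p_shift] unfolding e Fp_def by (simp_all only:)
  qed
  have f15: "(15*P-9)/6 * ((15*P-3)/6) * fact (15*h) = F2 * shift_fact 2 (3*h)"
    and f13: "(13*P-7)/6 * ((13*P-1)/6) * fact (13*h) = F2 * shift_fact 2 h"
    and f14: "(14*P-8)/6 * ((14*P-2)/6) * fact (14*h) = F2 * shift_fact 2 (2*h)"
  proof -
    have e: "of_nat (15*h) + 1 = (15*P-9)/6" "of_nat (15*h) + 2 = (15*P-3)/6"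
      "of_nat (13*h) + 1 = (13*P-7)/6" "of_nat (13*h) + 2 = (13*P-1)/6"
      "of_nat (14*h) + 1 = (14*P-8)/6" "of_nat (14*h) + 2 = (14*P-2)/6"
      by (simp_all add: hP field_simps)
    have l: "15*h + 2 = 2*p + 3*h" "13*h + 2 = 2*p + h" "14*h + 2 = 2*p + 2*h" using p_eq by auto
    show "(15*P-9)/6 * ((15*P-3)/6) * fact (15*h) = F2 * shift_fact 2 (3*h)"
      "(13*P-7)/6 * ((13*P-1)/6) * fact (13*h) = F2 * shift_fact 2 h"
      "(14*P-8)/6 * ((14*P-2)/6) * fact (14*h) = F2 * shift_fact 2 (2*h)"
      using l[THEN fact_2p_shift] unfolding e F2_def by (simp_all only:)
  qed
  have u: "shift_quot 1 h \<noteq> 0" "shift_quot 1 (2*h) \<noteq> 0" "shift_quot 2 h \<noteq> 0" "shift_quot 2 (2*h) \<noteq> 0"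
    using h_less by (auto intro!: unit_nz unit_shift_quot)
  have "P > 3" using p_gt_3 by simp
  then have "7*P-1 > 0" "8*P-2 > 0" "13*P-7 > 0" "13*P-1 > 0" "14*P-8 > 0" "14*P-2 > 0" by linarith+
  then have nz: "7*P-1 \<noteq> 0" "8*P-2 \<noteq> 0" "(13*P-7) * (13*P-1) \<noteq> 0" "(14*P-8) * (14*P-2) \<noteq> 0"
    by (metis less_numeral_extra(3) mult_pos_pos)+
  have C0: "of_nat (3*h choose (2*h)) = C"
    using binomial_symmetric[of "2*h" "3*h"] by (simp add: C_def)
  have g7: "fact (7*h) = 6 * Fp * shift_fact 1 h / (7*P-1)" and g8: "fact (8*h) = 6 * Fp * shift_fact 1 (2*h) / (8*P-2)"
    and g13: "fact (13*h) = 36 * F2 * shift_fact 2 h / ((13*P-7) * (13*P-1))"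
    and g14: "fact (14*h) = 36 * F2 * shift_fact 2 (2*h) / ((14*P-8) * (14*P-2))"
    unfolding eq_divide_eq using nz f7 f8 f13 f14 by (simp_all add: mult_ac)
  have g9: "(9*P-3) * fact (9*h) = 6 * Fp * shift_fact 1 (3*h)"
    using f9 by simp
  have g15: "(15*P-9) * (15*P-3) * fact (15*h) = 36 * F2 * shift_fact 2 (3*h)"
    using f15 by (simp add: mult_ac)
  have B1: "(9*P-3) * of_nat (9*h choose (2*h)) = C * ((7*P-1) * e1)"
  proof -
    have "(9*P-3) * of_nat (9*h choose (2*h)) = (9*P-3) * fact (9*h) / (fact (2*h) * fact (7*h))"
      by (simp add: binomial_fact)
    also have "\<dots> = C * ((7*P-1) * e1)"
      unfolding g9 g7 shift_fact_eq C_eq e1_def using nz u Fnz by (simp add: mult_ac)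
    finally show ?thesis .
  qed
  have B2: "(9*P-3) * of_nat (9*h choose (8*h)) = C * ((8*P-2) * e2)"
  proof -
    have "(9*P-3) * of_nat (9*h choose (8*h)) = (9*P-3) * fact (9*h) / (fact (8*h) * fact h)"
      by (simp add: binomial_fact)
    also have "\<dots> = C * ((8*P-2) * e2)"
      unfolding g9 g8 shift_fact_eq C_eq e2_def using nz u Fnz by (simp add: mult_ac)
    finally show ?thesis .
  qed
  have B3: "((15*P-9) * (15*P-3)) * of_nat (15*h choose (2*h)) = C * (((13*P-7) * (13*P-1)) * e3)"
  proof -
    have "((15*P-9) * (15*P-3)) * of_nat (15*h choose (2*h)) = (15*P-9) * (15*P-3) * fact (15*h) / (fact (2*h) * fact (13*h))"
      by (simp add: binomial_fact)
    also have "\<dots> = C * (((13*P-7) * (13*P-1)) * e3)"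
      unfolding g15 g13 shift_fact_eq C_eq e3_def using nz u Fnz by (simp add: mult_ac)
    finally show ?thesis .
  qed
  have B4: "((15*P-9) * (15*P-3)) * of_nat (15*h choose (14*h)) = C * (((14*P-8) * (14*P-2)) * e4)"
  proof -
    have "((15*P-9) * (15*P-3)) * of_nat (15*h choose (14*h)) = (15*P-9) * (15*P-3) * fact (15*h) / (fact (14*h) * fact h)"
      by (simp add: binomial_fact)
    also have "\<dots> = C * (((14*P-8) * (14*P-2)) * e4)"
      unfolding g15 g14 shift_fact_eq C_eq e4_def using nz u Fnz by (simp add: mult_ac)
    finally show ?thesis .
  qed
  have B5: "((15*P-9) * (15*P-3)) * of_nat (15*h choose (8*h)) = C * (2 * ((8*P-2) * (7*P-1)) * e5)"
  proof -
    have F2: "F2 = 2 * shift_quot 1 (p - 1) * (Fp * Fp)" unfolding F2_def Fp_def fact_2p by (simp add: power2_eq_square)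
    have "((15*P-9) * (15*P-3)) * of_nat (15*h choose (8*h)) = (15*P-9) * (15*P-3) * fact (15*h) / (fact (8*h) * fact (7*h))"
      by (simp add: binomial_fact)
    also have "\<dots> = C * (2 * ((8*P-2) * (7*P-1)) * e5)"
      unfolding g15 g7 g8 F2 shift_fact_eq C_eq e5_def using nz u Fnz(1) by (simp add: mult_ac)
    finally show ?thesis .
  qed
  have "((9*P-3) * (15*P-9) * (15*P-3)) * jacobi_binom =
      15 * ((9*P-3) * (15*P-9) * (15*P-3)) * C
      - 10 * ((15*P-9) * (15*P-3)) * ((9*P-3) * of_nat (9*h choose (2*h)) + (9*P-3) * of_nat (9*h choose (8*h)))
      + 3 * (9*P-3) * (((15*P-9) * (15*P-3)) * of_nat (15*h choose (2*h)) + ((15*P-9) * (15*P-3)) * of_nat (15*h choose (14*h))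
          + ((15*P-9) * (15*P-3)) * of_nat (15*h choose (8*h)))"
  proof -
    have "a * d * e * (15 * w - 10 * (x + y) + 3 * (q + r + v)) = 15 * (a * d * e) * w - 10 * (d * e) * (a * x + a * y)
        + 3 * a * (d * e * q + d * e * v + d * e * r)" for a d e w x y q r v :: rat
      by (simp add: algebra_simps)
    then show ?thesis unfolding jacobi_binom_def C0 .
  qed
  also have "\<dots> = C * (15 * ((9*P-3) * (15*P-9) * (15*P-3))
       - 10 * ((15*P-9) * (15*P-3)) * ((7*P-1) * e1 + (8*P-2) * e2)
       + 3 * (9*P-3) * ((13*P-7) * (13*P-1) * e3 + (14*P-8) * (14*P-2) * e4
          + 2 * ((8*P-2) * (7*P-1)) * e5))"
  proof -
    have "15 * A * w - 10 * D * (w * x + w * y) + 3 * a * (w * q + w * r + w * v)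
       = w * (15 * A - 10 * D * (x + y) + 3 * a * (q + r + v))" for A w D x y a q r v :: rat
      by (simp add: algebra_simps)
    then show ?thesis unfolding B1 B2 B3 B4 B5 .
  qed
  finally show ?thesis .
qed

text \<open>The exponential of \<open>p (b1/2 - c1/3) + p\<^sup>2 b2/24\<close>, up to second order.\<close>

definition F0 :: rat where "F0 = 1 + P * (b1 / 2 - c1 / 3) + P\<^sup>2 * ((b1 / 2 - c1 / 3)\<^sup>2 / 2 + b2 / 24)"

lemma log_exp_F0: "log_exp F0 (b1 / 2 - c1 / 3) (b2 / 24)"
  unfolding F0_def log_exp_def by auto

text \<open>The factor \<open>P - 1\<close> is the number of terms in the character sums below.\<close>

lemma jacobi_binom_cong: "cong_p 3 ((P - 1) * jacobi_binom) (- 8 * C * F0)"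
proof -
  define D where "D = (9*P-3) * (15*P-9) * (15*P-3)"
  define e where "e l m = 1 + P * l + P\<^sup>2 * (l\<^sup>2 / 2 + m)" for l m
  have e: "cong_p 3 x (e l m)" "e l m \<in> Zp" if "log_exp x l m" for x l m
    using that by (auto simp: log_exp_def e_def)
  define R where "R u1 u2 u3 u4 u5 = 15 * D
       - 10 * ((15*P-9) * (15*P-3)) * ((7*P-1) * u1 + (8*P-2) * u2)
       + 3 * (9*P-3) * ((13*P-7) * (13*P-1) * u3 + (14*P-8) * (14*P-2) * u4
          + 2 * ((8*P-2) * (7*P-1)) * u5)" for u1 u2 u3 u4 u5
  have DZ: "D \<in> Zp" by (auto simp: D_def)
  have uD: "unit_p D"
    unfolding D_def using unit_shift[of "- 3" 9] unit_shift[of "- 9" 15] unit_shift[of "- 3" 15] by simp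
  define R0 where "R0 = R (e (- b1) (3*b2)) (e (c1 - b1) (b2/2)) (e (- 2*b1) (11*b2)) (e (2*c1 - 2*b1) (2*b2)) (e (c1 - 2*b1) (7/2*b2))"
  have R1: "cong_p 3 (R e1 e2 e3 e4 e5) (R0)"
    unfolding R0_def R_def using DZ
    by (intro cong_add cong_diff cong_mult_left cong_refl e log_exp_e1 log_exp_e2 log_exp_e3 log_exp_e4 log_exp_e5) auto
  have id: "(P - 1) * R0
     = - 8 * D * F0 + P ^ 3 * jacobi_remainder P b1 c1 b2"
    unfolding R0_def R_def e_def D_def F0_def by (rule jacobi_expansion_identity)
  have "D * ((P - 1) * jacobi_binom) = (P - 1) * (D * jacobi_binom)" by simp
  also have "D * jacobi_binom = C * R e1 e2 e3 e4 e5"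
    unfolding R_def D_def by (rule jacobi_binom_eq)
  also have "cong_p 3 ((P - 1) * (C * R e1 e2 e3 e4 e5)) ((P - 1) * (C * R0))"
    using unit_C by (intro cong_mult_left R1) auto
  also have "(P - 1) * (C * R0)
     = C * ((P - 1) * R0)"
    by simp
  also have "cong_p 3 \<dots> (C * (- 8 * D * F0))"
    unfolding id using unit_C by (intro cong_mult_left congI[OF refl]) (auto simp: jacobi_remainder_def)
  also have "C * (- 8 * D * F0) = D * (- 8 * C * F0)" by simp
  finally show ?thesis using uD by (rule cong_unit_cancel)
qed

end

section \<open>A Jacobi sum\<close>

lemma sum_triples:
  fixes F :: "nat \<Rightarrow> int"
  shows "(\<Sum>i<3*n. F i) = (\<Sum>k<n. F (3*k) + F (3*k+1) + F (3*k+2))"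
proof (induction n)
  case (Suc n)
  have "3 * Suc n = Suc (Suc (Suc (3*n)))" by simp
  then show ?case using Suc by (simp only: sum.lessThan_Suc) (simp add: algebra_simps)
qed simp

lemma sum_periodic_shift:
  fixes F :: "nat \<Rightarrow> int"
  assumes "\<And>i. F (i + n) = F i"
  shows "(\<Sum>l<n. F (k + l)) = (\<Sum>l<n. F l)"
proof (induction k)
  case (Suc k)
  have "(\<Sum>l<n. F (Suc k + l)) + F k = (\<Sum>l<Suc n. F (k + l))"
    by (subst sum.lessThan_Suc_shift) simp
  then show ?case using Suc assms[of k] by simp
qed simp

text \<open>The ordinary congruences of integers are used from here on, so this locale does not extend
\<open>prime_gt_3\<close>, in whose context their names denote rules for rational numbers.\<close>

locale cubic_prime =
  fixes p h :: nat
  assumes prime_p: "prime p" and p_eq: "p = 6 * h + 1"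
begin

lemma h_pos: "h > 0"
  using prime_p p_eq by (cases h) auto

lemma p_gt_2: "p > 2" "int p > 2"
  using h_pos p_eq by auto

lemma prime_int: "prime (int p)"
  using prime_p by simp

definition L :: "int \<Rightarrow> int" where "L a = Legendre a (int p)"

lemma L_cong: "[a = b] (mod int p) \<Longrightarrow> L a = L b"
proof -
  assume *: "[a = b] (mod int p)"
  then have "[y = a] (mod int p) \<longleftrightarrow> [y = b] (mod int p)" for y
    by (metis cong_sym cong_trans)
  moreover have "[a = 0] (mod int p) \<longleftrightarrow> [b = 0] (mod int p)"
    using * by (metis cong_sym cong_trans)
  ultimately show ?thesis by (simp add: L_def Legendre_def QuadRes_def)
qed

lemma L_range: "\<bar>L a\<bar> \<le> 1"
  by (simp add: L_def Legendre_def)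

lemma L_eq_0_iff: "L a = 0 \<longleftrightarrow> int p dvd a"
  by (simp add: L_def Legendre_def cong_0_iff)

lemma L_euler: "[L a = a ^ (3 * h)] (mod int p)"
proof -
  have "(p - 1) div 2 = 3 * h" using p_eq by simp
  then show ?thesis using euler_criterion[OF prime_p p_gt_2(1), of a] by (simp add: L_def)
qed

lemma small_cong: assumes "[x = y] (mod int p)" "\<bar>x\<bar> \<le> 1" "\<bar>y\<bar> \<le> 1" shows "x = y"
proof (rule ccontr)
  assume "x \<noteq> y"
  moreover have "int p dvd x - y" using assms(1) by (simp add: cong_iff_dvd_diff)
  ultimately have "int p \<le> \<bar>x - y\<bar>"
    using dvd_imp_le_int[of "x - y" "int p"] by simp
  then show False using assms p_gt_2 by linarith
qed

text \<open>By Euler's criterion this holds modulo \<open>p\<close>, and both sides are at most \<open>1\<close> in absolute value.\<close>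

lemma L_mult: "L (a * b) = L a * L b"
proof (rule small_cong)
  have "[L (a * b) = (a * b) ^ (3 * h)] (mod int p)" by (rule L_euler)
  also have "(a * b) ^ (3 * h) = a ^ (3 * h) * b ^ (3 * h)" by (rule power_mult_distrib)
  also have "[\<dots> = L a * L b] (mod int p)" by (intro cong_mult cong_sym[OF L_euler])
  finally show "[L (a * b) = L a * L b] (mod int p)" .
  show "\<bar>L a * L b\<bar> \<le> 1" using mult_mono[OF L_range[of a] L_range[of b]] by (simp add: abs_mult)
qed (rule L_range)

lemma L_1: "L 1 = 1"
proof -
  have "\<not> int p dvd 1" using p_gt_2 by auto
  then have "L 1 \<noteq> 0" by (simp add: L_eq_0_iff)
  moreover have "L 1 * L 1 = L 1" using L_mult[of 1 1] by simp
  ultimately show ?thesis by simp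
qed

lemma sum_affine:
  assumes F: "\<And>a b. [a = b] (mod int p) \<Longrightarrow> F a = (F b :: int)" and c: "\<not> int p dvd c"
  shows "(\<Sum>u\<in>{0..<int p}. F (c * u + b)) = (\<Sum>u\<in>{0..<int p}. F u)"
proof -
  define \<phi> where "\<phi> u = (c * u + b) mod int p" for u
  have "inj_on \<phi> {0..<int p}"
  proof (rule inj_onI)
    fix x y assume xy: "x \<in> {0..<int p}" "y \<in> {0..<int p}" "\<phi> x = \<phi> y"
    then have "int p dvd (c * x + b) - (c * y + b)" by (simp add: \<phi>_def mod_eq_dvd_iff)
    then have "int p dvd c * (x - y)" by (simp add: algebra_simps)
    then have "int p dvd x - y" using c prime_int by (simp add: prime_dvd_mult_iff)
    then have "x mod int p = y mod int p" by (simp add: mod_eq_dvd_iff)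
    then show "x = y" using xy by simp
  qed
  moreover have "\<phi> ` {0..<int p} \<subseteq> {0..<int p}" using p_gt_2 by (auto simp: \<phi>_def)
  ultimately have bij: "bij_betw \<phi> {0..<int p} {0..<int p}"
    by (simp add: bij_betw_def endo_inj_surj)
  have "(\<Sum>u\<in>{0..<int p}. F (c * u + b)) = (\<Sum>u\<in>{0..<int p}. F (\<phi> u))"
    by (intro sum.cong F) (auto simp: \<phi>_def cong_def)
  also have "\<dots> = (\<Sum>u\<in>{0..<int p}. F u)"
    using bij by (rule sum.reindex_bij_betw)
  finally show ?thesis .
qed

end

text \<open>A primitive root modulo \<open>p\<close> that is a \<open>(p-1)\<close>st root of unity modulo \<open>p\<^sup>3\<close>. Its
powers are Teichmueller representatives: characters of order dividing \<open>p-1\<close> have values among them.\<close>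

locale teichmueller_root = cubic_prime +
  fixes z :: int
  assumes z_pow: "[z ^ (6 * h) = 1] (mod int p ^ 3)"
    and z_ord: "\<And>i. [z ^ i = 1] (mod int p) \<longleftrightarrow> 6 * h dvd i"
begin

lemma z_not_dvd: "\<not> int p dvd z ^ i"
proof
  assume "int p dvd z ^ i"
  then have "int p dvd z" using prime_int prime_dvd_power by blast
  then have "int p dvd z ^ (6 * h)" using h_pos by (simp add: dvd_power_same dvd_trans[OF _ dvd_power])
  moreover have "[z ^ (6 * h) = 1] (mod int p)" using z_ord by simp
  ultimately have "int p dvd 1" by (metis cong_dvd_iff)
  then show False using p_gt_2 by auto
qed

lemma sum_roots:
  assumes F: "\<And>a b. [a = b] (mod int p) \<Longrightarrow> F a = (F b :: int)"
  shows "(\<Sum>i<6*h. F (z ^ i)) = (\<Sum>u\<in>{0..<int p}. F u) - F 0"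
proof -
  define \<phi> where "\<phi> i = z ^ i mod int p" for i :: nat
  have ord: "i = j" if "i \<le> j" "j < 6 * h" "\<phi> i = \<phi> j" for i j
  proof -
    have "z ^ j = z ^ i * z ^ (j - i)" using that by (simp add: power_add[symmetric])
    then have "[z ^ i * 1 = z ^ i * z ^ (j - i)] (mod int p)" using that by (simp add: \<phi>_def cong_def)
    moreover have "coprime (z ^ i) (int p)" using z_not_dvd[of i] prime_int by (metis coprime_commute prime_imp_coprime)
    ultimately have "[1 = z ^ (j - i)] (mod int p)" by (simp only: cong_mult_lcancel)
    then have "6 * h dvd j - i" using z_ord cong_sym by blast
    then show ?thesis using that by (metis diff_is_0_eq dvd_imp_le le_antisym less_imp_diff_less not_less zero_less_diff)
  qed
  have inj: "inj_on \<phi> {..<6*h}"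
  proof (rule inj_onI)
    fix i j assume "i \<in> {..<6*h}" "j \<in> {..<6*h}" "\<phi> i = \<phi> j"
    then show "i = j" using ord[of i j] ord[of j i] by (cases "i \<le> j") auto
  qed
  have sub: "\<phi> ` {..<6*h} \<subseteq> {1..<int p}"
  proof
    fix x assume "x \<in> \<phi> ` {..<6*h}"
    then obtain i where i: "x = z ^ i mod int p" by (auto simp: \<phi>_def)
    then have "x \<noteq> 0" using z_not_dvd[of i] by (simp add: dvd_eq_mod_eq_0)
    moreover have "0 \<le> x" "x < int p" using i p_gt_2 by auto
    ultimately show "x \<in> {1..<int p}" by simp
  qed
  have "card (\<phi> ` {..<6*h}) = card {1..<int p}" using inj by (simp add: card_image p_eq)
  then have "\<phi> ` {..<6*h} = {1..<int p}" using sub by (intro card_subset_eq) auto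
  then have bij: "bij_betw \<phi> {..<6*h} {1..<int p}" using inj by (simp add: bij_betw_def)
  have "(\<Sum>i<6*h. F (z ^ i)) = (\<Sum>i<6*h. F (\<phi> i))"
    by (intro sum.cong F) (auto simp: \<phi>_def cong_def)
  also have "\<dots> = (\<Sum>u\<in>{1..<int p}. F u)" using bij by (rule sum.reindex_bij_betw)
  also have "\<dots> = (\<Sum>u\<in>{0..<int p}. F u) - F 0"
  proof -
    have "{0..<int p} = insert 0 {1..<int p}" using p_gt_2 by auto
    then show ?thesis by simp
  qed
  finally show ?thesis .
qed

lemma L_z: "L (z ^ i) = (- 1) ^ i"
proof -
  have "L z \<noteq> 1"
  proof
    assume "L z = 1"
    then have "[z ^ (3 * h) = 1] (mod int p)" using L_euler[of z] cong_sym by metis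
    then have "6 * h dvd 3 * h" using z_ord by blast
    then show False using h_pos by (auto dest: dvd_imp_le)
  qed
  moreover have "L z \<noteq> 0" using z_not_dvd[of 1] by (simp add: L_eq_0_iff)
  ultimately have "L z = - 1" using L_range[of z] by linarith
  then show ?thesis by (induction i) (simp_all add: L_1 L_mult)
qed

lemma sum_L: "(\<Sum>u\<in>{0..<int p}. L u) = 0"
proof -
  have "(\<Sum>u\<in>{0..<int p}. L (z * u + 0)) = (\<Sum>u\<in>{0..<int p}. L u)"
    using z_not_dvd[of 1] by (intro sum_affine L_cong) auto
  moreover have "L (z * u + 0) = - L u" for u using L_z[of 1] by (simp add: L_mult)
  ultimately show ?thesis by (simp add: sum_negf)
qed

definition f :: "nat \<Rightarrow> int" where "f i = L (1 - z ^ i)"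

lemma f_0_iff: "f i = 0 \<longleftrightarrow> 6 * h dvd i"
proof -
  have "f i = 0 \<longleftrightarrow> [1 = z ^ i] (mod int p)" by (simp add: f_def L_eq_0_iff cong_iff_dvd_diff)
  also have "\<dots> \<longleftrightarrow> [z ^ i = 1] (mod int p)" by (rule cong_sym_eq)
  finally show ?thesis by (simp add: z_ord)
qed

lemma z_period: "[z ^ (i + 6 * h) = z ^ i] (mod int p)"
proof -
  have "[z ^ i * z ^ (6 * h) = z ^ i * 1] (mod int p)" using z_ord[of "6 * h"] by (intro cong_mult) auto
  then show ?thesis by (simp add: power_add)
qed

lemma f_period: "f (i + 6 * h) = f i"
  unfolding f_def by (intro L_cong cong_diff z_period) auto

lemma sum_f: "(\<Sum>i<6*h. f i) = - 1"
proof -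
  have "(\<Sum>i<6*h. f i) = (\<Sum>u\<in>{0..<int p}. L (1 - u)) - L (1 - 0)"
    unfolding f_def by (intro sum_roots[where F = "\<lambda>u. L (1 - u)"] L_cong cong_diff) auto
  also have "(\<Sum>u\<in>{0..<int p}. L (1 - u)) = (\<Sum>u\<in>{0..<int p}. L (- 1 * u + 1))" by simp
  also have "\<dots> = 0"
    using p_gt_2 sum_L by (subst sum_affine) (auto intro: L_cong)
  finally show ?thesis by (simp add: L_1)
qed

lemma f_correlation_0: "(\<Sum>i<6*h. f i * f i) = 6 * int h - 1"
proof -
  have "f i * f i = (if i = 0 then 0 else 1)" if "i < 6*h" for i
  proof (cases "i = 0")
    case False
    then have "f i \<noteq> 0" using that f_0_iff by (auto dest: dvd_imp_le)
    then have "f i = 1 \<or> f i = - 1" using L_range[of "1 - z ^ i"] unfolding f_def by linarith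
    then show ?thesis using False by auto
  qed (use f_0_iff in simp)
  then have "(\<Sum>i<6*h. f i * f i) = (\<Sum>i<6*h. if i = 0 then 0 else 1)" by (intro sum.cong) auto
  also have "\<dots> = (\<Sum>i\<in>{..<6*h} - {0}. 1)"
    by (intro sum.mono_neutral_cong_right) auto
  finally show ?thesis using h_pos by simp
qed

text \<open>With \<open>r = z\<^sup>d\<close> this is the sum of the Legendre symbols of \<open>(1-t) (1-r t)\<close> over \<open>t \<noteq> 0\<close>. After
the substitution \<open>t = 1 - u\<close> and multiplication by the square \<open>u^-2\<close> it is the sum of the symbols of a
linear function of \<open>u^-1\<close>, which runs through all residues but \<open>r\<close>.\<close>

lemma f_correlation:
  assumes d: "\<not> 6 * h dvd d"
  shows "(\<Sum>i<6*h. f i * f (i + d)) = - ((- 1) ^ d) - 1"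
proof -
  define r where "r = z ^ d"
  have r: "\<not> int p dvd 1 - r"
    using d z_ord[of d] by (simp add: r_def cong_iff_dvd_diff dvd_diff_commute)
  define F where "F t = L (1 - t) * L (1 - r * t)" for t
  have Fc: "F a = F b" if "[a = b] (mod int p)" for a b
    unfolding F_def using that by (intro arg_cong2[where f = "(*)"] L_cong cong_diff cong_mult) auto
  have "(\<Sum>i<6*h. f i * f (i + d)) = (\<Sum>i<6*h. F (z ^ i))"
    by (simp add: f_def F_def r_def power_add mult.commute)
  also have "\<dots> = (\<Sum>u\<in>{0..<int p}. F u) - F 0" using Fc by (rule sum_roots)
  also have "(\<Sum>u\<in>{0..<int p}. F u) = (\<Sum>u\<in>{0..<int p}. F (- 1 * u + 1))"
    using p_gt_2 by (intro sum_affine[OF Fc, symmetric]) auto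
  also have "\<dots> = (\<Sum>u\<in>{0..<int p}. L u * L ((1 - r) + r * u))"
    by (intro sum.cong) (auto simp: F_def algebra_simps)
  also have "\<dots> = (\<Sum>i<6*h. L (z ^ i) * L ((1 - r) + r * z ^ i))"
  proof -
    have "(\<Sum>i<6*h. L (z ^ i) * L ((1 - r) + r * z ^ i)) = (\<Sum>u\<in>{0..<int p}. L u * L ((1 - r) + r * u)) - L 0 * L ((1 - r) + r * 0)"
      by (rule sum_roots[where F = "\<lambda>u. L u * L ((1 - r) + r * u)"])
         (intro arg_cong2[where f = "(*)"] L_cong cong_add cong_mult; auto)
    then show ?thesis using L_eq_0_iff[of 0] by simp
  qed
  \<comment> \<open>multiplying the second argument by the inverse of the first removes the first factor\<close>
  also have "\<dots> = (\<Sum>i<6*h. L ((1 - r) * z ^ (6 * h - i) + r))"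
  proof (rule sum.cong)
    fix i assume "i \<in> {..<6*h}"
    then have i: "6 * h - i + i = 6 * h" by simp
    have "even (6 * h - i) = even i" using i by presburger
    then have "L (z ^ i) = L (z ^ (6 * h - i))" unfolding L_z by (simp add: minus_one_power_iff)
    then have "L (z ^ i) * L ((1 - r) + r * z ^ i) = L (z ^ (6 * h - i) * ((1 - r) + r * z ^ i))"
      by (simp add: L_mult)
    also have "z ^ (6 * h - i) * ((1 - r) + r * z ^ i) = (1 - r) * z ^ (6 * h - i) + r * z ^ (6 * h)"
      using i by (simp add: algebra_simps power_add[symmetric])
    also have "L \<dots> = L ((1 - r) * z ^ (6 * h - i) + r * 1)"
      using z_ord[of "6 * h"] by (intro L_cong cong_add cong_mult) auto
    finally show "L (z ^ i) * L ((1 - r) + r * z ^ i) = L ((1 - r) * z ^ (6 * h - i) + r)" by simp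
  qed simp
  also have "\<dots> = (\<Sum>i<6*h. L ((1 - r) * z ^ Suc i + r))"
    by (rule sum.reindex_bij_witness[where i = "\<lambda>i. 6 * h - Suc i" and j = "\<lambda>i. 6 * h - Suc i"]) (auto simp: Suc_diff_Suc simp del: power_Suc)
  also have "\<dots> = (\<Sum>i<6*h. L ((1 - r) * z ^ i + r))"
  proof -
    have "(\<Sum>i<6*h. L ((1 - r) * z ^ (1 + i) + r)) = (\<Sum>i<6*h. L ((1 - r) * z ^ i + r))"
      by (rule sum_periodic_shift) (intro L_cong cong_add cong_mult z_period; simp)
    then show ?thesis by simp
  qed
  also have "\<dots> = (\<Sum>u\<in>{0..<int p}. L ((1 - r) * u + r)) - L ((1 - r) * 0 + r)"
    by (rule sum_roots[where F = "\<lambda>u. L ((1 - r) * u + r)"]) (intro L_cong cong_add cong_mult; simp)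
  also have "(\<Sum>u\<in>{0..<int p}. L ((1 - r) * u + r)) = 0"
    using sum_affine[of L, OF L_cong r] sum_L by simp
  finally show ?thesis by (simp add: F_def L_1 r_def L_z)
qed

text \<open>The sum of the Legendre symbols of \<open>1 - t\<close> over a coset of the cubes.\<close>

definition class_sum :: "nat \<Rightarrow> int" where "class_sum c = (\<Sum>k<2*h. f (3 * k + c))"

lemma sum_class_sums: "class_sum 0 + class_sum 1 + class_sum 2 = - 1"
proof -
  have "3 * (2 * h) = 6 * h" by simp
  then show ?thesis using sum_triples[of f "2 * h"] sum_f by (simp add: class_sum_def sum.distrib)
qed

text \<open>The squares count pairs \<open>(t, t')\<close> in the same coset of the cubes. Grouping them by the quotient
\<open>t' / t\<close> gives the correlations at the multiples of \<open>3\<close>.\<close>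

lemma sum_class_sums_sq: "class_sum 0 ^ 2 + class_sum 1 ^ 2 + class_sum 2 ^ 2 = 4 * int h + 1"
proof -
  have sq: "class_sum c ^ 2 = (\<Sum>m<2*h. \<Sum>k<2*h. f (3*k+c) * f (3*k+c+3*m))" for c
  proof -
    have per: "f (3 * (i + 2*h) + c) = f (3 * i + c)" for i
      using f_period[of "3 * i + c"] by (simp add: algebra_simps)
    have "class_sum c ^ 2 = (\<Sum>k<2*h. f (3*k+c) * (\<Sum>l<2*h. f (3*l+c)))"
      by (simp add: power2_eq_square class_sum_def sum_distrib_right)
    also have "\<dots> = (\<Sum>k<2*h. f (3*k+c) * (\<Sum>m<2*h. f (3*(k+m)+c)))"
      using sum_periodic_shift[of "\<lambda>l. f (3*l+c)" "2*h"] per by simp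
    also have "\<dots> = (\<Sum>k<2*h. \<Sum>m<2*h. f (3*k+c) * f (3*k+c+3*m))"
      by (simp add: sum_distrib_left algebra_simps)
    also have "\<dots> = (\<Sum>m<2*h. \<Sum>k<2*h. f (3*k+c) * f (3*k+c+3*m))" by (rule sum.swap)
    finally show ?thesis .
  qed
  have "class_sum 0 ^ 2 + class_sum 1 ^ 2 + class_sum 2 ^ 2 = (\<Sum>m<2*h. \<Sum>i<6*h. f i * f (i + 3 * m))"
  proof -
    have "(\<Sum>i<6*h. f i * f (i + 3 * m)) = (\<Sum>k<2*h. f (3*k) * f (3*k+3*m))
      + (\<Sum>k<2*h. f (3*k+1) * f (3*k+1+3*m)) + (\<Sum>k<2*h. f (3*k+2) * f (3*k+2+3*m))" for m
      using sum_triples[of "\<lambda>i. f i * f (i + 3 * m)" "2 * h"] by (simp add: sum.distrib)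
    then show ?thesis unfolding sq by (simp add: sum.distrib)
  qed
  also have "\<dots> = (\<Sum>m<2*h. if m = 0 then 6 * int h - 1 else - ((- 1) ^ m) - 1)"
  proof (rule sum.cong)
    fix m assume m: "m \<in> {..<2*h}"
    show "(\<Sum>i<6*h. f i * f (i + 3 * m)) = (if m = 0 then 6 * int h - 1 else - ((- 1) ^ m) - 1)"
    proof (cases "m = 0")
      case False
      then have "\<not> 6 * h dvd 3 * m" using m by (auto dest: dvd_imp_le)
      moreover have "(- 1 :: int) ^ (3 * m) = (- 1) ^ m" by (simp add: power_mult)
      ultimately show ?thesis using f_correlation[of "3 * m"] False by simp
    qed (use f_correlation_0 in simp)
  qed simp
  also have "\<dots> = (\<Sum>m<2*h. (if m = 0 then 6 * int h + 1 else 0) + (- ((- 1) ^ m) - 1))"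
    by (rule sum.cong) auto
  also have "\<dots> = (6 * int h + 1) - (\<Sum>m<2*h. (- 1) ^ m) - 2 * int h"
    using h_pos by (simp add: sum.distrib sum_negf sum_subtractf)
  also have "(\<Sum>m<2*h. (- 1) ^ m) = (0 :: int)"
  proof -
    have "(\<Sum>m<2*n. (- 1) ^ m) = (0 :: int)" for n by (induction n) simp_all
    then show ?thesis .
  qed
  finally show ?thesis by simp
qed

text \<open>Each coset has \<open>2h\<close> elements, and outside the cubes no symbol vanishes.\<close>

lemma even_class_sum: assumes "c = 1 \<or> c = 2" shows "even (class_sum c)"
proof -
  have "even (f (3 * k + c) - 1)" for k
  proof -
    have "\<not> 6 * h dvd 3 * k + c"
    proof
      assume "6 * h dvd 3 * k + c"
      then obtain e where "3 * k + c = 6 * h * e" by (elim dvdE)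
      then have "(3 * k + c) mod 3 = 0" by (simp add: mult.assoc)
      then show False using assms by auto
    qed
    then have "f (3 * k + c) \<noteq> 0" using f_0_iff by blast
    then have "f (3 * k + c) = 1 \<or> f (3 * k + c) = - 1" using L_range[of "1 - z ^ (3 * k + c)"] unfolding f_def by linarith
    then show ?thesis by auto
  qed
  then have "even (\<Sum>k<2*h. f (3 * k + c) - 1)" by (intro dvd_sum) auto
  then show ?thesis by (simp add: sum_subtractf class_sum_def)
qed

definition w :: int where "w = z ^ (4 * h)"
definition e :: int where "e = (class_sum 1 - class_sum 2) div 2"
text \<open>With \<open>w\<close> a primitive cube root of unity, \<open>class_sum 0 + class_sum 1 * w + class_sum 2 * w\<^sup>2\<close> is
\<open>X + e * (2 * w + 1)\<close>, and \<open>2 * w + 1\<close> is a square root of \<open>-3\<close>. Halving the difference of two class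
sums is possible by \<open>even_class_sum\<close>.\<close>

definition X :: int where "X = class_sum 0 - class_sum 2 - e"

lemma e_eq: "class_sum 1 - class_sum 2 = 2 * e"
  using even_class_sum[of 1] even_class_sum[of 2] by (simp add: e_def)

text \<open>The norm is a quadratic form in the class sums, determined by their sum and the sum of their
squares.\<close>

lemma norm_eq: "int p = X\<^sup>2 + 3 * e\<^sup>2"
proof -
  have a1: "class_sum 1 = class_sum 2 + 2 * e" using e_eq by simp
  have a0: "class_sum 0 = - 1 - 2 * class_sum 2 - 2 * e" using sum_class_sums a1 by simp
  have "6 * (class_sum 2)\<^sup>2 + 12 * class_sum 2 * e + 8 * e\<^sup>2 + 4 * class_sum 2 + 4 * e = 4 * int h"
    using sum_class_sums_sq unfolding a0 a1 by (simp add: power2_eq_square algebra_simps)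
  moreover have "X\<^sup>2 + 3 * e\<^sup>2 = 9 * (class_sum 2)\<^sup>2 + 18 * class_sum 2 * e + 12 * e\<^sup>2 + 6 * class_sum 2 + 6 * e + 1"
    unfolding X_def a0 by (simp add: power2_eq_square algebra_simps)
  ultimately show ?thesis by (simp add: p_eq)
qed

lemma coprime_minus_1: "\<not> 6 * h dvd d \<Longrightarrow> coprime (int p ^ 3) (z ^ d - 1)"
  using z_ord[of d] prime_int by (simp add: cong_iff_dvd_diff prime_imp_coprime)

lemma w_quadratic: "[w\<^sup>2 + w + 1 = 0] (mod int p ^ 3)"
proof -
  have "[(z ^ (6 * h))\<^sup>2 = 1\<^sup>2] (mod int p ^ 3)" by (intro cong_pow z_pow)
  moreover have "(z ^ (6 * h))\<^sup>2 = w ^ 3" by (simp add: w_def power_mult[symmetric])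
  ultimately have "int p ^ 3 dvd w ^ 3 - 1" by (simp add: cong_iff_dvd_diff)
  also have "w ^ 3 - 1 = (w\<^sup>2 + w + 1) * (w - 1)" by (simp add: power2_eq_square power3_eq_cube algebra_simps)
  finally have "int p ^ 3 dvd (w\<^sup>2 + w + 1) * (w - 1)" .
  moreover have "\<not> 6 * h dvd 4 * h" using h_pos by (auto dest: dvd_imp_le)
  then have "coprime (int p ^ 3) (w - 1)" unfolding w_def by (rule coprime_minus_1)
  ultimately show ?thesis by (simp add: coprime_dvd_mult_left_iff cong_0_iff)
qed

text \<open>The Jacobi sum of the cubic character \<open>z\<^sup>i \<mapsto> z^(4hi)\<close> and the Legendre symbol.\<close>

definition J :: int where "J = (\<Sum>i<6*h. z ^ (4 * h * i) * f i)"

lemma J_cong: "[J = X + e * (2 * w + 1)] (mod int p ^ 3)"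
proof -
  have zw: "[z ^ (4 * h * (3 * k + c)) = w ^ c] (mod int p ^ 3)" for k c
  proof -
    have "4 * h * (3 * k + c) = 6 * h * (2 * k) + 4 * h * c" by (simp add: algebra_simps)
    then have "z ^ (4 * h * (3 * k + c)) = (z ^ (6 * h)) ^ (2 * k) * w ^ c"
      by (simp only: power_add power_mult w_def)
    also have "[\<dots> = 1 ^ (2 * k) * w ^ c] (mod int p ^ 3)" by (intro cong_mult cong_pow z_pow cong_refl)
    finally show ?thesis by simp
  qed
  have triples: "J = (\<Sum>k<2*h. z ^ (4 * h * (3*k)) * f (3*k) + z ^ (4 * h * (3*k+1)) * f (3*k+1) + z ^ (4 * h * (3*k+2)) * f (3*k+2))"
    unfolding J_def using sum_triples[of "\<lambda>i. z ^ (4 * h * i) * f i" "2 * h"] by simp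
  have "[J = (\<Sum>k<2*h. w ^ 0 * f (3*k) + w ^ 1 * f (3*k+1) + w ^ 2 * f (3*k+2))] (mod int p ^ 3)"
    unfolding triples
  proof (rule cong_sum)
    fix k
    note zw0 = zw[of k 0, unfolded add_0_right]
    show "[z ^ (4 * h * (3*k)) * f (3*k) + z ^ (4 * h * (3*k+1)) * f (3*k+1) + z ^ (4 * h * (3*k+2)) * f (3*k+2)
       = w ^ 0 * f (3*k) + w ^ 1 * f (3*k+1) + w ^ 2 * f (3*k+2)] (mod int p ^ 3)"
      by (rule cong_add[OF cong_add[OF cong_scalar_right[OF zw0] cong_scalar_right[OF zw]] cong_scalar_right[OF zw]])
  qed
  also have "(\<Sum>k<2*h. w ^ 0 * f (3*k) + w ^ 1 * f (3*k+1) + w ^ 2 * f (3*k+2)) = class_sum 0 + w * class_sum 1 + w\<^sup>2 * class_sum 2"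
    by (simp add: class_sum_def sum.distrib sum_distrib_left)
  also have "\<dots> = X + e * (2 * w + 1) + class_sum 2 * (w\<^sup>2 + w + 1)"
  proof -
    have "class_sum 1 = class_sum 2 + 2 * e" using e_eq by simp
    then show ?thesis by (simp add: X_def algebra_simps)
  qed
  also have "[\<dots> = X + e * (2 * w + 1) + class_sum 2 * 0] (mod int p ^ 3)"
    by (intro cong_add cong_mult cong_refl w_quadratic)
  finally show ?thesis by simp
qed

text \<open>If \<open>y\<close> is congruent to \<open>\<epsilon> = \<plusminus>1\<close> modulo \<open>p\<close>, then \<open>15 y - 10 y\<^sup>3 + 3 y\<^sup>5 - 8 \<epsilon>\<close> is divisible by
\<open>(y - \<epsilon>)\<^sup>3\<close>, hence by \<open>p\<^sup>3\<close>. For \<open>i = 0\<close> both sides are exactly zero.\<close>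

lemma legendre_mod_cube:
  assumes "i < 6 * h"
  shows "[8 * f i = 15 * (1 - z ^ i) ^ (3*h) - 10 * (1 - z ^ i) ^ (9*h) + 3 * (1 - z ^ i) ^ (15*h)] (mod int p ^ 3)"
proof (cases "i = 0")
  case True
  then show ?thesis using h_pos f_0_iff[of 0] by (simp add: zero_power)
next
  case False
  define y where "y = (1 - z ^ i) ^ (3*h)"
  have y: "(1 - z ^ i) ^ (9*h) = y ^ 3" "(1 - z ^ i) ^ (15*h) = y ^ 5"
    by (simp_all add: y_def power_mult[symmetric] mult.commute)
  have "f i \<noteq> 0" using False assms f_0_iff by (auto dest: dvd_imp_le)
  then have f: "f i = 1 \<or> f i = - 1" using L_range[of "1 - z ^ i"] unfolding f_def by linarith
  have "int p dvd y - f i"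
    using cong_sym[OF L_euler[of "1 - z ^ i"]] by (simp add: f_def y_def cong_iff_dvd_diff)
  then have "int p ^ 3 dvd (y - f i) ^ 3" by (rule dvd_power_same)
  then have "int p ^ 3 dvd (y - f i) ^ 3 * (3 * y\<^sup>2 + 9 * f i * y + 8)" by (rule dvd_mult2)
  also have "(y - f i) ^ 3 * (3 * y\<^sup>2 + 9 * f i * y + 8) = 15 * y - 10 * y ^ 3 + 3 * y ^ 5 - 8 * f i"
    using f by (auto simp: eval_nat_numeral algebra_simps)
  finally have "[15 * y - 10 * y ^ 3 + 3 * y ^ 5 = 8 * f i] (mod int p ^ 3)" by (simp add: cong_iff_dvd_diff)
  then show ?thesis unfolding y y_def[symmetric] by (rule cong_sym)
qed

text \<open>Orthogonality: \<open>z\<^sup>d - 1\<close> is a unit unless \<open>d\<close> is a multiple of \<open>p - 1\<close>.\<close>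

lemma geometric_cong:
  "[(\<Sum>i<6*h. (z ^ d) ^ i) = (if 6 * h dvd d then 6 * int h else 0)] (mod int p ^ 3)"
proof (cases "6 * h dvd d")
  case True
  then obtain k where k: "d = 6 * h * k" by (elim dvdE)
  have "[(\<Sum>i<6*h. (z ^ d) ^ i) = (\<Sum>i<6*h. (1 ^ k) ^ i)] (mod int p ^ 3)"
    unfolding k power_mult[of z "6 * h"] by (intro cong_sum cong_pow z_pow)
  then show ?thesis using True by simp
next
  case False
  have "[(z ^ (6 * h)) ^ d = 1 ^ d] (mod int p ^ 3)" by (intro cong_pow z_pow)
  moreover have "(z ^ d) ^ (6 * h) = (z ^ (6 * h)) ^ d" by (simp add: power_mult[symmetric] mult.commute)
  ultimately have "int p ^ 3 dvd (z ^ d) ^ (6 * h) - 1" by (simp add: cong_iff_dvd_diff)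
  also have "(z ^ d) ^ (6 * h) - 1 = (\<Sum>i<6*h. (z ^ d) ^ i) * (z ^ d - 1)"
    by (simp add: power_diff_1_eq mult.commute)
  finally show ?thesis using False coprime_minus_1[OF False]
    by (simp add: coprime_dvd_mult_left_iff cong_0_iff)
qed

lemma binomial_character_sum:
  "[(\<Sum>i<6*h. z ^ (4 * h * i) * (1 - z ^ i) ^ M)
     = 6 * int h * (\<Sum>j | j \<le> M \<and> 6 * h dvd 4 * h + j. (- 1) ^ j * int (M choose j))] (mod int p ^ 3)"
proof -
  have ex: "(1 - z ^ i) ^ M = (\<Sum>j\<le>M. (- 1) ^ j * int (M choose j) * z ^ (i * j))" for i
  proof -
    have "(- (z ^ i) + 1) ^ M = (\<Sum>j\<le>M. int (M choose j) * (- (z ^ i)) ^ j * 1 ^ (M - j))" by (rule binomial_ring)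
    also have "\<dots> = (\<Sum>j\<le>M. (- 1) ^ j * int (M choose j) * z ^ (i * j))"
      by (intro sum.cong refl) (simp add: power_minus[of "z ^ i"] power_mult)
    finally show ?thesis by simp
  qed
  have expanded: "(\<Sum>i<6*h. z ^ (4 * h * i) * (1 - z ^ i) ^ M)
     = (\<Sum>j\<le>M. (- 1) ^ j * int (M choose j) * (\<Sum>i<6*h. (z ^ (4 * h + j)) ^ i))"
    unfolding ex sum_distrib_left
    by (subst sum.swap) (simp add: power_mult[symmetric] power_add[symmetric] algebra_simps)
  have "[(\<Sum>i<6*h. z ^ (4 * h * i) * (1 - z ^ i) ^ M) = (\<Sum>j\<le>M. (- 1) ^ j * int (M choose j) * (if 6 * h dvd 4 * h + j then 6 * int h else 0))] (mod int p ^ 3)"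
    unfolding expanded by (intro cong_sum cong_mult cong_refl geometric_cong)
  also have "(\<Sum>j\<le>M. (- 1) ^ j * int (M choose j) * (if 6 * h dvd 4 * h + j then 6 * int h else 0))
     = (\<Sum>j | j \<le> M \<and> 6 * h dvd 4 * h + j. (- 1) ^ j * int (M choose j) * (6 * int h))"
    by (rule sum.mono_neutral_cong_right) auto
  finally show ?thesis by (simp add: sum_distrib_left mult.commute)
qed

lemma exponents:
  assumes "M \<le> 15*h"
  shows "{j. j \<le> M \<and> 6 * h dvd 4 * h + j} = {j \<in> {2*h, 8*h, 14*h}. j \<le> M}"
proof -
  have 1: "j = 2*h \<or> j = 8*h \<or> j = 14*h" if "j \<le> 15*h" "6 * h dvd 4 * h + j" for j
  proof -
    obtain c where c: "4 * h + j = 6 * h * c" using \<open>6 * h dvd 4 * h + j\<close> by (elim dvdE)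
    have "c \<noteq> 0" using c h_pos by (intro notI) simp
    moreover have "c < 4"
    proof (rule ccontr)
      assume "\<not> c < 4"
      then have "6 * h * 4 \<le> 6 * h * c" by (intro mult_le_mono2) simp
      then show False using c that h_pos by linarith
    qed
    ultimately have "c = 1 \<or> c = 2 \<or> c = 3" by auto
    then show ?thesis using c by auto
  qed
  have 2: "6 * h dvd 4 * h + 2 * h" "6 * h dvd 4 * h + 8 * h" "6 * h dvd 4 * h + 14 * h"
    using dvd_triv_left[of "6 * h" 1] dvd_triv_left[of "6 * h" 2] dvd_triv_left[of "6 * h" 3] by simp_all
  show ?thesis
  proof (intro subset_antisym subsetI)
    fix j assume j: "j \<in> {j. j \<le> M \<and> 6 * h dvd 4 * h + j}"
    then show "j \<in> {j \<in> {2*h, 8*h, 14*h}. j \<le> M}" using 1[of j] assms by auto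
  next
    fix j assume "j \<in> {j \<in> {2*h, 8*h, 14*h}. j \<le> M}"
    then show "j \<in> {j. j \<le> M \<and> 6 * h dvd 4 * h + j}" using 2 by auto
  qed
qed

lemma J_binomial:
  "[8 * J = 6 * int h * (15 * int (3*h choose (2*h)) - 10 * (int (9*h choose (2*h)) + int (9*h choose (8*h)))
     + 3 * (int (15*h choose (2*h)) + int (15*h choose (8*h)) + int (15*h choose (14*h))))] (mod int p ^ 3)"
proof -
  define S where "S M = (\<Sum>i<6*h. z ^ (4 * h * i) * (1 - z ^ i) ^ M)" for M
  have J8: "8 * J = (\<Sum>i<6*h. z ^ (4 * h * i) * (8 * f i))" by (simp add: J_def sum_distrib_left mult_ac)
  have "[8 * J = (\<Sum>i<6*h. z ^ (4 * h * i) * (15 * (1 - z ^ i) ^ (3*h) - 10 * (1 - z ^ i) ^ (9*h) + 3 * (1 - z ^ i) ^ (15*h)))] (mod int p ^ 3)"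
    unfolding J8 by (intro cong_sum cong_mult cong_refl legendre_mod_cube) simp
  also have "(\<Sum>i<6*h. z ^ (4 * h * i) * (15 * (1 - z ^ i) ^ (3*h) - 10 * (1 - z ^ i) ^ (9*h) + 3 * (1 - z ^ i) ^ (15*h)))
    = 15 * S (3*h) - 10 * S (9*h) + 3 * S (15*h)"
    by (simp add: S_def sum_distrib_left sum_subtractf sum.distrib algebra_simps)
  also have "[\<dots> = 15 * (6 * int h * int (3*h choose (2*h))) - 10 * (6 * int h * (int (9*h choose (2*h)) + int (9*h choose (8*h))))
     + 3 * (6 * int h * (int (15*h choose (2*h)) + int (15*h choose (8*h)) + int (15*h choose (14*h))))] (mod int p ^ 3)"
  proof -
    have "{j \<in> {2*h, 8*h, 14*h}. j \<le> 3*h} = {2*h}" "{j \<in> {2*h, 8*h, 14*h}. j \<le> 9*h} = {2*h, 8*h}"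
      "{j \<in> {2*h, 8*h, 14*h}. j \<le> 15*h} = {2*h, 8*h, 14*h}"
      using h_pos by auto
    then show ?thesis
      using binomial_character_sum[of "3*h"] binomial_character_sum[of "9*h"] binomial_character_sum[of "15*h"] h_pos
      unfolding S_def by (intro cong_add cong_diff cong_mult cong_refl) (simp_all add: add.assoc exponents)
  qed
  finally show ?thesis by (simp add: algebra_simps)
qed

end

text \<open>The \<open>p\<^sup>2\<close>th power of a primitive root modulo \<open>p\<close> is still one, since \<open>p\<^sup>2\<close> is prime to
\<open>p - 1\<close>, and Euler's theorem applies modulo \<open>p\<^sup>3\<close>.\<close>

lemma (in cubic_prime) teichmueller_root_exists:
  "\<exists>z. teichmueller_root p h z"
proof -
  have n: "p > 1" using p_gt_2 by simp
  obtain g where g: "residue_primroot p g" using prime_primitive_root_exists[of p] prime_p n by auto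
  have tp: "totient p = 6 * h" using totient_prime[OF prime_p] p_eq by simp
  have cop: "coprime p g" and ordg: "ord p g = 6 * h" using g tp by (auto simp: residue_primroot_def)
  define y where "y = g ^ (p\<^sup>2)"
  have "totient (p ^ 3) = p\<^sup>2 * (6 * h)"
    using totient_prime_power[OF prime_p, of 3] p_eq by (simp add: eval_nat_numeral)
  moreover have "coprime g (p ^ 3)" using cop by (simp add: coprime_commute)
  ultimately have "[g ^ (p\<^sup>2 * (6 * h)) = 1] (mod p ^ 3)" using euler_theorem[of g "p ^ 3"] by simp
  then have "[y ^ (6 * h) = 1] (mod p ^ 3)" by (simp add: y_def power_mult)
  then have 1: "[int y ^ (6 * h) = 1] (mod int p ^ 3)"
    by (metis cong_int_iff of_nat_1 of_nat_power)
  have "[y ^ i = 1] (mod p) \<longleftrightarrow> 6 * h dvd i" for i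
  proof -
    have "[y ^ i = 1] (mod p) \<longleftrightarrow> 6 * h dvd p\<^sup>2 * i"
      unfolding y_def power_mult[symmetric] ord_divides ordg ..
    also have "coprime (6 * h) (p\<^sup>2)"
    proof -
      have "coprime (6 * h) p" unfolding p_eq by simp
      then show ?thesis by simp
    qed
    then have "6 * h dvd p\<^sup>2 * i \<longleftrightarrow> 6 * h dvd i" by (simp add: coprime_dvd_mult_right_iff)
    finally show ?thesis .
  qed
  then have 2: "[int y ^ i = 1] (mod int p) \<longleftrightarrow> 6 * h dvd i" for i
    by (metis cong_int_iff of_nat_1 of_nat_power)
  have "teichmueller_root p h (int y)" by unfold_locales (rule 1 2)+
  then show ?thesis by blast
qed

section \<open>Representations of p and the congruences\<close>

text \<open>The product of the two forms is a form of the same shape in two ways, and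
\<open>(xe + yX) (xe - yX)\<close> is divisible by \<open>q\<close>. If \<open>q\<close> divides one factor, that factor is zero, as three
times its square is at most \<open>q\<^sup>2\<close>.\<close>

lemma norm_form_unique:
  fixes x y X e q :: int
  assumes q: "prime q" and 1: "q = x\<^sup>2 + 3 * y\<^sup>2" and 2: "q = X\<^sup>2 + 3 * e\<^sup>2"
  shows "x\<^sup>2 = X\<^sup>2"
proof -
  have finish: "x\<^sup>2 = X\<^sup>2" if d: "q dvd x * e + s * y * X" and s: "s = 1 \<or> s = - 1" for s
  proof -
    define A where "A = x * e + s * y * X"
    have ss: "s * s = 1" using s by auto
    have "q * q = (x * X - 3 * s * y * e)\<^sup>2 + 3 * A\<^sup>2"
      unfolding A_def using s by (subst (1) 1, subst 2) (auto simp: power2_eq_square algebra_simps)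
    then have le: "3 * A\<^sup>2 \<le> q * q" by simp
    have "A = 0"
    proof (rule ccontr)
      assume "A \<noteq> 0"
      then have "\<bar>q\<bar> \<le> \<bar>A\<bar>" using d dvd_imp_le_int[of A q] by (simp add: A_def)
      then have "q\<^sup>2 \<le> A\<^sup>2" by (simp add: abs_le_square_iff)
      moreover have "q\<^sup>2 > 0" using q by (auto simp: prime_gt_0_int)
      ultimately show False using le by (simp add: power2_eq_square)
    qed
    then have "x * e = - (s * y * X)" unfolding A_def by linarith
    then have "(x * e)\<^sup>2 = (s * s) * (y * X)\<^sup>2" by (simp add: power2_eq_square)
    then have "(x * e)\<^sup>2 = (y * X)\<^sup>2" unfolding ss by simp
    then have "q * (e\<^sup>2 - y\<^sup>2) = 0"
    proof -
      have "q * e\<^sup>2 - q * y\<^sup>2 = (x\<^sup>2 + 3 * y\<^sup>2) * e\<^sup>2 - (X\<^sup>2 + 3 * e\<^sup>2) * y\<^sup>2" using 1 2 by simp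
      also have "\<dots> = (x * e)\<^sup>2 - (y * X)\<^sup>2" by (simp add: power2_eq_square algebra_simps)
      finally show ?thesis using \<open>(x * e)\<^sup>2 = (y * X)\<^sup>2\<close> by (simp add: algebra_simps)
    qed
    then have "e\<^sup>2 = y\<^sup>2" using q by auto
    then show ?thesis using 1 2 by simp
  qed
  have "(x * e + 1 * y * X) * (x * e + - 1 * y * X) = q * (e\<^sup>2 - y\<^sup>2)"
  proof -
    have "q * (e\<^sup>2 - y\<^sup>2) = (x\<^sup>2 + 3 * y\<^sup>2) * e\<^sup>2 - (X\<^sup>2 + 3 * e\<^sup>2) * y\<^sup>2"
      using 1 2 by (simp add: right_diff_distrib)
    then show ?thesis by (simp add: power2_eq_square algebra_simps)
  qed
  then have "q dvd (x * e + 1 * y * X) * (x * e + - 1 * y * X)" by simp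
  then have "q dvd x * e + 1 * y * X \<or> q dvd x * e + - 1 * y * X"
    using q by (simp only: prime_dvd_mult_iff)
  then show ?thesis using finish by blast
qed

context split_prime
begin

lemma log_exp_F0_sq: "log_exp (F0 * F0) (b1 - 2/3 * c1) (1/12 * b2)"
  using log_exp_mult[OF log_exp_F0 log_exp_F0] by (rule log_exp_eqI) (simp_all add: field_simps)

text \<open>Let \<open>U\<close> and \<open>W\<close> be the conjugate elements \<open>X \<plusminus> e s\<close>. Then \<open>U W \<equiv> p\<close> and \<open>2 X = U + W\<close>, so
\<open>4 X\<^sup>2 \<equiv> U\<^sup>2 + 2 p + p\<^sup>2 / U\<^sup>2\<close>, and in the last summand \<open>U\<^sup>2\<close> may be replaced by \<open>4 X\<^sup>2\<close>, to which
it is congruent modulo \<open>p\<close>.\<close>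

lemma unit_root_square:
  assumes u: "cong_p 3 (of_int (X + e * s)) (- C * F0)" and s: "[s\<^sup>2 = - 3] (mod int p ^ 3)"
    and norm: "int p = X\<^sup>2 + 3 * e\<^sup>2"
  shows "cong_p 3 (4 * (of_int X)\<^sup>2 - 2 * P - P\<^sup>2 / (4 * (of_int X)\<^sup>2)) (C\<^sup>2 * (F0 * F0))"
proof -
  define U :: rat where "U = of_int (X + e * s)"
  define W :: rat where "W = of_int (X - e * s)"
  have uU: "unit_p U"
    unfolding U_def using u log_exp_unit[OF log_exp_F0] unit_C by (intro unit_cong[OF u]) auto
  have U_sq: "cong_p 3 (U\<^sup>2) (C\<^sup>2 * (F0 * F0))"
  proof -
    have "cong_p 3 (U\<^sup>2) ((- C * F0)\<^sup>2)"
      unfolding U_def using u log_exp_unit[OF log_exp_F0] unit_C by (intro cong_power) auto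
    then show ?thesis by (simp add: power2_eq_square mult_ac)
  qed
  have "[X\<^sup>2 - e\<^sup>2 * s\<^sup>2 = X\<^sup>2 - e\<^sup>2 * (- 3)] (mod int p ^ 3)"
    by (intro Cong.cong_diff Cong.cong_mult Cong.cong_refl s)
  from cong_of_int[OF this] have "cong_p 3 (U * W) (of_int (X\<^sup>2 + 3 * e\<^sup>2))"
    by (simp add: U_def W_def power2_eq_square algebra_simps)
  then have UW: "cong_p 3 (U * W) P" unfolding norm[symmetric] by simp
  then have "cong_p 3 (U * W) (U * (P / U))" using unit_nz[OF uU] by simp
  then have W: "cong_p 3 W (P / U)" using uU by (rule cong_unit_cancel)
  have PU: "P / U \<in> Zp" using uU by auto
  have X2: "2 * of_int X = U + W" by (simp add: U_def W_def)
  have "4 * (of_int X)\<^sup>2 = (2 * of_int X :: rat)\<^sup>2" by (simp add: power_mult_distrib)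
  then have X4: "4 * (of_int X)\<^sup>2 = U\<^sup>2 + 2 * (U * W) + W\<^sup>2"
    unfolding X2 by (simp add: power2_eq_square algebra_simps)
  have c1: "cong_p 3 (4 * (of_int X)\<^sup>2) (U\<^sup>2 + 2 * P + (P / U)\<^sup>2)"
    unfolding X4 using UW W PU uU by (intro cong_add cong_mult_left cong_power) auto
  have "cong_p 1 (4 * (of_int X)\<^sup>2) (U\<^sup>2 + 2 * P + (P / U)\<^sup>2)"
    using c1 by (rule cong_mono) simp
  also have "cong_p 1 \<dots> (U\<^sup>2)"
    using uU by (intro congI[of _ _ _ "2 + P * (1 / U)\<^sup>2"]) (auto simp: power2_eq_square algebra_simps)
  finally have c2: "cong_p 1 (4 * (of_int X)\<^sup>2) (U\<^sup>2)" .
  have "cong_p 3 (P\<^sup>2 * (1 / (4 * (of_int X)\<^sup>2))) (P\<^sup>2 * (1 / U\<^sup>2))"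
    using c2 uU by (intro cong_mult_P2 cong_divide2) auto
  then have c3: "cong_p 3 (P\<^sup>2 / (4 * (of_int X)\<^sup>2)) ((P / U)\<^sup>2)" by (simp add: power_divide)
  have "cong_p 3 (4 * (of_int X)\<^sup>2 - 2 * P - P\<^sup>2 / (4 * (of_int X)\<^sup>2)) (U\<^sup>2 + 2 * P + (P / U)\<^sup>2 - 2 * P - (P / U)\<^sup>2)"
    using c1 c3 by (intro cong_diff) auto
  then have "cong_p 3 (4 * (of_int X)\<^sup>2 - 2 * P - P\<^sup>2 / (4 * (of_int X)\<^sup>2)) (U\<^sup>2)" by simp
  then show ?thesis using U_sq cong_trans by blast
qed

lemma split_target:
  assumes xy: "int p = x\<^sup>2 + 3 * y\<^sup>2"
  shows "cong_p 3 (4 * (of_int x)\<^sup>2 - 2 * P - P\<^sup>2 / (4 * (of_int x)\<^sup>2)) (C\<^sup>2 * (F0 * F0))"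
proof -
  interpret cub: cubic_prime p h
    by unfold_locales (rule prime_p, rule p_eq)
  obtain z where "teichmueller_root p h z" using cub.teichmueller_root_exists by blast
  then interpret t: teichmueller_root p h z .
  have h6: "6 * int h = int p - 1" by (simp add: p_eq)
  have "cong_p 3 (of_int (8 * t.J)) ((P - 1) * jacobi_binom)"
    using cong_of_int[OF t.J_binomial] unfolding h6 by (simp add: jacobi_binom_def)
  also note jacobi_binom_cong
  finally have "cong_p 3 (8 * of_int t.J) (8 * (- C * F0))" by (simp add: mult.assoc)
  then have "cong_p 3 (of_int t.J) (- C * F0)" by (rule cong_unit_cancel) simp
  with cong_sym[OF cong_of_int[OF t.J_cong]]
  have u: "cong_p 3 (of_int (t.X + t.e * (2 * t.w + 1))) (- C * F0)" by (rule cong_trans)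
  have "[4 * (t.w\<^sup>2 + t.w + 1) - 3 = 4 * 0 - 3] (mod int p ^ 3)"
    by (intro Cong.cong_diff Cong.cong_mult Cong.cong_refl t.w_quadratic)
  then have s: "[(2 * t.w + 1)\<^sup>2 = - 3] (mod int p ^ 3)"
    by (simp add: power2_eq_square algebra_simps)
  have "x\<^sup>2 = t.X\<^sup>2"
    using norm_form_unique[OF cub.prime_int xy t.norm_eq] .
  then have "(of_int x)\<^sup>2 = (of_int t.X :: rat)\<^sup>2" by (metis of_int_power)
  then show ?thesis using unit_root_square[OF u s t.norm_eq] by simp
qed

lemma split_sums: "cong_p 3 S4 (C\<^sup>2 * (F0 * F0))" "cong_p 3 S16 (C\<^sup>2 * (F0 * F0))"
  using S4_split[OF log_exp_F0_sq] S16_split[OF log_exp_F0_sq] .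

end

theorem theorem1p1:
  fixes p :: nat
  assumes "prime p" and "p > 3"
  shows "(\<forall>x y :: int. [p = 1] (mod 3) \<longrightarrow> int p = x\<^sup>2 + 3 * y\<^sup>2 \<longrightarrow>
            rat_cong p 3 (\<Sum>k=0..p-1. of_nat (domb k) / 4 ^ k)
                         (\<Sum>k=0..p-1. of_nat (domb k) / 16 ^ k) \<and>
            rat_cong p 3 (\<Sum>k=0..p-1. of_nat (domb k) / 16 ^ k)
                         (4 * (of_int x)\<^sup>2 - 2 * of_nat p
                            - (of_nat p)\<^sup>2 / (4 * (of_int x)\<^sup>2))) \<and>
         ([p = 2] (mod 3) \<longrightarrow>
            rat_cong p 3 (\<Sum>k=0..p-1. of_nat (domb k) / 4 ^ k)
                         (- 2 * (\<Sum>k=0..p-1. of_nat (domb k) / 16 ^ k)) \<and>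
            rat_cong p 3 (- 2 * (\<Sum>k=0..p-1. of_nat (domb k) / 16 ^ k))
                         ((of_nat p)\<^sup>2 / 2 *
                            inverse ((of_nat (((p - 1) div 2) choose ((p - 5) div 6)))\<^sup>2)))"
proof -
  interpret prime_gt_3 p using assms by unfold_locales
  have odd: "odd p" by (rule p_odd)
  show ?thesis
    unfolding S4_def[symmetric] S16_def[symmetric]
  proof (intro conjI allI impI)
    fix x y :: int
    assume p1: "[p = 1] (mod 3)" and xy: "int p = x\<^sup>2 + 3 * y\<^sup>2"
    have "p = 6 * (p div 6) + 1" using p1 odd unfolding cong_def by presburger
    then interpret split_prime p "p div 6" by unfold_locales
    show "rat_cong p 3 S4 S16"
      using split_sums(1) cong_sym[OF split_sums(2)] by (rule cong_trans)
    show "rat_cong p 3 S16 (4 * (of_int x)\<^sup>2 - 2 * of_nat p - (of_nat p)\<^sup>2 / (4 * (of_int x)\<^sup>2))"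
      using split_sums(2) cong_sym[OF split_target[OF xy]] by (rule cong_trans)
  next
    assume p2: "[p = 2] (mod 3)"
    have "p = 6 * (p div 6) + 5" using p2 odd unfolding cong_def by presburger
    then interpret inert_prime p "p div 6" by unfold_locales
    have idx: "(p - 1) div 2 = hp" "(p - 5) div 6 = p div 6"
      using p_eq by (simp_all add: hp_def)
    show "rat_cong p 3 S4 (- 2 * S16)"
      using inert_S4 cong_sym[OF inert_S16] by (rule cong_trans)
    show "rat_cong p 3 (- 2 * S16) ((of_nat p)\<^sup>2 / 2 * inverse ((of_nat (((p - 1) div 2) choose ((p - 5) div 6)))\<^sup>2))"
      unfolding idx using inert_S16 cong_sym[OF inert_target] by (rule cong_trans)
  qed
qed

end
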